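(* Let $\mathcal A$ be a locally small abelian category with enough projectives, and let $n\ge1$. Let $C^b(\mathcal A)$ be the abelian category of bounded cochain complexes over $\mathcal A$ (with componentwise exact sequences). For every $X^\bullet\in C^b(\mathcal A)$ one has $$X^\bullet\in\mathcal T^n(C^b(\mathcal A))\iff X^i\in\mathcal T^n(\mathcal A)\text{ for every }i.$$ Moreover, $$X^\bullet\in\mathcal T^\infty(C^b(\mathcal A))\iff X^i\in\mathcal T^\infty(\mathcal A)\text{ for every }i,$$ and $$X^\bullet\in\mathrm{GP}(C^b(\mathcal A))\iff X^i\in\mathrm{GP}(\mathcal A)\text{ for every }i.$$
   Context: $C^b(\mathcal A)$ has as objects all bounded cochain complexes (the bound may vary with the complex) and as morphisms chain maps; kernels, cokernels and exactness are degreewise, and it is an abelian category with enough projectives. For an abelian category $\mathcal C$ with enough projectives: $\mathcal P(\mathcal C)$ is the full subcategory of projectives. A morphism $f:M\to P$ with $P$ projective is a left projective approximation if every morphism from $M$ to a projective object factors through $f$. For $n\ge1$, $M$ is $n$-torsionfree if there is an exact sequence $0\to M\xrightarrow{f_1}P_1\xrightarrow{f_2}\cdots\xrightarrow{f_n}P_n$ with all $P_i$ projective such that each inclusion $\mathrm{Im} f_i\to P_i$ is a left projective approximation ($1\le i\le n$); $\mathcal T^n(\mathcal C)$ is the full subcategory of such objects and $\mathcal T^\infty(\mathcal C)=\bigcap_{n\ge1}\mathcal T^n(\mathcal C)$. An object is Gorenstein projective if it is isomorphic to the zeroth cocycle of a totally acyclic complex, i.e. of an acyclic complex of projectives, unbounded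 in both directions, that remains acyclic after applying $\mathrm{Hom}_{\mathcal C}(-,P)$ for every projective $P$; $\mathrm{GP}(\mathcal C)$ is the full subcategory of these objects. *)

theory Defs
  imports "HOL-Algebra.Coset"
begin

section \<open>Preadditive and abelian categories\<close>

record ('o, 'm) cat =
  Obj :: "'o set"
  Arr :: "'m set"
  Dom :: "'m \<Rightarrow> 'o"
  Cod :: "'m \<Rightarrow> 'o"
  Idn :: "'o \<Rightarrow> 'm"
  Comp :: "'m \<Rightarrow> 'm \<Rightarrow> 'm" (infixl \<open>\<cdot>\<index>\<close> 70)
  Plus :: "'m \<Rightarrow> 'm \<Rightarrow> 'm"
  Zero :: "'o \<Rightarrow> 'o \<Rightarrow> 'm"

definition Hom :: "('o, 'm) cat \<Rightarrow> 'o \<Rightarrow> 'o \<Rightarrow> 'm set" where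
  "Hom C X Y = {f \<in> Arr C. Dom C f = X \<and> Cod C f = Y}"

text \<open>The additive group of morphisms, in the multiplicative record of the algebra library.\<close>

definition HomGroup :: "('o, 'm) cat \<Rightarrow> 'o \<Rightarrow> 'o \<Rightarrow> 'm monoid" where
  "HomGroup C X Y = \<lparr>carrier = Hom C X Y, mult = Plus C, one = Zero C X Y\<rparr>"

text \<open>Every collection of morphisms is a set of HOL, so local smallness is built in.\<close>

locale category =
  fixes C :: "('o, 'm) cat" (structure)
  assumes Dom_Obj: "f \<in> Arr C \<Longrightarrow> Dom C f \<in> Obj C"
    and Cod_Obj: "f \<in> Arr C \<Longrightarrow> Cod C f \<in> Obj C"
    and Idn_Hom: "X \<in> Obj C \<Longrightarrow> Idn C X \<in> Hom C X X"
    and Comp_Hom: "f \<in> Hom C X Y \<Longrightarrow> g \<in> Hom C Y Z \<Longrightarrow> g \<cdot> f \<in> Hom C X Z"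
    and Comp_assoc: "f \<in> Hom C W X \<Longrightarrow> g \<in> Hom C X Y \<Longrightarrow> h \<in> Hom C Y Z \<Longrightarrow>
          (h \<cdot> g) \<cdot> f = h \<cdot> (g \<cdot> f)"
    and Comp_Idn: "f \<in> Hom C X Y \<Longrightarrow> f \<cdot> Idn C X = f"
    and Idn_Comp: "f \<in> Hom C X Y \<Longrightarrow> Idn C Y \<cdot> f = f"

locale preadditive_category = category +
  assumes Hom_comm_group: "X \<in> Obj C \<Longrightarrow> Y \<in> Obj C \<Longrightarrow> comm_group (HomGroup C X Y)"
    and Comp_Plus: "f \<in> Hom C X Y \<Longrightarrow> f' \<in> Hom C X Y \<Longrightarrow> g \<in> Hom C Y Z \<Longrightarrow>
          g \<cdot> Plus C f f' = Plus C (g \<cdot> f) (g \<cdot> f')"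
    and Plus_Comp: "f \<in> Hom C X Y \<Longrightarrow> g \<in> Hom C Y Z \<Longrightarrow> g' \<in> Hom C Y Z \<Longrightarrow>
          Plus C g g' \<cdot> f = Plus C (g \<cdot> f) (g' \<cdot> f)"

definition zero_object :: "('o, 'm) cat \<Rightarrow> 'o \<Rightarrow> bool" where
  "zero_object C Z \<longleftrightarrow> Z \<in> Obj C \<and>
     (\<forall>X\<in>Obj C. (\<exists>!f. f \<in> Hom C Z X) \<and> (\<exists>!f. f \<in> Hom C X Z))"

definition is_product :: "('o, 'm) cat \<Rightarrow> 'o \<Rightarrow> 'o \<Rightarrow> 'o \<Rightarrow> 'm \<Rightarrow> 'm \<Rightarrow> bool" where
  "is_product C X Y P p q \<longleftrightarrow> p \<in> Hom C P X \<and> q \<in> Hom C P Y \<and>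
     (\<forall>W\<in>Obj C. \<forall>f\<in>Hom C W X. \<forall>g\<in>Hom C W Y.
        \<exists>!h. h \<in> Hom C W P \<and> p \<cdot>\<^bsub>C\<^esub> h = f \<and> q \<cdot>\<^bsub>C\<^esub> h = g)"

definition monomorphism :: "('o, 'm) cat \<Rightarrow> 'm \<Rightarrow> bool" where
  "monomorphism C f \<longleftrightarrow> f \<in> Arr C \<and>
     (\<forall>W\<in>Obj C. \<forall>g\<in>Hom C W (Dom C f). \<forall>h\<in>Hom C W (Dom C f).
        f \<cdot>\<^bsub>C\<^esub> g = f \<cdot>\<^bsub>C\<^esub> h \<longrightarrow> g = h)"

definition epimorphism :: "('o, 'm) cat \<Rightarrow> 'm \<Rightarrow> bool" where
  "epimorphism C f \<longleftrightarrow> f \<in> Arr C \<and>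
     (\<forall>W\<in>Obj C. \<forall>g\<in>Hom C (Cod C f) W. \<forall>h\<in>Hom C (Cod C f) W.
        g \<cdot>\<^bsub>C\<^esub> f = h \<cdot>\<^bsub>C\<^esub> f \<longrightarrow> g = h)"

definition isomorphic_objects :: "('o, 'm) cat \<Rightarrow> 'o \<Rightarrow> 'o \<Rightarrow> bool" where
  "isomorphic_objects C X Y \<longleftrightarrow>
     (\<exists>f\<in>Hom C X Y. \<exists>g\<in>Hom C Y X. g \<cdot>\<^bsub>C\<^esub> f = Idn C X \<and> f \<cdot>\<^bsub>C\<^esub> g = Idn C Y)"

definition is_kernel :: "('o, 'm) cat \<Rightarrow> 'm \<Rightarrow> 'm \<Rightarrow> bool" where
  "is_kernel C k f \<longleftrightarrow> f \<in> Arr C \<and> k \<in> Arr C \<and> Cod C k = Dom C f \<and>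
     f \<cdot>\<^bsub>C\<^esub> k = Zero C (Dom C k) (Cod C f) \<and>
     (\<forall>W\<in>Obj C. \<forall>g\<in>Hom C W (Dom C f). f \<cdot>\<^bsub>C\<^esub> g = Zero C W (Cod C f) \<longrightarrow>
        (\<exists>!h. h \<in> Hom C W (Dom C k) \<and> k \<cdot>\<^bsub>C\<^esub> h = g))"

definition is_cokernel :: "('o, 'm) cat \<Rightarrow> 'm \<Rightarrow> 'm \<Rightarrow> bool" where
  "is_cokernel C c f \<longleftrightarrow> f \<in> Arr C \<and> c \<in> Arr C \<and> Dom C c = Cod C f \<and>
     c \<cdot>\<^bsub>C\<^esub> f = Zero C (Dom C f) (Cod C c) \<and>
     (\<forall>W\<in>Obj C. \<forall>g\<in>Hom C (Cod C f) W. g \<cdot>\<^bsub>C\<^esub> f = Zero C (Dom C f) W \<longrightarrow>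
        (\<exists>!h. h \<in> Hom C (Cod C c) W \<and> h \<cdot>\<^bsub>C\<^esub> c = g))"

locale abelian_category = preadditive_category +
  assumes ex_zero_object: "\<exists>Z. zero_object C Z"
    and ex_product: "X \<in> Obj C \<Longrightarrow> Y \<in> Obj C \<Longrightarrow> \<exists>P p q. is_product C X Y P p q"
    and ex_kernel: "f \<in> Arr C \<Longrightarrow> \<exists>k. is_kernel C k f"
    and ex_cokernel: "f \<in> Arr C \<Longrightarrow> \<exists>c. is_cokernel C c f"
    and mono_kernel: "monomorphism C f \<Longrightarrow> is_cokernel C c f \<Longrightarrow> is_kernel C f c"
    and epi_cokernel: "epimorphism C f \<Longrightarrow> is_kernel C k f \<Longrightarrow> is_cokernel C f k"

text \<open>\<open>is_image C j f\<close>: the morphism \<open>j\<close> is the inclusion of the image of \<open>f\<close> into the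
  codomain of \<open>f\<close>, that is, a kernel of a cokernel of \<open>f\<close>.\<close>

definition is_image :: "('o, 'm) cat \<Rightarrow> 'm \<Rightarrow> 'm \<Rightarrow> bool" where
  "is_image C j f \<longleftrightarrow> (\<exists>c. is_cokernel C c f \<and> is_kernel C j c)"

text \<open>\<open>f\<close> followed by \<open>g\<close> is exact at the middle object: \<open>Im f\<close> and \<open>Ker g\<close> are the same
  subobject.\<close>

definition exact_at :: "('o, 'm) cat \<Rightarrow> 'm \<Rightarrow> 'm \<Rightarrow> bool" where
  "exact_at C f g \<longleftrightarrow> f \<in> Arr C \<and> g \<in> Arr C \<and> Cod C f = Dom C g \<and>
     (\<exists>j. is_image C j f \<and> is_kernel C j g)"

section \<open>Projective, torsionfree and Gorenstein projective objects\<close>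

definition projective :: "('o, 'm) cat \<Rightarrow> 'o \<Rightarrow> bool" where
  "projective C P \<longleftrightarrow> P \<in> Obj C \<and>
     (\<forall>e f. epimorphism C e \<and> f \<in> Hom C P (Cod C e) \<longrightarrow>
        (\<exists>g\<in>Hom C P (Dom C e). e \<cdot>\<^bsub>C\<^esub> g = f))"

definition enough_projectives :: "('o, 'm) cat \<Rightarrow> bool" where
  "enough_projectives C \<longleftrightarrow>
     (\<forall>X\<in>Obj C. \<exists>e. epimorphism C e \<and> projective C (Dom C e) \<and> Cod C e = X)"

definition left_projective_approximation :: "('o, 'm) cat \<Rightarrow> 'm \<Rightarrow> bool" where
  "left_projective_approximation C f \<longleftrightarrow> f \<in> Arr C \<and> projective C (Cod C f) \<and>
     (\<forall>Q. projective C Q \<longrightarrow>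
        (\<forall>g\<in>Hom C (Dom C f) Q. \<exists>h\<in>Hom C (Cod C f) Q. h \<cdot>\<^bsub>C\<^esub> f = g))"

text \<open>In \<open>0 \<rightarrow> M \<rightarrow> P\<^sub>1 \<rightarrow> \<dots> \<rightarrow> P\<^sub>n\<close> the map \<open>0 \<rightarrow> M\<close> is \<open>f 0\<close>, and \<open>P\<^sub>i\<close> is the codomain of
  \<open>f i\<close> for \<open>1 \<le> i \<le> n\<close>; the sequence is exact at \<open>M, P\<^sub>1, \<dots>, P\<^sub>n\<^sub>-\<^sub>1\<close>, with no condition at \<open>P\<^sub>n\<close>.\<close>

definition torsionfree :: "nat \<Rightarrow> ('o, 'm) cat \<Rightarrow> 'o \<Rightarrow> bool" where
  "torsionfree n C M \<longleftrightarrow> (\<exists>f :: nat \<Rightarrow> 'm.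
     f 0 \<in> Arr C \<and> zero_object C (Dom C (f 0)) \<and> Cod C (f 0) = M \<and>
     (\<forall>i\<in>{1..n}. exact_at C (f (i - 1)) (f i) \<and> projective C (Cod C (f i)) \<and>
        (\<exists>j. is_image C j (f i) \<and> left_projective_approximation C j)))"

definition Tf :: "nat \<Rightarrow> ('o, 'm) cat \<Rightarrow> 'o set" where
  "Tf n C = {M \<in> Obj C. torsionfree n C M}"

definition Tf_infinity :: "('o, 'm) cat \<Rightarrow> 'o set" where
  "Tf_infinity C = (\<Inter>n\<in>{1..}. Tf n C)"

datatype ('o, 'm) cochain = Cochain (Term: "int \<Rightarrow> 'o") (Diff: "int \<Rightarrow> 'm")

definition is_complex :: "('o, 'm) cat \<Rightarrow> ('o, 'm) cochain \<Rightarrow> bool" where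
  "is_complex C X \<longleftrightarrow>
     (\<forall>i. Term X i \<in> Obj C \<and> Diff X i \<in> Hom C (Term X i) (Term X (i + 1)) \<and>
        Diff X (i + 1) \<cdot>\<^bsub>C\<^esub> Diff X i = Zero C (Term X i) (Term X (i + 2)))"

text \<open>The last conjunct is exactness of \<open>Hom(T\<^sup>i\<^sup>+\<^sup>2, Q) \<rightarrow> Hom(T\<^sup>i\<^sup>+\<^sup>1, Q) \<rightarrow> Hom(T\<^sup>i, Q)\<close> as groups.\<close>

definition totally_acyclic :: "('o, 'm) cat \<Rightarrow> ('o, 'm) cochain \<Rightarrow> bool" where
  "totally_acyclic C T \<longleftrightarrow> is_complex C T \<and>
     (\<forall>i. projective C (Term T i)) \<and>
     (\<forall>i. exact_at C (Diff T i) (Diff T (i + 1))) \<and>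
     (\<forall>Q. projective C Q \<longrightarrow> (\<forall>i.
        (\<lambda>g. g \<cdot>\<^bsub>C\<^esub> Diff T (i + 1)) ` Hom C (Term T (i + 2)) Q =
        kernel (HomGroup C (Term T (i + 1)) Q) (HomGroup C (Term T i) Q) (\<lambda>g. g \<cdot>\<^bsub>C\<^esub> Diff T i)))"

definition GP :: "('o, 'm) cat \<Rightarrow> 'o set" where
  "GP C = {M \<in> Obj C. \<exists>T k. totally_acyclic C T \<and> is_kernel C k (Diff T 0) \<and>
     isomorphic_objects C M (Dom C k)}"

section \<open>The category of bounded cochain complexes\<close>

definition is_bounded :: "('o, 'm) cat \<Rightarrow> ('o, 'm) cochain \<Rightarrow> bool" where
  "is_bounded C X \<longleftrightarrow> (\<exists>a b :: int. \<forall>i. i < a \<or> b < i \<longrightarrow> zero_object C (Term X i))"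

datatype ('o, 'm) chain_map =
  ChainMap (Source: "('o, 'm) cochain") (Target: "('o, 'm) cochain") (Component: "int \<Rightarrow> 'm")

definition is_chain_map :: "('o, 'm) cat \<Rightarrow> ('o, 'm) chain_map \<Rightarrow> bool" where
  "is_chain_map C f \<longleftrightarrow>
     (\<forall>i. Component f i \<in> Hom C (Term (Source f) i) (Term (Target f) i) \<and>
        Diff (Target f) i \<cdot>\<^bsub>C\<^esub> Component f i = Component f (i + 1) \<cdot>\<^bsub>C\<^esub> Diff (Source f) i)"

definition bounded_complexes :: "('o, 'm) cat \<Rightarrow> ('o, 'm) cochain set" where
  "bounded_complexes C = {X. is_complex C X \<and> is_bounded C X}"

definition Cb :: "('o, 'm) cat \<Rightarrow> (('o, 'm) cochain, ('o, 'm) chain_map) cat" where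
  "Cb C = \<lparr>
     Obj = bounded_complexes C,
     Arr = {f. Source f \<in> bounded_complexes C \<and> Target f \<in> bounded_complexes C \<and> is_chain_map C f},
     Dom = Source,
     Cod = Target,
     Idn = (\<lambda>X. ChainMap X X (\<lambda>i. Idn C (Term X i))),
     Comp = (\<lambda>g f. ChainMap (Source f) (Target g) (\<lambda>i. Component g i \<cdot>\<^bsub>C\<^esub> Component f i)),
     Plus = (\<lambda>f g. ChainMap (Source f) (Target f) (\<lambda>i. Plus C (Component f i) (Component g i))),
     Zero = (\<lambda>X Y. ChainMap X Y (\<lambda>i. Zero C (Term X i) (Term Y i)))\<rparr>"

end

theory Submission
  imports Defs
begin

text \<open>
  Call a short exact sequence \<open>0 \<rightarrow> M \<rightarrow> P \<rightarrow> N \<rightarrow> 0\<close> an approximation sequence if \<open>M \<rightarrow> P\<close> is a left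
  projective approximation. An object is \<open>(n + 1)\<close>-torsionfree iff it starts an approximation
  sequence whose last term is \<open>n\<close>-torsionfree, and Gorenstein projective iff it belongs to a doubly
  infinite chain of approximation sequences. Both classes are closed under adding a projective
  summand.

  Every projective bounded complex is a direct summand of a sum \<open>E(Q)\<close> of contractible two-term
  complexes on projective objects \<open>Q\<^sup>i\<close>. Chain maps into \<open>E(Q)\<close> are just families of morphisms
  \<open>X\<^sup>i \<rightarrow> Q\<^sup>i\<close>, so being an approximation sequence can be checked in each degree. Conversely,
  approximation sequences \<open>0 \<rightarrow> X\<^sup>i \<rightarrow> P\<^sup>i \<rightarrow> N\<^sup>i \<rightarrow> 0\<close> yield a monomorphism \<open>X \<rightarrow> E(P)\<close>; after a shear
  of \<open>P\<^sup>i \<oplus> P\<^sup>i\<^sup>+\<^sup>1\<close> its cokernel is \<open>N\<^sup>i \<oplus> P\<^sup>i\<^sup>+\<^sup>1\<close> in degree \<open>i\<close>. Hence the cosyzygies of a complex are, in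
  each degree, cosyzygies of its terms up to projective summands, and dually for syzygies.
\<close>

text \<open>The obstacle is that cosyzygies in \<open>Cb C\<close> cannot be prescribed degree by
  degree: approximations chosen for the single terms need not commute with the differentials.
  Passing to E(P) turns any family into a chain map, at the price of a second coordinate, the next
  approximation after the differential. Since its target is projective, the approximation property
  extends this coordinate over the first one, and the extension is the arrow that defines the shear.
  For syzygies the corresponding arrow is a lift, supplied by projectivity. The summand that remains
  makes the new terms differ from the chosen ones, so a step can be repeated only because both
  classes absorb projective summands. For torsionfreeness the repetition is an induction on n over
  all complexes. Gorenstein projectivity has no first or last step and is reached by coinduction: in
  a class where every object has a cosyzygy and a syzygy inside the class, all objects are
  Gorenstein projective. Each complex must be bounded, though the bounds may grow from step to step;
  hence zero terms are always resolved by zero objects.\<close>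

lemma Hom_iff [simp]: "f \<in> Hom C X Y \<longleftrightarrow> f \<in> Arr C \<and> Dom C f = X \<and> Cod C f = Y"
  by (auto simp: Hom_def)

section \<open>Preadditive categories\<close>

context category
begin

declare Dom_Obj [simp] Cod_Obj [simp]

text \<open>Typing is kept as equations for \<open>Dom\<close> and \<open>Cod\<close> instead of
  membership in \<open>Hom\<close>, so that rewriting can discharge the side conditions of long
  calculations.\<close>

lemma Comp_Arr [simp]:
  assumes "f \<in> Arr C" "g \<in> Arr C" "Cod C f = Dom C g"
  shows "g \<cdot> f \<in> Arr C" "Dom C (g \<cdot> f) = Dom C f" "Cod C (g \<cdot> f) = Cod C g"
  using Comp_Hom[of f "Dom C f" "Dom C g" g "Cod C g"] assms by auto

lemma Comp_assoc_Arr [simp]: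
  assumes "f \<in> Arr C" "g \<in> Arr C" "h \<in> Arr C" "Cod C f = Dom C g" "Cod C g = Dom C h"
  shows "(h \<cdot> g) \<cdot> f = h \<cdot> (g \<cdot> f)"
  using Comp_assoc[of f _ _ g _ h] assms by auto

lemma Idn_Arr [simp]:
  assumes "X \<in> Obj C"
  shows "Idn C X \<in> Arr C" "Dom C (Idn C X) = X" "Cod C (Idn C X) = X"
  using Idn_Hom[OF assms] by auto

lemma Comp_Idn_Arr [simp]: "f \<in> Arr C \<Longrightarrow> Dom C f = X \<Longrightarrow> f \<cdot> Idn C X = f"
  using Comp_Idn[of f X "Cod C f"] by auto

lemma Idn_Comp_Arr [simp]: "f \<in> Arr C \<Longrightarrow> Cod C f = X \<Longrightarrow> Idn C X \<cdot> f = f"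
  using Idn_Comp[of f "Dom C f" X] by auto

lemma mono_cancel:
  assumes "monomorphism C f" "f \<cdot> g = f \<cdot> h" "g \<in> Arr C" "h \<in> Arr C"
    "Cod C g = Dom C f" "Cod C h = Dom C f" "Dom C g = Dom C h"
  shows "g = h"
  using assms unfolding monomorphism_def by (metis Hom_iff Dom_Obj)

lemma epi_cancel:
  assumes "epimorphism C f" "g \<cdot> f = h \<cdot> f" "g \<in> Arr C" "h \<in> Arr C"
    "Dom C g = Cod C f" "Dom C h = Cod C f" "Cod C g = Cod C h"
  shows "g = h"
  using assms unfolding epimorphism_def by (metis Hom_iff Cod_Obj)

lemma mono_Comp:
  assumes f: "monomorphism C f" and g: "monomorphism C g" and fg: "Cod C f = Dom C g"
  shows "monomorphism C (g \<cdot> f)"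
proof -
  have A: "f \<in> Arr C" "g \<in> Arr C" using f g by (auto simp: monomorphism_def)
  have "x = y" if "x \<in> Arr C" "y \<in> Arr C" "Dom C x = Dom C y" "Cod C x = Dom C f"
    "Cod C y = Dom C f" "g \<cdot> (f \<cdot> x) = g \<cdot> (f \<cdot> y)" for x y
    using mono_cancel[OF g that(6)] mono_cancel[OF f, of x y] that A fg by auto
  then show ?thesis unfolding monomorphism_def using A fg by auto
qed

lemma epi_Comp:
  assumes f: "epimorphism C f" and g: "epimorphism C g" and fg: "Cod C f = Dom C g"
  shows "epimorphism C (g \<cdot> f)"
proof -
  have A: "f \<in> Arr C" "g \<in> Arr C" using f g by (auto simp: epimorphism_def)
  have "x = y" if "x \<in> Arr C" "y \<in> Arr C" "Cod C x = Cod C y" "Dom C x = Cod C g"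
    "Dom C y = Cod C g" "(x \<cdot> g) \<cdot> f = (y \<cdot> g) \<cdot> f" for x y
    using epi_cancel[OF f that(6)] epi_cancel[OF g, of x y] that A fg by auto
  then show ?thesis unfolding epimorphism_def using A fg by auto
qed

lemma split_mono:
  assumes "r \<cdot> s = Idn C (Dom C s)" "s \<in> Arr C" "r \<in> Arr C" "Cod C s = Dom C r"
  shows "monomorphism C s"
proof -
  have "x = y" if "x \<in> Arr C" "y \<in> Arr C" "Dom C x = Dom C y" "Cod C x = Dom C s"
    "Cod C y = Dom C s" "s \<cdot> x = s \<cdot> y" for x y
  proof -
    have "(r \<cdot> s) \<cdot> x = (r \<cdot> s) \<cdot> y" using that assms(2-) by simp
    then show ?thesis using that assms by simp
  qed
  then show ?thesis unfolding monomorphism_def using assms by auto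
qed

lemma split_epi:
  assumes "r \<cdot> s = Idn C (Cod C r)" "s \<in> Arr C" "r \<in> Arr C" "Cod C s = Dom C r"
  shows "epimorphism C r"
proof -
  have "Dom C s = Cod C r" using assms by (metis Comp_Arr(2) Cod_Obj Idn_Arr(2))
  moreover have "x = y" if "x \<in> Arr C" "y \<in> Arr C" "Cod C x = Cod C y" "Dom C x = Cod C r"
    "Dom C y = Cod C r" "x \<cdot> r = y \<cdot> r" for x y
  proof -
    have "x = (x \<cdot> r) \<cdot> s" using that(1,4) assms by simp
    also have "\<dots> = (y \<cdot> r) \<cdot> s" using that(6) by simp
    also have "\<dots> = y" using that(2,5) assms by simp
    finally show ?thesis .
  qed
  ultimately show ?thesis unfolding epimorphism_def using assms by auto
qed

text \<open>Lift \<open>f \<cdot> r\<close> from the projective \<open>P\<close>, then restrict the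
  lift along the section \<open>s\<close>.\<close>

lemma retract_projective:
  assumes P: "projective C P" and r: "r \<in> Hom C P R" and s: "s \<in> Hom C R P"
    and rs: "r \<cdot> s = Idn C R"
  shows "projective C R"
  unfolding projective_def
proof (intro conjI allI impI)
  show "R \<in> Obj C" using r by auto
  fix e f assume ef: "epimorphism C e \<and> f \<in> Hom C R (Cod C e)"
  then have e: "e \<in> Arr C" by (auto simp: epimorphism_def)
  have "f \<cdot> r \<in> Hom C P (Cod C e)" using ef r by auto
  then obtain g where g: "g \<in> Hom C P (Dom C e)" "e \<cdot> g = f \<cdot> r"
    using P ef unfolding projective_def by blast
  have "e \<cdot> (g \<cdot> s) = (f \<cdot> r) \<cdot> s"
    using g e s by (metis Comp_assoc_Arr Hom_iff)
  also have "\<dots> = f" using ef r s rs by simp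
  finally show "\<exists>g\<in>Hom C R (Dom C e). e \<cdot> g = f" using g s by (intro bexI[of _ "g \<cdot> s"]) auto
qed

end

section \<open>Addition of morphisms, kernels and cokernels\<close>

context preadditive_category
begin

lemma Plus_Arr [simp]:
  assumes "f \<in> Arr C" "g \<in> Arr C" "Dom C f = Dom C g" "Cod C f = Cod C g"
  shows "Plus C f g \<in> Arr C" "Dom C (Plus C f g) = Dom C g" "Cod C (Plus C f g) = Cod C g"
proof -
  interpret comm_group "HomGroup C (Dom C g) (Cod C g)"
    using Hom_comm_group assms by simp
  show "Plus C f g \<in> Arr C" "Dom C (Plus C f g) = Dom C g" "Cod C (Plus C f g) = Cod C g"
    using m_closed[of f g] assms by (auto simp: HomGroup_def)
qed

lemma Zero_Arr [simp]:
  assumes "X \<in> Obj C" "Y \<in> Obj C"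
  shows "Zero C X Y \<in> Arr C" "Dom C (Zero C X Y) = X" "Cod C (Zero C X Y) = Y"
proof -
  interpret comm_group "HomGroup C X Y" using Hom_comm_group assms by simp
  show "Zero C X Y \<in> Arr C" "Dom C (Zero C X Y) = X" "Cod C (Zero C X Y) = Y"
    using one_closed by (auto simp: HomGroup_def)
qed

lemma Plus_Zero [simp]:
  assumes "f \<in> Arr C" "Dom C f = X" "Cod C f = Y"
  shows "Plus C f (Zero C X Y) = f" "Plus C (Zero C X Y) f = f"
proof -
  interpret comm_group "HomGroup C X Y" using Hom_comm_group assms by auto
  show "Plus C f (Zero C X Y) = f" "Plus C (Zero C X Y) f = f"
    using r_one[of f] l_one[of f] assms by (auto simp: HomGroup_def)
qed

lemma Plus_commute:
  assumes "f \<in> Arr C" "g \<in> Arr C" "Dom C f = Dom C g" "Cod C f = Cod C g"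
  shows "Plus C f g = Plus C g f"
proof -
  interpret comm_group "HomGroup C (Dom C g) (Cod C g)" using Hom_comm_group assms by auto
  show ?thesis using m_comm[of f g] assms by (auto simp: HomGroup_def)
qed

lemma Plus_assoc [simp]:
  assumes "f \<in> Arr C" "g \<in> Arr C" "h \<in> Arr C" "Dom C f = Dom C g" "Cod C f = Cod C g"
    "Dom C g = Dom C h" "Cod C g = Cod C h"
  shows "Plus C (Plus C f g) h = Plus C f (Plus C g h)"
proof -
  interpret comm_group "HomGroup C (Dom C g) (Cod C g)" using Hom_comm_group assms by auto
  show ?thesis using m_assoc[of f g h] assms by (auto simp: HomGroup_def)
qed

text \<open>A category record has no negation; negatives are taken from the inverses of the group of
  morphisms.\<close>

lemma ex_minus:
  assumes "f \<in> Arr C"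
  obtains g where "g \<in> Arr C" "Dom C g = Dom C f" "Cod C g = Cod C f"
    "Plus C f g = Zero C (Dom C f) (Cod C f)" "Plus C g f = Zero C (Dom C f) (Cod C f)"
proof -
  interpret comm_group "HomGroup C (Dom C f) (Cod C f)" using Hom_comm_group assms by auto
  have "f \<in> carrier (HomGroup C (Dom C f) (Cod C f))" using assms by (simp add: HomGroup_def)
  from inv_closed[OF this] l_inv[OF this] r_inv[OF this] show ?thesis
    by (intro that[of "inv\<^bsub>HomGroup C (Dom C f) (Cod C f)\<^esub> f"]) (simp_all add: HomGroup_def)
qed

lemma Comp_Plus_Arr [simp]:
  assumes "f \<in> Arr C" "f' \<in> Arr C" "g \<in> Arr C" "Dom C f = Dom C f'" "Cod C f = Dom C g"
    "Cod C f' = Dom C g"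
  shows "g \<cdot> Plus C f f' = Plus C (g \<cdot> f) (g \<cdot> f')"
  using Comp_Plus[of f "Dom C f" "Dom C g" f' g "Cod C g"] assms by auto

lemma Plus_Comp_Arr [simp]:
  assumes "f \<in> Arr C" "g \<in> Arr C" "g' \<in> Arr C" "Cod C g = Cod C g'" "Cod C f = Dom C g"
    "Cod C f = Dom C g'"
  shows "Plus C g g' \<cdot> f = Plus C (g \<cdot> f) (g' \<cdot> f)"
  using Plus_Comp[of f "Dom C f" "Dom C g" g "Cod C g" g'] assms by auto

lemma Plus_left_cancel:
  assumes "Plus C f g = Plus C f h" "f \<in> Arr C" "g \<in> Arr C" "h \<in> Arr C"
    "Dom C f = Dom C g" "Cod C f = Cod C g" "Dom C h = Dom C g" "Cod C h = Cod C g"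
  shows "g = h"
proof -
  obtain f' where f': "f' \<in> Arr C" "Dom C f' = Dom C f" "Cod C f' = Cod C f"
    "Plus C f' f = Zero C (Dom C f) (Cod C f)" using ex_minus[OF assms(2)] by metis
  have "g = Plus C (Plus C f' f) g" using f' assms by simp
  also have "\<dots> = Plus C (Plus C f' f) h" using f'(1-3) assms by simp
  also have "\<dots> = h" unfolding f'(4) using assms by simp
  finally show ?thesis .
qed

text \<open>Distributivity makes the composite additively idempotent, and cancellation then makes it
  zero.\<close>

lemma Comp_Zero [simp]:
  assumes "g \<in> Arr C" "Dom C g = Y" "X \<in> Obj C"
  shows "g \<cdot> Zero C X Y = Zero C X (Cod C g)"
proof -
  have Y: "Y \<in> Obj C" using assms by auto
  then have Z: "Plus C (Zero C X Y) (Zero C X Y) = Zero C X Y" using assms by simp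
  have "Plus C (g \<cdot> Zero C X Y) (g \<cdot> Zero C X Y) = g \<cdot> Plus C (Zero C X Y) (Zero C X Y)"
    by (subst Comp_Plus_Arr) (use assms Y in simp_all)
  also have "\<dots> = Plus C (g \<cdot> Zero C X Y) (Zero C X (Cod C g))"
    unfolding Z using assms Y by simp
  finally show ?thesis by (rule Plus_left_cancel) (use assms Y in auto)
qed

lemma Zero_Comp [simp]:
  assumes "g \<in> Arr C" "Cod C g = X" "Y \<in> Obj C"
  shows "Zero C X Y \<cdot> g = Zero C (Dom C g) Y"
proof -
  have X: "X \<in> Obj C" using assms by auto
  have "Plus C (Zero C X Y \<cdot> g) (Zero C X Y \<cdot> g) = Plus C (Zero C X Y) (Zero C X Y) \<cdot> g"
    using assms X by (subst Plus_Comp_Arr) auto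
  also have "\<dots> = Plus C (Zero C X Y \<cdot> g) (Zero C (Dom C g) Y)"
    using assms X by simp
  finally show ?thesis by (rule Plus_left_cancel) (use assms X in auto)
qed

text \<open>Two arrows with equal composites differ by an arrow whose composite is zero; in the
  proof \<open>h'\<close> is the negative of \<open>h\<close>. In this form injectivity can be
  checked on coordinates of sums.\<close>

lemma mono_iff_Zero:
  "monomorphism C f \<longleftrightarrow> f \<in> Arr C \<and> (\<forall>g\<in>Arr C. Cod C g = Dom C f \<longrightarrow>
     f \<cdot> g = Zero C (Dom C g) (Cod C f) \<longrightarrow> g = Zero C (Dom C g) (Dom C f))"
proof
  assume f: "monomorphism C f"
  then have A: "f \<in> Arr C" by (simp add: monomorphism_def)
  have "g = Zero C (Dom C g) (Dom C f)" if "g \<in> Arr C" "Cod C g = Dom C f"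
    "f \<cdot> g = Zero C (Dom C g) (Cod C f)" for g
    by (rule mono_cancel[OF f]) (use that A in simp_all)
  with A show "f \<in> Arr C \<and> (\<forall>g\<in>Arr C. Cod C g = Dom C f \<longrightarrow>
     f \<cdot> g = Zero C (Dom C g) (Cod C f) \<longrightarrow> g = Zero C (Dom C g) (Dom C f))"
    by blast
next
  assume *: "f \<in> Arr C \<and> (\<forall>g\<in>Arr C. Cod C g = Dom C f \<longrightarrow>
     f \<cdot> g = Zero C (Dom C g) (Cod C f) \<longrightarrow> g = Zero C (Dom C g) (Dom C f))"
  have "g = h" if "g \<in> Arr C" "h \<in> Arr C" "Dom C g = Dom C h" "Cod C g = Dom C f"
    "Cod C h = Dom C f" "f \<cdot> g = f \<cdot> h" for g h
  proof -
    obtain h' where h': "h' \<in> Arr C" "Dom C h' = Dom C h" "Cod C h' = Cod C h"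
      "Plus C h' h = Zero C (Dom C h) (Cod C h)" using ex_minus \<open>h \<in> Arr C\<close> by metis
    have f: "f \<in> Arr C" using * by blast
    have "f \<cdot> Plus C h' g = f \<cdot> Plus C h' h" using that h'(1-3) f by simp
    also have "\<dots> = Zero C (Dom C h) (Cod C f)" using that h' f by simp
    finally have "Plus C h' g = Zero C (Dom C (Plus C h' g)) (Dom C f)"
      by (intro *[THEN conjunct2, rule_format]) (use that h' f in auto)
    then have "Plus C h' g = Plus C h' h" using that h' by simp
    then show ?thesis by (rule Plus_left_cancel) (use that h' in auto)
  qed
  then show "monomorphism C f" using * by (auto simp: monomorphism_def)
qed

lemma epi_iff_Zero:
  "epimorphism C f \<longleftrightarrow> f \<in> Arr C \<and> (\<forall>g\<in>Arr C. Dom C g = Cod C f \<longrightarrow>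
     g \<cdot> f = Zero C (Dom C f) (Cod C g) \<longrightarrow> g = Zero C (Cod C f) (Cod C g))"
proof
  assume f: "epimorphism C f"
  then have A: "f \<in> Arr C" by (simp add: epimorphism_def)
  have "g = Zero C (Cod C f) (Cod C g)" if "g \<in> Arr C" "Dom C g = Cod C f"
    "g \<cdot> f = Zero C (Dom C f) (Cod C g)" for g
    by (rule epi_cancel[OF f]) (use that A in simp_all)
  with A show "f \<in> Arr C \<and> (\<forall>g\<in>Arr C. Dom C g = Cod C f \<longrightarrow>
     g \<cdot> f = Zero C (Dom C f) (Cod C g) \<longrightarrow> g = Zero C (Cod C f) (Cod C g))"
    by blast
next
  assume *: "f \<in> Arr C \<and> (\<forall>g\<in>Arr C. Dom C g = Cod C f \<longrightarrow>
     g \<cdot> f = Zero C (Dom C f) (Cod C g) \<longrightarrow> g = Zero C (Cod C f) (Cod C g))"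
  have "g = h" if "g \<in> Arr C" "h \<in> Arr C" "Cod C g = Cod C h" "Dom C g = Cod C f"
    "Dom C h = Cod C f" "g \<cdot> f = h \<cdot> f" for g h
  proof -
    obtain h' where h': "h' \<in> Arr C" "Dom C h' = Dom C h" "Cod C h' = Cod C h"
      "Plus C h' h = Zero C (Dom C h) (Cod C h)" using ex_minus \<open>h \<in> Arr C\<close> by metis
    have f: "f \<in> Arr C" using * by blast
    have "Plus C h' g \<cdot> f = Plus C h' h \<cdot> f" using that h'(1-3) f by simp
    also have "\<dots> = Zero C (Dom C f) (Cod C h)" using that h' f by simp
    finally have "Plus C h' g = Zero C (Cod C f) (Cod C (Plus C h' g))"
      by (intro *[THEN conjunct2, rule_format]) (use that h' f in auto)
    then have "Plus C h' g = Plus C h' h" using that h' by simp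
    then show ?thesis by (rule Plus_left_cancel) (use that h' in auto)
  qed
  then show "epimorphism C f" using * by (auto simp: epimorphism_def)
qed

text \<open>The last conclusion is the uniqueness half of the universal property: an arrow killed by
  \<open>k\<close> and the zero arrow are both factorizations of the same zero arrow.\<close>

lemma is_kernelD:
  assumes "is_kernel C k f"
  shows "k \<in> Arr C" "f \<in> Arr C" "Cod C k = Dom C f" "f \<cdot> k = Zero C (Dom C k) (Cod C f)"
    "monomorphism C k"
proof -
  show *: "k \<in> Arr C" "f \<in> Arr C" "Cod C k = Dom C f" "f \<cdot> k = Zero C (Dom C k) (Cod C f)"
    using assms by (auto simp: is_kernel_def)
  have U: "\<exists>!h. h \<in> Hom C W (Dom C k) \<and> k \<cdot> h = g"
    if "W \<in> Obj C" "g \<in> Hom C W (Dom C f)" "f \<cdot> g = Zero C W (Cod C f)" for W g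
    using assms that unfolding is_kernel_def by blast
  have "g = Zero C (Dom C g) (Dom C k)"
    if g: "g \<in> Arr C" "Cod C g = Dom C k" "k \<cdot> g = Zero C (Dom C g) (Cod C k)" for g
  proof -
    have "f \<cdot> Zero C (Dom C g) (Dom C f) = Zero C (Dom C g) (Cod C f)"
      using * g by simp
    moreover have "Zero C (Dom C g) (Dom C f) \<in> Hom C (Dom C g) (Dom C f)"
      using * g by simp
    ultimately have "\<exists>!h. h \<in> Hom C (Dom C g) (Dom C k) \<and> k \<cdot> h = Zero C (Dom C g) (Dom C f)"
      by (intro U) (use g in auto)
    moreover have "g \<in> Hom C (Dom C g) (Dom C k)" "Zero C (Dom C g) (Dom C k) \<in> Hom C (Dom C g) (Dom C k)"
      "k \<cdot> g = Zero C (Dom C g) (Dom C f)" "k \<cdot> Zero C (Dom C g) (Dom C k) = Zero C (Dom C g) (Dom C f)"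
      using g * by auto
    ultimately show ?thesis by blast
  qed
  then show "monomorphism C k" using * by (simp add: mono_iff_Zero)
qed

lemma is_kernelE:
  assumes "is_kernel C k f" "g \<in> Arr C" "Cod C g = Dom C f"
    "f \<cdot> g = Zero C (Dom C g) (Cod C f)"
  obtains h where "h \<in> Arr C" "Dom C h = Dom C g" "Cod C h = Dom C k" "k \<cdot> h = g"
proof -
  have "\<exists>h. h \<in> Hom C (Dom C g) (Dom C k) \<and> k \<cdot> h = g"
    using assms unfolding is_kernel_def by (metis Hom_iff Dom_Obj)
  then show ?thesis using that by auto
qed

text \<open>Uniqueness of the factorization is traded for \<open>k\<close> being a monomorphism,
  which leaves its existence to be shown.\<close>

lemma is_kernelI:
  assumes "f \<in> Arr C" "Cod C k = Dom C f" "f \<cdot> k = Zero C (Dom C k) (Cod C f)"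
    and k: "monomorphism C k"
    and ex: "\<And>g. g \<in> Arr C \<Longrightarrow> Cod C g = Dom C f \<Longrightarrow> f \<cdot> g = Zero C (Dom C g) (Cod C f) \<Longrightarrow>
      \<exists>h. h \<in> Arr C \<and> Dom C h = Dom C g \<and> Cod C h = Dom C k \<and> k \<cdot> h = g"
  shows "is_kernel C k f"
proof -
  have "k \<in> Arr C" using k by (simp add: monomorphism_def)
  moreover have "\<exists>!h. h \<in> Hom C W (Dom C k) \<and> k \<cdot> h = g"
    if g: "g \<in> Hom C W (Dom C f)" "f \<cdot> g = Zero C W (Cod C f)" for g W
  proof -
    obtain h where "h \<in> Hom C W (Dom C k)" "k \<cdot> h = g" using ex[of g] g by auto
    then show ?thesis using mono_cancel[OF k] by (intro ex1I[of _ h]) auto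
  qed
  ultimately show ?thesis using assms(1-3) unfolding is_kernel_def by blast
qed

lemma is_cokernelD:
  assumes "is_cokernel C c f"
  shows "c \<in> Arr C" "f \<in> Arr C" "Dom C c = Cod C f" "c \<cdot> f = Zero C (Dom C f) (Cod C c)"
    "epimorphism C c"
proof -
  show *: "c \<in> Arr C" "f \<in> Arr C" "Dom C c = Cod C f" "c \<cdot> f = Zero C (Dom C f) (Cod C c)"
    using assms by (auto simp: is_cokernel_def)
  have U: "\<exists>!h. h \<in> Hom C (Cod C c) W \<and> h \<cdot> c = g"
    if "W \<in> Obj C" "g \<in> Hom C (Cod C f) W" "g \<cdot> f = Zero C (Dom C f) W" for W g
    using assms that unfolding is_cokernel_def by blast
  have "g = Zero C (Cod C c) (Cod C g)"
    if g: "g \<in> Arr C" "Dom C g = Cod C c" "g \<cdot> c = Zero C (Dom C c) (Cod C g)" for g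
  proof -
    have "Zero C (Cod C f) (Cod C g) \<cdot> f = Zero C (Dom C f) (Cod C g)"
      using * g by simp
    moreover have "Zero C (Cod C f) (Cod C g) \<in> Hom C (Cod C f) (Cod C g)"
      using * g by simp
    ultimately have "\<exists>!h. h \<in> Hom C (Cod C c) (Cod C g) \<and> h \<cdot> c = Zero C (Cod C f) (Cod C g)"
      by (intro U) (use g in auto)
    moreover have "g \<in> Hom C (Cod C c) (Cod C g)" "Zero C (Cod C c) (Cod C g) \<in> Hom C (Cod C c) (Cod C g)"
      "g \<cdot> c = Zero C (Cod C f) (Cod C g)" "Zero C (Cod C c) (Cod C g) \<cdot> c = Zero C (Cod C f) (Cod C g)"
      using g * by auto
    ultimately show ?thesis by blast
  qed
  then show "epimorphism C c" using * by (simp add: epi_iff_Zero)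
qed

lemma is_cokernelE:
  assumes "is_cokernel C c f" "g \<in> Arr C" "Dom C g = Cod C f"
    "g \<cdot> f = Zero C (Dom C f) (Cod C g)"
  obtains h where "h \<in> Arr C" "Dom C h = Cod C c" "Cod C h = Cod C g" "h \<cdot> c = g"
proof -
  have "\<exists>h. h \<in> Hom C (Cod C c) (Cod C g) \<and> h \<cdot> c = g"
    using assms unfolding is_cokernel_def by (metis Hom_iff Cod_Obj)
  then show ?thesis using that by auto
qed

lemma is_cokernelI:
  assumes "f \<in> Arr C" "Dom C c = Cod C f" "c \<cdot> f = Zero C (Dom C f) (Cod C c)"
    and c: "epimorphism C c"
    and ex: "\<And>g. g \<in> Arr C \<Longrightarrow> Dom C g = Cod C f \<Longrightarrow> g \<cdot> f = Zero C (Dom C f) (Cod C g) \<Longrightarrow>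
      \<exists>h. h \<in> Arr C \<and> Dom C h = Cod C c \<and> Cod C h = Cod C g \<and> h \<cdot> c = g"
  shows "is_cokernel C c f"
proof -
  have "c \<in> Arr C" using c by (simp add: epimorphism_def)
  moreover have "\<exists>!h. h \<in> Hom C (Cod C c) W \<and> h \<cdot> c = g"
    if g: "g \<in> Hom C (Cod C f) W" "g \<cdot> f = Zero C (Dom C f) W" for g W
  proof -
    obtain h where "h \<in> Hom C (Cod C c) W" "h \<cdot> c = g" using ex[of g] g by auto
    then show ?thesis using epi_cancel[OF c] by (intro ex1I[of _ h]) auto
  qed
  ultimately show ?thesis using assms(1-3) unfolding is_cokernel_def by blast
qed

lemma kernel_unique:
  assumes k: "is_kernel C k f" and k': "is_kernel C k' f"
  obtains u v where "u \<in> Hom C (Dom C k) (Dom C k')" "v \<in> Hom C (Dom C k') (Dom C k)"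
    "v \<cdot> u = Idn C (Dom C k)" "u \<cdot> v = Idn C (Dom C k')" "k' \<cdot> u = k" "k \<cdot> v = k'"
proof -
  note K = is_kernelD[OF k] is_kernelD[OF k']
  obtain u where u: "u \<in> Arr C" "Dom C u = Dom C k" "Cod C u = Dom C k'" "k' \<cdot> u = k"
    using is_kernelE[OF k', of k] K by metis
  obtain v where v: "v \<in> Arr C" "Dom C v = Dom C k'" "Cod C v = Dom C k" "k \<cdot> v = k'"
    using is_kernelE[OF k, of k'] K by metis
  have "(k \<cdot> v) \<cdot> u = k" using u v by simp
  then have "k \<cdot> (v \<cdot> u) = k \<cdot> Idn C (Dom C k)" using u(1-3) v(1-3) K by simp
  then have vu: "v \<cdot> u = Idn C (Dom C k)" by (rule mono_cancel[OF K(5)]) (use u(1-3) v(1-3) K in simp_all)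
  have "(k' \<cdot> u) \<cdot> v = k'" using u v by simp
  then have "k' \<cdot> (u \<cdot> v) = k' \<cdot> Idn C (Dom C k')" using u(1-3) v(1-3) K by simp
  then have uv: "u \<cdot> v = Idn C (Dom C k')" by (rule mono_cancel[OF K(10)]) (use u(1-3) v(1-3) K in simp_all)
  show ?thesis using that[of u v] u v uv vu by auto
qed

lemma cokernel_unique:
  assumes c: "is_cokernel C c f" and c': "is_cokernel C c' f"
  obtains u v where "u \<in> Hom C (Cod C c) (Cod C c')" "v \<in> Hom C (Cod C c') (Cod C c)"
    "v \<cdot> u = Idn C (Cod C c)" "u \<cdot> v = Idn C (Cod C c')" "u \<cdot> c = c'" "v \<cdot> c' = c"
proof -
  note K = is_cokernelD[OF c] is_cokernelD[OF c']
  obtain v where v: "v \<in> Arr C" "Dom C v = Cod C c'" "Cod C v = Cod C c" "v \<cdot> c' = c"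
    using is_cokernelE[OF c', of c] K by metis
  obtain u where u: "u \<in> Arr C" "Dom C u = Cod C c" "Cod C u = Cod C c'" "u \<cdot> c = c'"
    using is_cokernelE[OF c, of c'] K by metis
  have "(v \<cdot> u) \<cdot> c = Idn C (Cod C c) \<cdot> c" using u v K by simp
  then have vu: "v \<cdot> u = Idn C (Cod C c)" by (rule epi_cancel[OF K(5)]) (use u(1-3) v(1-3) K in simp_all)
  have "(u \<cdot> v) \<cdot> c' = Idn C (Cod C c') \<cdot> c'" using u v K by simp
  then have uv: "u \<cdot> v = Idn C (Cod C c')" by (rule epi_cancel[OF K(10)]) (use u(1-3) v(1-3) K in simp_all)
  show ?thesis using that[of u v] u v uv vu by auto
qed

lemma kernel_Comp_iso:
  assumes k: "is_kernel C k f" and u: "u \<in> Hom C X (Dom C k)" "v \<in> Hom C (Dom C k) X"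
    "v \<cdot> u = Idn C X" "u \<cdot> v = Idn C (Dom C k)"
  shows "is_kernel C (k \<cdot> u) f"
proof (rule is_kernelI)
  note K = is_kernelD[OF k]
  show "f \<in> Arr C" "Cod C (k \<cdot> u) = Dom C f" using K u by auto
  have "(f \<cdot> k) \<cdot> u = Zero C (Dom C (k \<cdot> u)) (Cod C f)"
    unfolding K(4) using u K(1-3) by simp
  then show "f \<cdot> (k \<cdot> u) = Zero C (Dom C (k \<cdot> u)) (Cod C f)" using u K(1-3) by simp
  show "monomorphism C (k \<cdot> u)"
    using K u by (intro mono_Comp split_mono[of v u]) auto
  fix g assume g: "g \<in> Arr C" "Cod C g = Dom C f" "f \<cdot> g = Zero C (Dom C g) (Cod C f)"
  then obtain h where h: "h \<in> Arr C" "Dom C h = Dom C g" "Cod C h = Dom C k" "k \<cdot> h = g"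
    using is_kernelE[OF k] by metis
  have "u \<cdot> (v \<cdot> h) = (u \<cdot> v) \<cdot> h" using u(1,2) h by simp
  also have "\<dots> = h" using u h by simp
  finally have "(k \<cdot> u) \<cdot> (v \<cdot> h) = g" using u(1,2) h K by simp
  then show "\<exists>h. h \<in> Arr C \<and> Dom C h = Dom C g \<and> Cod C h = Dom C (k \<cdot> u) \<and> (k \<cdot> u) \<cdot> h = g"
    using u h K by (intro exI[of _ "v \<cdot> h"]) auto
qed

lemma cokernel_iso_Comp:
  assumes c: "is_cokernel C c f" and u: "u \<in> Hom C (Cod C c) X" "v \<in> Hom C X (Cod C c)"
    "v \<cdot> u = Idn C (Cod C c)" "u \<cdot> v = Idn C X"
  shows "is_cokernel C (u \<cdot> c) f"
proof (rule is_cokernelI)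
  note K = is_cokernelD[OF c]
  show "f \<in> Arr C" "Dom C (u \<cdot> c) = Cod C f" using K u by auto
  show "(u \<cdot> c) \<cdot> f = Zero C (Dom C f) (Cod C (u \<cdot> c))" using u K by simp
  show "epimorphism C (u \<cdot> c)"
    using K u by (intro epi_Comp split_epi[of u v]) auto
  fix g assume g: "g \<in> Arr C" "Dom C g = Cod C f" "g \<cdot> f = Zero C (Dom C f) (Cod C g)"
  then obtain h where h: "h \<in> Arr C" "Dom C h = Cod C c" "Cod C h = Cod C g" "h \<cdot> c = g"
    using is_cokernelE[OF c] by metis
  have "v \<cdot> (u \<cdot> c) = (v \<cdot> u) \<cdot> c" using u(1,2) K by simp
  also have "\<dots> = c" using u K by simp
  finally have "(h \<cdot> v) \<cdot> (u \<cdot> c) = g" using u(1,2) h K by simp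
  then show "\<exists>h. h \<in> Arr C \<and> Dom C h = Cod C (u \<cdot> c) \<and> Cod C h = Cod C g \<and> h \<cdot> (u \<cdot> c) = g"
    using u h K by (intro exI[of _ "h \<cdot> v"]) auto
qed

end

section \<open>Zero objects, and composition with monomorphisms and epimorphisms\<close>

context preadditive_category
begin

lemma Zero_if_zero_Dom:
  assumes Z: "zero_object C (Dom C f)" and f: "f \<in> Arr C"
  shows "f = Zero C (Dom C f) (Cod C f)"
  using assms unfolding zero_object_def by (metis Cod_Obj Hom_iff Zero_Arr)

lemma Zero_if_zero_Cod:
  assumes Z: "zero_object C (Cod C f)" and f: "f \<in> Arr C"
  shows "f = Zero C (Dom C f) (Cod C f)"
  using assms unfolding zero_object_def by (metis Dom_Obj Hom_iff Zero_Arr)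

text \<open>Composing with an identity that vanishes makes every arrow into or out of
  \<open>Z\<close> vanish. The equational form can be checked in each degree of a complex.\<close>

lemma zero_object_iff: "zero_object C Z \<longleftrightarrow> Z \<in> Obj C \<and> Idn C Z = Zero C Z Z"
proof (intro iffI conjI)
  assume "zero_object C Z"
  then show Z: "Z \<in> Obj C" by (simp add: zero_object_def)
  show "Idn C Z = Zero C Z Z"
    using Zero_if_zero_Dom[of "Idn C Z"] \<open>zero_object C Z\<close> Z by simp
next
  assume Z: "Z \<in> Obj C \<and> Idn C Z = Zero C Z Z"
  have "f = Zero C Z X" if "f \<in> Hom C Z X" for f X
  proof -
    have "f = f \<cdot> Idn C Z" using that by simp
    also have "\<dots> = Zero C Z X" using Z that by simp
    finally show ?thesis .
  qed
  moreover have "f = Zero C X Z" if "f \<in> Hom C X Z" for f X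
  proof -
    have "f = Idn C Z \<cdot> f" using that by simp
    also have "\<dots> = Zero C X Z" using Z that by (metis Hom_iff Zero_Comp)
    finally show ?thesis .
  qed
  moreover have "Zero C X Z \<in> Hom C X Z" "Zero C Z X \<in> Hom C Z X" if "X \<in> Obj C" for X
    using that Z by auto
  ultimately show "zero_object C Z" unfolding zero_object_def using Z by blast
qed

lemma mono_into_zero:
  assumes f: "monomorphism C f" and Z: "zero_object C (Cod C f)"
  shows "zero_object C (Dom C f)"
proof -
  have A: "f \<in> Arr C" using f by (simp add: monomorphism_def)
  have "f \<cdot> Idn C (Dom C f) = f \<cdot> Zero C (Dom C f) (Dom C f)"
    using Zero_if_zero_Cod[OF Z A] A by simp
  then have "Idn C (Dom C f) = Zero C (Dom C f) (Dom C f)"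
    by (rule mono_cancel[OF f]) (use A in simp_all)
  then show ?thesis using A by (simp add: zero_object_iff)
qed

lemma epi_from_zero:
  assumes f: "epimorphism C f" and Z: "zero_object C (Dom C f)"
  shows "zero_object C (Cod C f)"
proof -
  have A: "f \<in> Arr C" using f by (simp add: epimorphism_def)
  have "Idn C (Cod C f) \<cdot> f = Zero C (Cod C f) (Cod C f) \<cdot> f"
    using Zero_if_zero_Dom[OF Z A] A by simp
  then have "Idn C (Cod C f) = Zero C (Cod C f) (Cod C f)"
    by (rule epi_cancel[OF f]) (use A in simp_all)
  then show ?thesis using A by (simp add: zero_object_iff)
qed

lemma zero_projective:
  assumes "zero_object C Z"
  shows "projective C Z"
  unfolding projective_def
proof (intro conjI allI impI)
  show Z: "Z \<in> Obj C" using assms by (simp add: zero_object_def)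
  fix e f assume ef: "epimorphism C e \<and> f \<in> Hom C Z (Cod C e)"
  then have e: "e \<in> Arr C" by (simp add: epimorphism_def)
  have "e \<cdot> Zero C Z (Dom C e) = f"
    using ef e Z assms Zero_if_zero_Dom[of f] by simp
  then show "\<exists>g\<in>Hom C Z (Dom C e). e \<cdot> g = f" using e Z by (intro bexI[of _ "Zero C Z (Dom C e)"]) auto
qed

text \<open>A monomorphism does not change which arrows are annihilated, so both universal
  properties range over the same arrows.\<close>

lemma kernel_mono_Comp_iff:
  assumes m: "monomorphism C m" and p: "p \<in> Arr C" "Cod C p = Dom C m"
  shows "is_kernel C k (m \<cdot> p) \<longleftrightarrow> is_kernel C k p"
proof -
  have A: "m \<in> Arr C" using m by (simp add: monomorphism_def)
  have key: "(m \<cdot> p) \<cdot> x = Zero C W (Cod C (m \<cdot> p)) \<longleftrightarrow> p \<cdot> x = Zero C W (Cod C p)"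
    if "x \<in> Hom C W (Dom C p)" for x W
    using that A p m[unfolded mono_iff_Zero, THEN conjunct2, rule_format, of "p \<cdot> x"] by auto
  have Q: "(\<forall>W\<in>Obj C. \<forall>g\<in>Hom C W (Dom C p). (m \<cdot> p) \<cdot> g = Zero C W (Cod C (m \<cdot> p)) \<longrightarrow> Q W g) \<longleftrightarrow>
      (\<forall>W\<in>Obj C. \<forall>g\<in>Hom C W (Dom C p). p \<cdot> g = Zero C W (Cod C p) \<longrightarrow> Q W g)" for Q
    by (intro ball_cong refl imp_cong key)
  have z: "(m \<cdot> p) \<cdot> k = Zero C (Dom C k) (Cod C (m \<cdot> p)) \<longleftrightarrow> p \<cdot> k = Zero C (Dom C k) (Cod C p)"
    if "k \<in> Arr C" "Cod C k = Dom C p" using key[of k] that by simp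
  have D: "m \<cdot> p \<in> Arr C" "Dom C (m \<cdot> p) = Dom C p" using A p by auto
  show ?thesis unfolding is_kernel_def D(2) Q using z D(1) p by blast
qed

lemma cokernel_Comp_epi_iff:
  assumes p: "epimorphism C p" and m: "m \<in> Arr C" "Cod C p = Dom C m"
  shows "is_cokernel C c (m \<cdot> p) \<longleftrightarrow> is_cokernel C c m"
proof -
  have A: "p \<in> Arr C" using p by (simp add: epimorphism_def)
  have key: "x \<cdot> (m \<cdot> p) = Zero C (Dom C (m \<cdot> p)) W \<longleftrightarrow> x \<cdot> m = Zero C (Dom C m) W"
    if x: "x \<in> Hom C (Cod C m) W" for x W
  proof -
    have W: "W \<in> Obj C" using x by auto
    have "x \<cdot> (m \<cdot> p) = (x \<cdot> m) \<cdot> p" using x A m by simp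
    also have "\<dots> = Zero C (Dom C p) W" if "x \<cdot> m = Zero C (Dom C m) W"
      unfolding that using W A m by simp
    finally show ?thesis
      using x A m p[unfolded epi_iff_Zero, THEN conjunct2, rule_format, of "x \<cdot> m"] by auto
  qed
  have Q: "(\<forall>W\<in>Obj C. \<forall>g\<in>Hom C (Cod C m) W. g \<cdot> (m \<cdot> p) = Zero C (Dom C (m \<cdot> p)) W \<longrightarrow> Q W g) \<longleftrightarrow>
      (\<forall>W\<in>Obj C. \<forall>g\<in>Hom C (Cod C m) W. g \<cdot> m = Zero C (Dom C m) W \<longrightarrow> Q W g)" for Q
    by (intro ball_cong refl imp_cong key)
  have z: "c \<cdot> (m \<cdot> p) = Zero C (Dom C (m \<cdot> p)) (Cod C c) \<longleftrightarrow> c \<cdot> m = Zero C (Dom C m) (Cod C c)"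
    if "c \<in> Arr C" "Dom C c = Cod C m" using key[of c] that by simp
  have D: "m \<cdot> p \<in> Arr C" "Cod C (m \<cdot> p) = Cod C m" using A m by auto
  show ?thesis unfolding is_cokernel_def D(2) Q using z D(1) m by blast
qed

end

section \<open>Left projective approximations in abelian categories\<close>

definition approximation_sequence :: "('o, 'm) cat \<Rightarrow> 'm \<Rightarrow> 'm \<Rightarrow> bool" where
  "approximation_sequence C i p \<longleftrightarrow>
     is_kernel C i p \<and> is_cokernel C p i \<and> left_projective_approximation C i"

section \<open>Image factorization and exactness\<close>

context abelian_category
begin

text \<open>To see that \<open>e\<close> is epi, let \<open>g\<close> kill \<open>e\<close> and let
  \<open>l\<close> be the kernel of \<open>g\<close>. Then \<open>f\<close> factors through the
  monomorphism \<open>j \<cdot> l\<close>, which is the kernel of its cokernel \<open>c'\<close>. So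
  \<open>c'\<close> kills \<open>f\<close>, factors through \<open>c\<close> and hence kills
  \<open>j\<close>. Therefore \<open>j\<close> factors through \<open>j \<cdot> l\<close>; this
  gives \<open>l\<close> a right inverse and forces \<open>g\<close> to be zero.\<close>

lemma image_factorization:
  assumes c: "is_cokernel C c f" and j: "is_kernel C j c"
  obtains e where "epimorphism C e" "Dom C e = Dom C f" "Cod C e = Dom C j" "j \<cdot> e = f"
proof -
  note K = is_cokernelD[OF c] is_kernelD[OF j]
  obtain e where e: "e \<in> Arr C" "Dom C e = Dom C f" "Cod C e = Dom C j" "j \<cdot> e = f"
    using is_kernelE[OF j, of f] K by metis
  have "g = Zero C (Cod C e) (Cod C g)"
    if g: "g \<in> Arr C" "Dom C g = Cod C e" "g \<cdot> e = Zero C (Dom C e) (Cod C g)" for g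
  proof -
    obtain l where l: "is_kernel C l g" using ex_kernel g by blast
    note L = is_kernelD[OF l]
    obtain e' where e': "e' \<in> Arr C" "Dom C e' = Dom C e" "Cod C e' = Dom C l" "l \<cdot> e' = e"
      using is_kernelE[OF l, of e] e g by metis
    have "monomorphism C (j \<cdot> l)" using mono_Comp[OF L(5) K(10)] L g e by simp
    moreover from this obtain c' where c': "is_cokernel C c' (j \<cdot> l)"
      using ex_cokernel unfolding monomorphism_def by blast
    ultimately have jl: "is_kernel C (j \<cdot> l) c'" by (rule mono_kernel)
    note C' = is_cokernelD[OF c']
    have [simp]: "Cod C l = Dom C j" "Dom C c' = Cod C j" using L(3) C'(3) g e K L by auto
    have "c' \<cdot> f = (c' \<cdot> (j \<cdot> l)) \<cdot> e'" using e e' L(1) C'(1) K(6) by simp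
    also have "\<dots> = Zero C (Dom C f) (Cod C c')" unfolding C'(4) using e' e L(1) C'(1) K(6) by simp
    finally obtain d where d: "d \<in> Arr C" "Dom C d = Cod C c" "Cod C d = Cod C c'" "d \<cdot> c = c'"
      using is_cokernelE[OF c, of c'] C' K by auto
    have "c' \<cdot> j = d \<cdot> (c \<cdot> j)" using d K by (metis Comp_assoc_Arr)
    also have "\<dots> = Zero C (Dom C j) (Cod C c')" unfolding K(9) using d K by simp
    finally obtain x where x: "x \<in> Arr C" "Dom C x = Dom C j" "Cod C x = Dom C (j \<cdot> l)" "(j \<cdot> l) \<cdot> x = j"
      using is_kernelE[OF jl, of j] K C' by auto
    have x': "Cod C x = Dom C l" using x L K by simp
    have "j \<cdot> (l \<cdot> x) = j \<cdot> Idn C (Dom C j)" using x x' L(1) K by simp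
    then have lx: "l \<cdot> x = Idn C (Dom C j)"
      by (rule mono_cancel[OF K(10)]) (use x(1-2) x' L(1) K in simp_all)
    have "g = g \<cdot> (l \<cdot> x)" unfolding lx using g e by simp
    also have "\<dots> = (g \<cdot> l) \<cdot> x" using g e x x' L(1) by simp
    also have "\<dots> = Zero C (Cod C e) (Cod C g)" unfolding L(4) using g e x(1,2) x' by simp
    finally show ?thesis .
  qed
  then have "epimorphism C e" using e by (simp add: epi_iff_Zero)
  then show ?thesis using that e by blast
qed

text \<open>Factor \<open>m \<cdot> p\<close> as an image inclusion \<open>j\<close> after an
  epimorphism \<open>e\<close>. Like \<open>p\<close>, the arrow \<open>e\<close> is a cokernel of
  \<open>i\<close>, so the two differ by an isomorphism \<open>u\<close>, and \<open>m\<close> is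
  \<open>j \<cdot> u\<close>.\<close>

lemma mono_if_kernel_Comp:
  assumes i: "is_kernel C i p" and p: "is_cokernel C p i" and mp: "is_kernel C i (m \<cdot> p)"
    and m: "m \<in> Arr C" "Dom C m = Cod C p"
  shows "monomorphism C m"
proof -
  note K = is_cokernelD[OF p]
  have A: "m \<cdot> p \<in> Arr C" using K m by simp
  obtain c where c: "is_cokernel C c (m \<cdot> p)" using ex_cokernel[OF A] by blast
  then obtain j where j: "is_kernel C j c" using ex_kernel is_cokernelD(1) by blast
  obtain e where e: "epimorphism C e" "Dom C e = Dom C (m \<cdot> p)" "Cod C e = Dom C j" "j \<cdot> e = m \<cdot> p"
    using image_factorization[OF c j] by blast
  have eA: "e \<in> Arr C" using e by (simp add: epimorphism_def)
  note J = is_kernelD[OF j]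
  have "is_kernel C i e"
    using kernel_mono_Comp_iff[OF J(5) eA] e mp by simp
  then have ec: "is_cokernel C e i" using e epi_cokernel by blast
  obtain u v where uv: "u \<in> Hom C (Cod C p) (Cod C e)" "v \<in> Hom C (Cod C e) (Cod C p)"
    "v \<cdot> u = Idn C (Cod C p)" "u \<cdot> p = e"
    using cokernel_unique[OF p ec] by blast
  have cj: "Cod C j = Cod C m" using is_cokernelD(3)[OF c] J(3) K(1) m by simp
  have "(j \<cdot> u) \<cdot> p = j \<cdot> (u \<cdot> p)" using uv(1) e(3) J(1) K(1) by simp
  then have "m \<cdot> p = (j \<cdot> u) \<cdot> p" using uv(4) e(4) by simp
  then have "m = j \<cdot> u" by (rule epi_cancel[OF K(5)]) (use uv e(3) J K m cj in simp_all)
  moreover have "monomorphism C u" using uv by (intro split_mono[of v u]) auto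
  ultimately show ?thesis using mono_Comp[of u j] J(5) uv e by auto
qed

text \<open>The image of the monomorphism \<open>i\<close> is \<open>i\<close> itself, so exactness
  says that \<open>i\<close> is a kernel of \<open>m \<cdot> p\<close>. This turns exactness at a
  middle term into injectivity on a cokernel, and long sequences can then be cut and
  spliced.\<close>

lemma exact_at_mono_Comp_iff:
  assumes i: "monomorphism C i" and p: "is_cokernel C p i"
    and m: "m \<in> Arr C" "Dom C m = Cod C p"
  shows "exact_at C i (m \<cdot> p) \<longleftrightarrow> monomorphism C m"
proof
  have ip: "is_kernel C i p" by (rule mono_kernel[OF i p])
  note K = is_cokernelD[OF p]
  assume "exact_at C i (m \<cdot> p)"
  then obtain j c where "is_cokernel C c i" "is_kernel C j c" and j: "is_kernel C j (m \<cdot> p)"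
    unfolding exact_at_def is_image_def by blast
  then obtain u v where uv: "u \<in> Hom C (Dom C j) (Dom C i)" "v \<in> Hom C (Dom C i) (Dom C j)"
     "v \<cdot> u = Idn C (Dom C j)" "u \<cdot> v = Idn C (Dom C i)" "j \<cdot> v = i"
    using kernel_unique[of j c i] mono_kernel[OF i, of c] by blast
  have "is_kernel C i (m \<cdot> p)" using kernel_Comp_iso[OF j uv(2,1,4,3)] uv(5) by simp
  then show "monomorphism C m" by (rule mono_if_kernel_Comp[OF ip p _ m])
next
  have ip: "is_kernel C i p" by (rule mono_kernel[OF i p])
  note K = is_cokernelD[OF p]
  assume mm: "monomorphism C m"
  have "is_kernel C i (m \<cdot> p)" using kernel_mono_Comp_iff[OF mm] K m ip by simp
  then show "exact_at C i (m \<cdot> p)"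
    unfolding exact_at_def is_image_def using K m ip p by auto
qed

lemma exact_at_mono_Zero:
  assumes i: "monomorphism C i" and g: "exact_at C i g"
  shows "g \<cdot> i = Zero C (Dom C i) (Cod C g)"
proof -
  obtain j c where c: "is_cokernel C c i" and jc: "is_kernel C j c" and j: "is_kernel C j g"
    using g unfolding exact_at_def is_image_def by blast
  note K = is_kernelD[OF j]
  obtain u v where uv: "v \<in> Hom C (Dom C i) (Dom C j)" "j \<cdot> v = i"
    using kernel_unique[OF jc mono_kernel[OF i c]] by blast
  have "g \<cdot> i = (g \<cdot> j) \<cdot> v" using uv K(1-3) by auto
  also have "\<dots> = Zero C (Dom C i) (Cod C g)" unfolding K(4) using uv K(1-3) by simp
  finally show ?thesis .
qed

lemma is_image_Comp_epi_iff:
  assumes "epimorphism C p" "m \<in> Arr C" "Cod C p = Dom C m"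
  shows "is_image C j (m \<cdot> p) \<longleftrightarrow> is_image C j m"
  using cokernel_Comp_epi_iff[OF assms] by (simp add: is_image_def)

lemma exact_at_Comp_epi_iff:
  assumes "epimorphism C p" "m \<in> Arr C" "Cod C p = Dom C m"
  shows "exact_at C (m \<cdot> p) g \<longleftrightarrow> exact_at C m g"
proof -
  have "p \<in> Arr C" using assms by (simp add: epimorphism_def)
  then show ?thesis unfolding exact_at_def is_image_Comp_epi_iff[OF assms] using assms by auto
qed

text \<open>Since \<open>z\<close> is zero, its cokernel is mono and its image is zero; exactness
  thus says that \<open>f\<close> has zero kernel.\<close>

lemma exact_at_zero_iff:
  assumes Z: "zero_object C (Dom C z)" and z: "z \<in> Arr C" and f: "f \<in> Arr C" "Cod C z = Dom C f"
  shows "exact_at C z f \<longleftrightarrow> monomorphism C f"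
proof -
  have z0: "z = Zero C (Dom C z) (Cod C z)" by (rule Zero_if_zero_Dom[OF Z z])
  have j0: "monomorphism C c" if c: "is_cokernel C c z" for c
  proof -
    note K = is_cokernelD[OF c]
    \<comment> \<open>The identity kills \<open>z\<close>, hence factors through \<open>c\<close>,
      which gives \<open>c\<close> a left inverse.\<close>
    have "Idn C (Cod C z) \<cdot> z = Zero C (Dom C z) (Cod C (Idn C (Cod C z)))" using z z0 by simp
    then obtain h where h: "h \<in> Arr C" "Dom C h = Cod C c" "h \<cdot> c = Idn C (Cod C z)"
      using is_cokernelE[OF c, of "Idn C (Cod C z)"] z by auto
    then show ?thesis using K by (intro split_mono[of h c]) auto
  qed
  obtain c where c: "is_cokernel C c z" using ex_cokernel z by blast
  note K = is_cokernelD[OF c]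
  obtain j where j: "is_kernel C j c" using ex_kernel K by blast
  note J = is_kernelD[OF j]
  show ?thesis
  proof
    assume "exact_at C z f"
    then obtain j c where c: "is_cokernel C c z" and j: "is_kernel C j c" and jf: "is_kernel C j f"
      unfolding exact_at_def is_image_def by blast
    note J = is_kernelD[OF j] is_kernelD[OF jf]
    have j0: "j = Zero C (Dom C j) (Cod C j)"
      using j0[OF c] J unfolding mono_iff_Zero by metis
    have "g = Zero C (Dom C g) (Dom C f)"
      if g: "g \<in> Arr C" "Cod C g = Dom C f" "f \<cdot> g = Zero C (Dom C g) (Cod C f)" for g
    proof -
      obtain h where h: "h \<in> Arr C" "Dom C h = Dom C g" "Cod C h = Dom C j" "j \<cdot> h = g"
        using is_kernelE[OF jf g] by metis
      have "Zero C (Dom C j) (Cod C j) \<cdot> h = Zero C (Dom C g) (Dom C f)"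
        using h(1-3) J(1,8) Cod_Obj[OF J(1)] by simp
      then show ?thesis using h(4) j0 by metis
    qed
    then show "monomorphism C f" using f by (simp add: mono_iff_Zero)
  next
    assume fm: "monomorphism C f"
    have j0: "j = Zero C (Dom C j) (Cod C j)"
      using j0[OF c] J unfolding mono_iff_Zero by metis
    have "is_kernel C j f"
    proof (rule is_kernelI)
      show "f \<in> Arr C" "Cod C j = Dom C f" "monomorphism C j" using J K f by auto
      then show "f \<cdot> j = Zero C (Dom C j) (Cod C f)" using j0 J f by (metis Comp_Zero Dom_Obj)
      fix g assume g: "g \<in> Arr C" "Cod C g = Dom C f" "f \<cdot> g = Zero C (Dom C g) (Cod C f)"
      then have "g = Zero C (Dom C g) (Dom C f)" using fm unfolding mono_iff_Zero by blast
      then have "c \<cdot> g = Zero C (Dom C g) (Cod C c)" using K f g by (metis Comp_Zero Dom_Obj)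
      then show "\<exists>h. h \<in> Arr C \<and> Dom C h = Dom C g \<and> Cod C h = Dom C j \<and> j \<cdot> h = g"
        using is_kernelE[OF j, of g] g K f by metis
    qed
    then show "exact_at C z f" unfolding exact_at_def is_image_def using c j z f by auto
  qed
qed

end

section \<open>Torsionfree and Gorenstein projective objects through approximation sequences\<close>

context abelian_category
begin

lemma approximation_sequenceD:
  assumes "approximation_sequence C i p"
  shows "is_kernel C i p" "is_cokernel C p i" "left_projective_approximation C i"
    "i \<in> Arr C" "p \<in> Arr C" "Dom C p = Cod C i" "p \<cdot> i = Zero C (Dom C i) (Cod C p)"
    "monomorphism C i" "epimorphism C p" "projective C (Cod C i)"
  using assms is_kernelD[of i p] is_cokernelD[of p i]
  unfolding approximation_sequence_def left_projective_approximation_def by blast+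

lemma left_projective_approximationE:
  assumes "left_projective_approximation C i" "projective C (Cod C g)" "g \<in> Arr C"
    "Dom C g = Dom C i"
  obtains h where "h \<in> Arr C" "Dom C h = Cod C i" "Cod C h = Cod C g" "h \<cdot> i = g"
proof -
  have "g \<in> Hom C (Dom C i) (Cod C g)" using assms by simp
  then have "\<exists>h\<in>Hom C (Cod C i) (Cod C g). h \<cdot> i = g"
    using assms(1,2) unfolding left_projective_approximation_def by blast
  then show ?thesis using that by auto
qed

lemma left_projective_approximation_Comp_iso:
  assumes j: "left_projective_approximation C j"
    and uv: "u \<in> Hom C (Dom C j) X" "v \<in> Hom C X (Dom C j)" "u \<cdot> v = Idn C X"
  shows "left_projective_approximation C (j \<cdot> v)"
  unfolding left_projective_approximation_def
proof (intro conjI allI impI ballI)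
  have J: "j \<in> Arr C" "projective C (Cod C j)"
    using j by (auto simp: left_projective_approximation_def)
  show "j \<cdot> v \<in> Arr C" "projective C (Cod C (j \<cdot> v))" using J uv by auto
  fix Q g assume Q: "projective C Q" and g: "g \<in> Hom C (Dom C (j \<cdot> v)) Q"
  have g': "g \<in> Hom C X Q" using g uv J by simp
  obtain h where h: "h \<in> Arr C" "Dom C h = Cod C j" "Cod C h = Q" "h \<cdot> j = g \<cdot> u"
    using left_projective_approximationE[OF j, of "g \<cdot> u"] Q g' uv by auto
  have "h \<cdot> (j \<cdot> v) = (h \<cdot> j) \<cdot> v" using h(1-3) uv J by simp
  also have "\<dots> = g" unfolding h(4) using g' uv by simp
  finally show "\<exists>h\<in>Hom C (Cod C (j \<cdot> v)) Q. h \<cdot> (j \<cdot> v) = g"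
    using h(1-3) J uv by auto
qed

text \<open>Torsionfreeness puts the approximation condition on an image inclusion; for a
  monomorphism this inclusion differs from the arrow itself by an isomorphism.\<close>

lemma left_projective_approximation_if_image:
  assumes i: "monomorphism C i" and j: "is_image C j i" "left_projective_approximation C j"
  shows "left_projective_approximation C i"
proof -
  obtain c where c: "is_cokernel C c i" "is_kernel C j c" using j unfolding is_image_def by blast
  obtain u v where uv: "u \<in> Hom C (Dom C j) (Dom C i)" "v \<in> Hom C (Dom C i) (Dom C j)"
    "u \<cdot> v = Idn C (Dom C i)" "j \<cdot> v = i"
    using kernel_unique[OF c(2) mono_kernel[OF i c(1)]] by blast
  then show ?thesis using left_projective_approximation_Comp_iso[OF j(2) uv(1-3)] by simp
qed

text \<open>For \<open>n = 0\<close> the defining sequence is a single arrow from a zero object.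
  This empty condition is the base of the inductions.\<close>

lemma torsionfree_0: "M \<in> Obj C \<Longrightarrow> torsionfree 0 C M"
proof -
  assume M: "M \<in> Obj C"
  obtain Z where Z: "zero_object C Z" using ex_zero_object by blast
  then have "Z \<in> Obj C" by (simp add: zero_object_def)
  then show ?thesis unfolding torsionfree_def using M Z by (intro exI[of _ "\<lambda>_. Zero C Z M"]) simp
qed

text \<open>Cut the sequence at its first projective term: \<open>f 1\<close> is mono, and
  \<open>f 2\<close> is a monomorphism \<open>m\<close> after the cokernel \<open>p\<close> of
  \<open>f 1\<close>. As \<open>p\<close> is epi, \<open>f 2\<close> and \<open>m\<close> have the
  same image, so \<open>m\<close>, \<open>f 3\<close>, ... is a sequence for
  \<open>Cod C p\<close>.\<close>

lemma approximation_sequence_if_torsionfree_Suc: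
  assumes "torsionfree (Suc n) C M"
  obtains i p where "approximation_sequence C i p" "Dom C i = M" "torsionfree n C (Cod C p)"
proof -
  obtain f where f0: "f 0 \<in> Arr C" "zero_object C (Dom C (f 0))" "Cod C (f 0) = M"
    and f: "\<And>i. i \<in> {1..Suc n} \<Longrightarrow> exact_at C (f (i - 1)) (f i) \<and> projective C (Cod C (f i)) \<and>
      (\<exists>j. is_image C j (f i) \<and> left_projective_approximation C j)"
    using assms unfolding torsionfree_def by blast
  let ?i = "f 1"
  have ex1: "exact_at C (f 0) ?i" using f[of 1] by simp
  then have i: "?i \<in> Arr C" "Dom C ?i = M" using f0 by (auto simp: exact_at_def)
  have im: "monomorphism C ?i" using exact_at_zero_iff[OF f0(2,1) i(1)] f0 i ex1 by simp
  then have ilpa: "left_projective_approximation C ?i"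
    using left_projective_approximation_if_image f[of 1] by auto
  obtain p where p: "is_cokernel C p ?i" using ex_cokernel i by blast
  note P = is_cokernelD[OF p]
  have aseq: "approximation_sequence C ?i p"
    using mono_kernel[OF im p] p ilpa by (simp add: approximation_sequence_def)
  have "torsionfree n C (Cod C p)"
  proof (cases "n = 0")
    case True
    then show ?thesis using torsionfree_0 P by simp
  next
    case False
    have ex2: "exact_at C ?i (f 2)" using f[of 2] False by simp
    then have f2: "f 2 \<in> Arr C" "Dom C (f 2) = Cod C ?i" by (auto simp: exact_at_def)
    obtain m where m: "m \<in> Arr C" "Dom C m = Cod C p" "Cod C m = Cod C (f 2)" "m \<cdot> p = f 2"
      using is_cokernelE[OF p, of "f 2"] f2 exact_at_mono_Zero[OF im ex2] by auto
    have mm: "monomorphism C m"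
      using exact_at_mono_Comp_iff[OF im p m(1,2)] ex2 m(4) by simp
    obtain Z where Z: "zero_object C Z" using ex_zero_object by blast
    then have ZO: "Z \<in> Obj C" by (simp add: zero_object_def)
    \<comment> \<open>Indices drop by one: \<open>m\<close> takes the place of \<open>f 2\<close>
      and stands at 1.\<close>
    let ?g = "\<lambda>k. if k = 0 then Zero C Z (Cod C p) else if k = 1 then m else f (k + 1)"
    have "exact_at C (?g (k - 1)) (?g k) \<and> projective C (Cod C (?g k)) \<and>
      (\<exists>j. is_image C j (?g k) \<and> left_projective_approximation C j)" if k: "k \<in> {1..n}" for k
    proof -
      consider "k = 1" | "k = 2" | "k > 2" using k by fastforce
      then show ?thesis
      proof cases
        case 1
        have "exact_at C (Zero C Z (Cod C p)) m"
          using exact_at_zero_iff[of "Zero C Z (Cod C p)" m] Z ZO P(1) m(1,2) mm by simp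
        moreover have "projective C (Cod C m)" using f[of 2] False m(3) by simp
        moreover have "\<exists>j. is_image C j m \<and> left_projective_approximation C j"
          using f[of 2] False is_image_Comp_epi_iff[OF P(5) m(1)] m(2,4) by simp
        ultimately show ?thesis using 1 by simp
      next
        case 2
        have "exact_at C (f 2) (f 3)" using f[of 3] k 2 by simp
        then have "exact_at C m (f 3)"
          using exact_at_Comp_epi_iff[OF P(5) m(1)] m(2,4) by simp
        then show ?thesis using f[of 3] k 2 by simp
      next
        case 3
        then have "k - 1 \<noteq> 1" "k - 1 \<noteq> 0" "k - 1 + 1 = k" by auto
        then show ?thesis using 3 f[of "k + 1"] k by simp
      qed
    qed
    then show ?thesis unfolding torsionfree_def using Z ZO P(1) by (intro exI[of _ ?g]) simp
  qed
  then show ?thesis using that aseq i by blast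
qed

text \<open>The converse operation splices \<open>i\<close> in front of a sequence for
  \<open>Cod C p\<close>; composing with the epimorphism \<open>p\<close> changes neither images nor
  exactness further on.\<close>

lemma torsionfree_SucI:
  assumes ip: "approximation_sequence C i p" and t: "torsionfree n C (Cod C p)"
  shows "torsionfree (Suc n) C (Dom C i)"
proof -
  note P = approximation_sequenceD[OF ip]
  obtain g where g0: "g 0 \<in> Arr C" "zero_object C (Dom C (g 0))" "Cod C (g 0) = Cod C p"
    and g: "\<And>i. i \<in> {1..n} \<Longrightarrow> exact_at C (g (i - 1)) (g i) \<and> projective C (Cod C (g i)) \<and>
      (\<exists>j. is_image C j (g i) \<and> left_projective_approximation C j)"
    using t unfolding torsionfree_def by blast
  obtain Z where Z: "zero_object C Z" using ex_zero_object by blast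
  then have ZO: "Z \<in> Obj C" by (simp add: zero_object_def)
  \<comment> \<open>The two pieces are joined at index 2 by \<open>g 1 \<cdot> p\<close>; from index
    3 on the old sequence is shifted by one.\<close>
  let ?f = "\<lambda>k. if k = 0 then Zero C Z (Dom C i) else if k = 1 then i else
    if k = 2 then g 1 \<cdot> p else g (k - 1)"
  \<comment> \<open>The old sequence constrains \<open>g 1\<close> when \<open>n\<close> is
    positive, which is exactly when index 2 is reached.\<close>
  have g1: "g 1 \<in> Arr C \<and> Dom C (g 1) = Cod C p \<and> monomorphism C (g 1)" if "n \<ge> 1"
  proof -
    have ex: "exact_at C (g 0) (g 1)" using g[of 1] that by simp
    then have "g 1 \<in> Arr C" "Dom C (g 1) = Cod C p" using g0 by (auto simp: exact_at_def)
    then show ?thesis using exact_at_zero_iff[OF g0(2,1)] g0 ex by simp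
  qed
  have "exact_at C (?f (k - 1)) (?f k) \<and> projective C (Cod C (?f k)) \<and>
      (\<exists>j. is_image C j (?f k) \<and> left_projective_approximation C j)" if k: "k \<in> {1..Suc n}" for k
  proof -
    consider "k = 1" | "k = 2" | "k = 3" | "k > 3" using k by fastforce
    then show ?thesis
    proof cases
      case 1
      have "exact_at C (Zero C Z (Dom C i)) i"
        using exact_at_zero_iff[of "Zero C Z (Dom C i)" i] Z ZO P by simp
      moreover have "is_image C i i" unfolding is_image_def using P(1,2) by blast
      ultimately show ?thesis using 1 P by auto
    next
      case 2
      then have n: "n \<ge> 1" using k by simp
      have "exact_at C i (g 1 \<cdot> p)" using exact_at_mono_Comp_iff[OF P(8,2)] g1[OF n] by simp
      moreover have "\<exists>j. is_image C j (g 1 \<cdot> p) \<and> left_projective_approximation C j"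
        using g[of 1] n is_image_Comp_epi_iff[OF P(9)] g1[OF n] by simp
      ultimately show ?thesis using 2 g[of 1] n g1[OF n] P(5) by simp
    next
      case 3
      then have n: "n \<ge> 1" using k by simp
      have "exact_at C (g 1 \<cdot> p) (g 2)"
        using exact_at_Comp_epi_iff[OF P(9), of "g 1" "g 2"] g1[OF n] g[of 2] k 3 by simp
      then show ?thesis using 3 g[of 2] k by simp
    next
      case 4
      then have "k - 1 \<noteq> 1" "k - 1 \<noteq> 2" "k - 1 \<noteq> 0" "k - 1 \<in> {1..n}" using k by auto
      then show ?thesis using g[of "k - 1"] 4 by simp
    qed
  qed
  then show ?thesis unfolding torsionfree_def using Z ZO P(4) by (intro exI[of _ ?f]) simp
qed

lemma torsionfree_Suc_iff:
  "torsionfree (Suc n) C M \<longleftrightarrow>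
    (\<exists>i p. approximation_sequence C i p \<and> Dom C i = M \<and> torsionfree n C (Cod C p))"
  using approximation_sequence_if_torsionfree_Suc torsionfree_SucI by metis

lemma kernel_HomGroup:
  assumes "d \<in> Arr C"
  shows "kernel (HomGroup C (Cod C d) Q) (HomGroup C (Dom C d) Q) (\<lambda>g. g \<cdot> d) =
    {g \<in> Hom C (Cod C d) Q. g \<cdot> d = Zero C (Dom C d) Q}"
  by (simp add: kernel_def HomGroup_def)

text \<open>Splicing gives the differential \<open>i (k + 1) \<cdot> p k\<close> with cocycles
  \<open>Dom C (i k)\<close>. For exactness under Hom into a projective, an arrow that kills this
  differential kills \<open>i (k + 1)\<close>, because \<open>p k\<close> is epi; it then descends
  along \<open>p (k + 1)\<close> and extends along the approximation
  \<open>i (k + 2)\<close>.\<close>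

lemma GP_I:
  fixes i p :: "int \<Rightarrow> 'b"
  assumes ip: "\<And>k. approximation_sequence C (i k) (p k)"
    and link: "\<And>k. Cod C (p k) = Dom C (i (k + 1))"
  shows "Dom C (i 0) \<in> GP C"
proof -
  note P = approximation_sequenceD[OF ip]
  define T where "T = Cochain (\<lambda>k. Cod C (i k)) (\<lambda>k. i (k + 1) \<cdot> p k)"
  have [simp]: "Term T k = Cod C (i k)" "Diff T k = i (k + 1) \<cdot> p k" for k
    by (simp_all add: T_def)
  have A [simp]: "i k \<in> Arr C" "p k \<in> Arr C" "Dom C (p k) = Cod C (i k)"
     "Cod C (p k) = Dom C (i (k + 1))" "i k \<in> Arr C" for k
    by (rule P link)+
  have pi: "p k \<cdot> i k = Zero C (Dom C (i k)) (Dom C (i (k + 1)))" for k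
    using P(7)[of k] by simp
  have ker: "is_kernel C (i k) (i (k + 1) \<cdot> p k)" for k
    using kernel_mono_Comp_iff[OF P(8)] P(1) by simp
  have comp: "is_complex C T"
    unfolding is_complex_def
  proof (intro allI conjI)
    fix k
    show "Term T k \<in> Obj C" "Diff T k \<in> Hom C (Term T k) (Term T (k + 1))" by auto
    have "Diff T (k + 1) \<cdot> Diff T k = i (k + 1 + 1) \<cdot> ((p (k + 1) \<cdot> i (k + 1)) \<cdot> p k)"
      by simp
    also have "\<dots> = Zero C (Cod C (i k)) (Cod C (i (k + 1 + 1)))"
      unfolding pi by simp
    finally show "Diff T (k + 1) \<cdot> Diff T k = Zero C (Term T k) (Term T (k + 2))"
      by (simp add: add.assoc)
  qed
  have ex: "exact_at C (Diff T k) (Diff T (k + 1))" for k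
  proof -
    have "exact_at C (i (k + 1)) (i (k + 1 + 1) \<cdot> p (k + 1))"
      using exact_at_mono_Comp_iff[OF P(8) P(2)] P(8) by simp
    then show ?thesis using exact_at_Comp_epi_iff[OF P(9)] by simp
  qed
  have hom: "(\<lambda>g. g \<cdot> Diff T (k + 1)) ` Hom C (Term T (k + 2)) Q =
      kernel (HomGroup C (Term T (k + 1)) Q) (HomGroup C (Term T k) Q) (\<lambda>g. g \<cdot> Diff T k)"
    if Q: "projective C Q" for k Q
  proof -
    have QO: "Q \<in> Obj C" using Q by (simp add: projective_def)
    have k2: "k + 1 + 1 = k + 2" by simp
    have d: "i (k + 1) \<cdot> p k \<in> Arr C" "Dom C (i (k + 1) \<cdot> p k) = Cod C (i k)"
      "Cod C (i (k + 1) \<cdot> p k) = Cod C (i (k + 1))" by auto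
    have "g \<cdot> (i (k + 2) \<cdot> p (k + 1)) \<in> Hom C (Cod C (i (k + 1))) Q \<and>
       (g \<cdot> (i (k + 2) \<cdot> p (k + 1))) \<cdot> (i (k + 1) \<cdot> p k) = Zero C (Cod C (i k)) Q"
      if g: "g \<in> Hom C (Cod C (i (k + 2))) Q" for g
    proof -
      have B: "Cod C (p (k + 1)) = Dom C (i (k + 2))" using link[of "k + 1"] by (simp add: add.assoc)
      have "(g \<cdot> (i (k + 2) \<cdot> p (k + 1))) \<cdot> (i (k + 1) \<cdot> p k) =
        (g \<cdot> i (k + 2)) \<cdot> ((p (k + 1) \<cdot> i (k + 1)) \<cdot> p k)" using g B by simp
      also have "\<dots> = Zero C (Cod C (i k)) Q"
        unfolding pi k2 using g QO B by simp
      finally show ?thesis using g B by simp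
    qed
    moreover have "g \<in> (\<lambda>g. g \<cdot> (i (k + 2) \<cdot> p (k + 1))) ` Hom C (Cod C (i (k + 2))) Q"
      if g: "g \<in> Hom C (Cod C (i (k + 1))) Q" "g \<cdot> (i (k + 1) \<cdot> p k) = Zero C (Cod C (i k)) Q" for g
    proof -
      have B: "Cod C (p (k + 1)) = Dom C (i (k + 2))" using link[of "k + 1"] by (simp add: add.assoc)
      have "(g \<cdot> i (k + 1)) \<cdot> p k = Zero C (Dom C (i (k + 1))) Q \<cdot> p k"
        using g QO by simp
      then have "g \<cdot> i (k + 1) = Zero C (Dom C (i (k + 1))) Q"
        by (rule epi_cancel[OF P(9)]) (use g QO in simp_all)
      then obtain h where h: "h \<in> Arr C" "Dom C h = Dom C (i (k + 2))" "Cod C h = Q" "h \<cdot> p (k + 1) = g"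
        using is_cokernelE[OF P(2), of g "k + 1"] g B by auto
      obtain h' where h': "h' \<in> Arr C" "Dom C h' = Cod C (i (k + 2))" "Cod C h' = Q" "h' \<cdot> i (k + 2) = h"
        using left_projective_approximationE[OF P(3), of h "k + 2"] h Q by auto
      have "h' \<cdot> (i (k + 2) \<cdot> p (k + 1)) = (h' \<cdot> i (k + 2)) \<cdot> p (k + 1)" using h'(1,2) B by simp
      also have "\<dots> = g" using h'(4) h(4) by simp
      finally show ?thesis using h' by (intro image_eqI[of _ _ h']) auto
    qed
    ultimately show ?thesis
      using kernel_HomGroup[OF d(1), of Q] unfolding d by (auto simp: k2)
  qed
  have "totally_acyclic C T"
    unfolding totally_acyclic_def using comp ex hom P(10) by simp
  moreover have "is_kernel C (i 0) (Diff T 0)" using ker[of 0] by simp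
  moreover have "isomorphic_objects C (Dom C (i 0)) (Dom C (i 0))"
    unfolding isomorphic_objects_def by (intro bexI[of _ "Idn C (Dom C (i 0))"]) auto
  moreover have "Dom C (i 0) \<in> Obj C" by simp
  ultimately show ?thesis unfolding GP_def by blast
qed

text \<open>Here \<open>i k\<close> includes the cocycles and \<open>p k\<close> is the corestricted
  differential. Exactness makes \<open>p k\<close> epi, and exactness under Hom makes
  \<open>i k\<close> an approximation.\<close>

lemma GP_E:
  assumes "M \<in> GP C"
  obtains i p :: "int \<Rightarrow> 'b" where "\<And>k. approximation_sequence C (i k) (p k)"
    "\<And>k. Cod C (p k) = Dom C (i (k + 1))" "Dom C (i 0) = M"
proof -
  obtain T k0 where ta: "totally_acyclic C T" and k0: "is_kernel C k0 (Diff T 0)"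
    and iso: "isomorphic_objects C M (Dom C k0)" using assms unfolding GP_def by blast
  have d [simp]: "Diff T k \<in> Arr C" "Dom C (Diff T k) = Term T k" "Cod C (Diff T k) = Term T (k + 1)"
     for k
    using ta unfolding totally_acyclic_def is_complex_def by auto
  have dd: "Diff T (k + 1) \<cdot> Diff T k = Zero C (Term T k) (Term T (k + 1 + 1))" for k
    using ta unfolding totally_acyclic_def is_complex_def by (auto simp: add.assoc)
  have ex: "exact_at C (Diff T k) (Diff T (k + 1))" for k
    using ta unfolding totally_acyclic_def by blast
  have proj: "projective C (Term T k)" for k using ta unfolding totally_acyclic_def by blast
  obtain u v where uv: "u \<in> Hom C M (Dom C k0)" "v \<in> Hom C (Dom C k0) M"
    "v \<cdot> u = Idn C M" "u \<cdot> v = Idn C (Dom C k0)"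
    using iso unfolding isomorphic_objects_def by blast
  \<comment> \<open>In degree 0 the kernel is precomposed with the isomorphism from
    \<open>M\<close>, so that the chain passes through \<open>M\<close> itself.\<close>
  define i where "i k = (if k = 0 then k0 \<cdot> u else (SOME i. is_kernel C i (Diff T k)))" for k
  have i: "is_kernel C (i k) (Diff T k)" for k
    unfolding i_def using kernel_Comp_iso[OF k0 uv] someI_ex[OF ex_kernel[OF d(1)[of k]]] by auto
  note I = is_kernelD[OF i]
  have I' [simp]: "i k \<in> Arr C" "Cod C (i k) = Term T k" for k using I(1,3)[of k] by auto
  \<comment> \<open>Exactness supplies some kernel \<open>j\<close> of the next differential; the
    comparison isomorphism \<open>x\<close> redirects the image factorization to the chosen kernel
    \<open>i (k + 1)\<close>.\<close>
  have "\<exists>p. epimorphism C p \<and> Dom C p = Term T k \<and> Cod C p = Dom C (i (k + 1)) \<and> i (k + 1) \<cdot> p = Diff T k" for k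
  proof -
    obtain j c where c: "is_cokernel C c (Diff T k)" and j: "is_kernel C j c" "is_kernel C j (Diff T (k + 1))"
      using ex[of k] unfolding exact_at_def is_image_def by blast
    obtain e where e: "epimorphism C e" "Dom C e = Term T k" "Cod C e = Dom C j" "j \<cdot> e = Diff T k"
      using image_factorization[OF c j(1)] by auto
    obtain x y where xy: "x \<in> Hom C (Dom C j) (Dom C (i (k + 1)))" "y \<in> Hom C (Dom C (i (k + 1))) (Dom C j)"
      "y \<cdot> x = Idn C (Dom C j)" "x \<cdot> y = Idn C (Dom C (i (k + 1)))" "i (k + 1) \<cdot> x = j"
      using kernel_unique[OF j(2) i[of "k + 1"]] by blast
    have eA: "e \<in> Arr C" using e by (simp add: epimorphism_def)
    have "epimorphism C x" using split_epi[of x y] xy by auto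
    then have "epimorphism C (x \<cdot> e)" using epi_Comp[OF e(1)] xy e by simp
    moreover have "i (k + 1) \<cdot> (x \<cdot> e) = (i (k + 1) \<cdot> x) \<cdot> e" using xy(1) eA e(3) by simp
    ultimately show ?thesis using xy(1,5) e eA by (intro exI[of _ "x \<cdot> e"]) auto
  qed
  then obtain p where p: "\<And>k. epimorphism C (p k)" "\<And>k. Dom C (p k) = Term T k"
    "\<And>k. Cod C (p k) = Dom C (i (k + 1))" "\<And>k. i (k + 1) \<cdot> p k = Diff T k" by metis
  have pA: "p k \<in> Arr C" for k using p(1) by (simp add: epimorphism_def)
  have ker: "is_kernel C (i k) (p k)" for k
    using kernel_mono_Comp_iff[OF I(5)[of "k + 1"] pA[of k]] p(3,4) i[of k] by simp
  have cok: "is_cokernel C (p k) (i k)" for k using epi_cokernel[OF p(1) ker] .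
  have "left_projective_approximation C (i k)" for k
    unfolding left_projective_approximation_def
  proof (intro conjI allI impI ballI)
    show "i k \<in> Arr C" "projective C (Cod C (i k))" using proj by auto
    fix Q g assume Q: "projective C Q" and g: "g \<in> Hom C (Dom C (i k)) Q"
    have QO: "Q \<in> Obj C" using Q by (simp add: projective_def)
    \<comment> \<open>To extend \<open>g\<close> along \<open>i k\<close>, pull it back to degree
      \<open>k - 1\<close>. There \<open>g \<cdot> p (k - 1)\<close> kills the differential coming
      from degree \<open>k - 2\<close>, hence is some \<open>h\<close> after the differential of
      degree \<open>k - 1\<close>. Cancelling \<open>p (k - 1)\<close> shows that \<open>h\<close>
      extends \<open>g\<close>.\<close>
    let ?a = "k - 2" let ?b = "k - 1"
    have ab: "?a + 1 = ?b" "?b + 1 = k" "?a + 2 = k" by auto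
    note pb = p(2-4)[of ?b, unfolded ab] pA[of ?b]
    have da: "Cod C (Diff T ?a) = Term T ?b" using d(3)[of ?a] unfolding ab .
    have "i k \<cdot> (p ?b \<cdot> Diff T ?a) = (i k \<cdot> p ?b) \<cdot> Diff T ?a" using pb(1,2,4) da by simp
    also have "\<dots> = Zero C (Term T ?a) (Term T k)" unfolding pb(3) using dd[of ?a] unfolding ab by simp
    also have "\<dots> = i k \<cdot> Zero C (Term T ?a) (Dom C (i k))"
      using d(2)[of ?a] Dom_Obj[OF d(1)[of ?a]] by simp
    finally have "p ?b \<cdot> Diff T ?a = Zero C (Term T ?a) (Dom C (i k))"
      by (rule mono_cancel[OF I(5)]) (use pb da Dom_Obj[OF d(1)[of ?a]] in simp_all)
    then have z: "(g \<cdot> p ?b) \<cdot> Diff T ?a = Zero C (Term T ?a) Q"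
      using g pb da Dom_Obj[OF d(1)[of ?a]] by simp
    have "g \<cdot> p ?b \<in> kernel (HomGroup C (Cod C (Diff T ?a)) Q) (HomGroup C (Dom C (Diff T ?a)) Q) (\<lambda>g. g \<cdot> Diff T ?a)"
      unfolding kernel_HomGroup[OF d(1)] using z g pb da by simp
    moreover have "(\<lambda>g. g \<cdot> Diff T (?a + 1)) ` Hom C (Term T (?a + 2)) Q =
        kernel (HomGroup C (Term T (?a + 1)) Q) (HomGroup C (Term T ?a) Q) (\<lambda>g. g \<cdot> Diff T ?a)"
      using ta Q unfolding totally_acyclic_def by blast
    ultimately have "g \<cdot> p ?b \<in> (\<lambda>g. g \<cdot> Diff T ?b) ` Hom C (Term T k) Q"
      unfolding ab d(2) da by simp
    then obtain h where h: "h \<in> Hom C (Term T k) Q" "h \<cdot> Diff T ?b = g \<cdot> p ?b" by auto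
    have "(h \<cdot> i k) \<cdot> p ?b = h \<cdot> (i k \<cdot> p ?b)" using h(1) pb by simp
    then have "(h \<cdot> i k) \<cdot> p ?b = g \<cdot> p ?b" using h(2) pb(3) by simp
    then have "h \<cdot> i k = g"
      by (rule epi_cancel[OF p(1)]) (use h(1) g pb in simp_all)
    then show "\<exists>h\<in>Hom C (Cod C (i k)) Q. h \<cdot> i k = g" using h(1) by auto
  qed
  then have "approximation_sequence C (i k) (p k)" for k
    using ker cok by (simp add: approximation_sequence_def)
  moreover have "Dom C (i 0) = M" unfolding i_def using is_kernelD[OF k0] uv by simp
  ultimately show ?thesis using that p(3) by blast
qed

end

section \<open>Biproducts\<close>

text \<open>Equations between arrows are used in place of universal properties, so that shearing,
  swapping and transport along isomorphisms are calculations.\<close>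

locale biproduct = preadditive_category +
  fixes X Y B i j p q
  assumes biproduct_Hom: "i \<in> Hom C X B" "j \<in> Hom C Y B" "p \<in> Hom C B X" "q \<in> Hom C B Y"
    and biproduct_Comp: "p \<cdot> i = Idn C X" "q \<cdot> j = Idn C Y" "p \<cdot> j = Zero C Y X" "q \<cdot> i = Zero C X Y"
    and biproduct_Plus: "Plus C (i \<cdot> p) (j \<cdot> q) = Idn C B"
begin

lemma biproduct_Arr [simp]:
  "i \<in> Arr C" "j \<in> Arr C" "p \<in> Arr C" "q \<in> Arr C"
  "Dom C i = X" "Dom C j = Y" "Dom C p = B" "Dom C q = B"
  "Cod C i = B" "Cod C j = B" "Cod C p = X" "Cod C q = Y"
  using biproduct_Hom by auto

lemma biproduct_Obj [simp]: "X \<in> Obj C" "Y \<in> Obj C" "B \<in> Obj C"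
  using Dom_Obj[of i] Dom_Obj[of j] Dom_Obj[of p] by auto

declare biproduct_Comp [simp]

lemma biproduct_Comp_Comp [simp]:
  assumes "f \<in> Arr C"
  shows "Cod C f = X \<Longrightarrow> p \<cdot> (i \<cdot> f) = f" "Cod C f = Y \<Longrightarrow> q \<cdot> (j \<cdot> f) = f"
    "Cod C f = Y \<Longrightarrow> p \<cdot> (j \<cdot> f) = Zero C (Dom C f) X"
    "Cod C f = X \<Longrightarrow> q \<cdot> (i \<cdot> f) = Zero C (Dom C f) Y"
  using assms Comp_assoc_Arr[of f i p] Comp_assoc_Arr[of f j q] Comp_assoc_Arr[of f j p]
    Comp_assoc_Arr[of f i q] by simp_all

lemma eq_into_biproduct:
  assumes "p \<cdot> f = p \<cdot> g" "q \<cdot> f = q \<cdot> g" "f \<in> Arr C" "g \<in> Arr C" "Cod C f = B" "Cod C g = B"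
    "Dom C f = Dom C g"
  shows "f = g"
proof -
  have "f = Plus C (i \<cdot> p) (j \<cdot> q) \<cdot> f" unfolding biproduct_Plus using assms(3,5) by simp
  also have "\<dots> = Plus C (i \<cdot> (p \<cdot> f)) (j \<cdot> (q \<cdot> f))" using assms(3,5) by simp
  also have "\<dots> = Plus C (i \<cdot> p) (j \<cdot> q) \<cdot> g" unfolding assms(1,2) using assms(4,6) by simp
  also have "\<dots> = g" unfolding biproduct_Plus using assms(4,6) by simp
  finally show ?thesis .
qed

lemma eq_from_biproduct:
  assumes "f \<cdot> i = g \<cdot> i" "f \<cdot> j = g \<cdot> j" "f \<in> Arr C" "g \<in> Arr C" "Dom C f = B" "Dom C g = B"
    "Cod C f = Cod C g"
  shows "f = g"
proof -
  have "f = f \<cdot> Plus C (i \<cdot> p) (j \<cdot> q)" unfolding biproduct_Plus using assms(3,5) by simp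
  also have "\<dots> = Plus C ((f \<cdot> i) \<cdot> p) ((f \<cdot> j) \<cdot> q)" using assms(3,5) by simp
  also have "\<dots> = g \<cdot> Plus C (i \<cdot> p) (j \<cdot> q)" unfolding assms(1,2) using assms(4,6) by simp
  also have "\<dots> = g" unfolding biproduct_Plus using assms(4,6) by simp
  finally show ?thesis .
qed

lemma biproduct_commute: "biproduct C Y X B j i q p"
  by unfold_locales (use biproduct_Plus in \<open>simp_all add: Plus_commute[of "j \<cdot> q"]\<close>)

text \<open>These are the structure maps transported along the automorphism that sends (x, y) to (x,
  y + h x). The negative \<open>m\<close> of \<open>h\<close> enters the second projection through
  the inverse automorphism.\<close>

lemma biproduct_shear:
  assumes h: "h \<in> Hom C X Y" and m: "m \<in> Hom C X Y" and hm: "Plus C h m = Zero C X Y"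
  shows "biproduct C X Y B (Plus C i (j \<cdot> h)) j p (Plus C q (m \<cdot> p))"
proof unfold_locales
  have A [simp]: "h \<in> Arr C" "Dom C h = X" "Cod C h = Y" "m \<in> Arr C" "Dom C m = X" "Cod C m = Y"
    using h m by auto
  show "Plus C i (j \<cdot> h) \<in> Hom C X B" "j \<in> Hom C Y B" "p \<in> Hom C B X"
    "Plus C q (m \<cdot> p) \<in> Hom C B Y" by auto
  show "p \<cdot> Plus C i (j \<cdot> h) = Idn C X" "Plus C q (m \<cdot> p) \<cdot> j = Idn C Y" "p \<cdot> j = Zero C Y X"
    by simp_all
  show "Plus C q (m \<cdot> p) \<cdot> Plus C i (j \<cdot> h) = Zero C X Y"
    by (simp add: hm Plus_commute[of m])
  have "Plus C (Plus C i (j \<cdot> h) \<cdot> p) (j \<cdot> Plus C q (m \<cdot> p)) \<cdot> i = Plus C i (j \<cdot> Plus C h m)"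
    by simp
  with hm show "Plus C (Plus C i (j \<cdot> h) \<cdot> p) (j \<cdot> Plus C q (m \<cdot> p)) = Idn C B"
    by - (rule eq_from_biproduct, simp_all)
qed

lemma biproduct_iso:
  assumes "u \<in> Hom C B B'" "v \<in> Hom C B' B" "v \<cdot> u = Idn C B" "u \<cdot> v = Idn C B'"
  shows "biproduct C X Y B' (u \<cdot> i) (u \<cdot> j) (p \<cdot> v) (q \<cdot> v)"
proof unfold_locales
  have A [simp]: "u \<in> Arr C" "Dom C u = B" "Cod C u = B'" "v \<in> Arr C" "Dom C v = B'" "Cod C v = B"
    using assms by auto
  show "u \<cdot> i \<in> Hom C X B'" "u \<cdot> j \<in> Hom C Y B'" "p \<cdot> v \<in> Hom C B' X" "q \<cdot> v \<in> Hom C B' Y"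
    by auto
  have vu: "v \<cdot> (u \<cdot> f) = f" if "f \<in> Arr C" "Cod C f = B" for f
    using that assms(3) Comp_assoc_Arr[of f u v] by simp
  show "(p \<cdot> v) \<cdot> (u \<cdot> i) = Idn C X" "(q \<cdot> v) \<cdot> (u \<cdot> j) = Idn C Y"
    "(p \<cdot> v) \<cdot> (u \<cdot> j) = Zero C Y X" "(q \<cdot> v) \<cdot> (u \<cdot> i) = Zero C X Y"
    by (simp_all add: vu)
  have "Plus C ((u \<cdot> i) \<cdot> (p \<cdot> v)) ((u \<cdot> j) \<cdot> (q \<cdot> v)) = u \<cdot> (Plus C (i \<cdot> p) (j \<cdot> q) \<cdot> v)"
    by simp
  also have "\<dots> = Idn C B'" unfolding biproduct_Plus using assms(4) by simp
  finally show "Plus C ((u \<cdot> i) \<cdot> (p \<cdot> v)) ((u \<cdot> j) \<cdot> (q \<cdot> v)) = Idn C B'" .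
qed

lemma projective_biproduct:
  assumes X: "projective C X" and Y: "projective C Y"
  shows "projective C B"
  unfolding projective_def
proof (intro conjI allI impI)
  show "B \<in> Obj C" by simp
  fix e f assume ef: "epimorphism C e \<and> f \<in> Hom C B (Cod C e)"
  then have [simp]: "e \<in> Arr C" "f \<in> Arr C" "Dom C f = B" "Cod C f = Cod C e"
    by (auto simp: epimorphism_def)
  have "f \<cdot> i \<in> Hom C X (Cod C e)" "f \<cdot> j \<in> Hom C Y (Cod C e)" by auto
  then obtain g h where g: "g \<in> Hom C X (Dom C e)" "e \<cdot> g = f \<cdot> i"
    and h: "h \<in> Hom C Y (Dom C e)" "e \<cdot> h = f \<cdot> j"
    using X Y ef unfolding projective_def by meson
  have [simp]: "g \<in> Arr C" "Dom C g = X" "Cod C g = Dom C e" "h \<in> Arr C" "Dom C h = Y" "Cod C h = Dom C e"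
    using g h by auto
  have "e \<cdot> Plus C (g \<cdot> p) (h \<cdot> q) = f"
    by (rule eq_from_biproduct) (use g(2) h(2) in simp_all)
  then show "\<exists>g\<in>Hom C B (Dom C e). e \<cdot> g = f"
    by (intro bexI[of _ "Plus C (g \<cdot> p) (h \<cdot> q)"]) auto
qed

end

section \<open>Adding projective summands to approximation sequences\<close>

context abelian_category
begin

text \<open>The injections are the arrows into the product with coordinates identity and zero. The
  decomposition of the identity follows from uniqueness, both sides having coordinates
  \<open>p\<close> and \<open>q\<close>.\<close>

lemma ex_biproduct:
  assumes "X \<in> Obj C" "Y \<in> Obj C"
  obtains B i j p q where "biproduct C X Y B i j p q"
proof -
  obtain B p q where P: "is_product C X Y B p q" using ex_product[OF assms] by blast
  then have [simp]: "p \<in> Arr C" "Dom C p = B" "Cod C p = X" "q \<in> Arr C" "Dom C q = B" "Cod C q = Y"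
    by (auto simp: is_product_def)
  have B [simp]: "B \<in> Obj C" using Dom_Obj[of p] by simp
  have U: "\<exists>!h. h \<in> Hom C W B \<and> p \<cdot> h = f \<and> q \<cdot> h = g" if "f \<in> Hom C W X" "g \<in> Hom C W Y" for W f g
  proof -
    have "W \<in> Obj C" using that(1) by auto
    then show ?thesis using P that unfolding is_product_def by blast
  qed
  have "\<exists>i. i \<in> Hom C X B \<and> p \<cdot> i = Idn C X \<and> q \<cdot> i = Zero C X Y"
    "\<exists>j. j \<in> Hom C Y B \<and> p \<cdot> j = Zero C Y X \<and> q \<cdot> j = Idn C Y"
    using assms by (intro ex1_implies_ex U; simp)+
  then obtain i j where ij: "i \<in> Hom C X B" "p \<cdot> i = Idn C X" "q \<cdot> i = Zero C X Y"
    "j \<in> Hom C Y B" "p \<cdot> j = Zero C Y X" "q \<cdot> j = Idn C Y" by blast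
  have [simp]: "i \<in> Arr C" "Dom C i = X" "Cod C i = B" "j \<in> Arr C" "Dom C j = Y" "Cod C j = B"
    using ij by auto
  have "p \<cdot> (i \<cdot> p) = (p \<cdot> i) \<cdot> p" "p \<cdot> (j \<cdot> q) = (p \<cdot> j) \<cdot> q" "q \<cdot> (i \<cdot> p) = (q \<cdot> i) \<cdot> p" "q \<cdot> (j \<cdot> q) = (q \<cdot> j) \<cdot> q"
    by simp_all
  then have "p \<cdot> (i \<cdot> p) = p" "p \<cdot> (j \<cdot> q) = Zero C B X" "q \<cdot> (i \<cdot> p) = Zero C B Y" "q \<cdot> (j \<cdot> q) = q"
    unfolding ij using assms by simp_all
  then have "p \<cdot> Plus C (i \<cdot> p) (j \<cdot> q) = p" "q \<cdot> Plus C (i \<cdot> p) (j \<cdot> q) = q"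
    by simp_all
  moreover have "h = h'" if "h \<in> Hom C B B" "h' \<in> Hom C B B" "p \<cdot> h = p" "q \<cdot> h = q" "p \<cdot> h' = p" "q \<cdot> h' = q" for h h'
    using U[of p B q] that by auto
  ultimately have "Plus C (i \<cdot> p) (j \<cdot> q) = Idn C B" by simp
  then have "biproduct C X Y B i j p q" using ij by unfold_locales auto
  then show ?thesis using that by blast
qed

text \<open>Kernels are unique up to isomorphism, and precomposition with an isomorphism preserves
  approximations.\<close>

lemma approximation_sequence_kernel:
  assumes "approximation_sequence C i p" "is_kernel C k p"
  shows "approximation_sequence C k p"
proof -
  note P = approximation_sequenceD[OF assms(1)]
  obtain u v where uv: "u \<in> Hom C (Dom C i) (Dom C k)" "v \<in> Hom C (Dom C k) (Dom C i)"
    "u \<cdot> v = Idn C (Dom C k)" "i \<cdot> v = k"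
    using kernel_unique[OF P(1) assms(2)] by blast
  show ?thesis
    using left_projective_approximation_Comp_iso[OF P(3) uv(1-3)] epi_cokernel[OF P(9) assms(2)] assms uv(4)
    by (simp add: approximation_sequence_def)
qed

lemma approximation_sequence_cokernel:
  assumes "approximation_sequence C i p" "is_cokernel C c i"
  shows "approximation_sequence C i c"
  using approximation_sequenceD[OF assms(1)] mono_kernel[OF _ assms(2)] assms(2)
  by (simp add: approximation_sequence_def)

text \<open>This is the direct sum of the given sequence with Q -> Q -> 0, which leaves the last
  term unchanged.\<close>

lemma approximation_sequence_biproduct_left:
  assumes s: "approximation_sequence C \<iota> \<pi>" and Q: "projective C Q"
    and K: "biproduct C (Dom C \<iota>) Q K e1 e2 r1 r2" and B: "biproduct C (Cod C \<iota>) Q B j1 j2 q1 q2"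
  shows "approximation_sequence C (Plus C (j1 \<cdot> (\<iota> \<cdot> r1)) (j2 \<cdot> r2)) (\<pi> \<cdot> q1)"
proof -
  note P = approximation_sequenceD[OF s]
  note [simp] = P(4,5,6)
  interpret K: biproduct C "Dom C \<iota>" Q K e1 e2 r1 r2 by (rule K)
  interpret B: biproduct C "Cod C \<iota>" Q B j1 j2 q1 q2 by (rule B)
  have z: "\<pi> \<cdot> (\<iota> \<cdot> x) = Zero C (Dom C x) (Cod C \<pi>)" if "x \<in> Arr C" "Cod C x = Dom C \<iota>" for x
    using that P(7) Comp_assoc_Arr[of x \<iota> \<pi>] by simp
  let ?k = "Plus C (j1 \<cdot> (\<iota> \<cdot> r1)) (j2 \<cdot> r2)"
  have k: "?k \<in> Arr C" "Dom C ?k = K" "Cod C ?k = B" by simp_all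
  have ker: "is_kernel C ?k (\<pi> \<cdot> q1)"
  proof (rule is_kernelI)
    show "\<pi> \<cdot> q1 \<in> Arr C" "Cod C ?k = Dom C (\<pi> \<cdot> q1)" by simp_all
    show "(\<pi> \<cdot> q1) \<cdot> ?k = Zero C (Dom C ?k) (Cod C (\<pi> \<cdot> q1))" by (simp add: z)
    have "x = Zero C (Dom C x) K" if x: "x \<in> Arr C" "Cod C x = K" "?k \<cdot> x = Zero C (Dom C x) B" for x
    proof -
      have "q1 \<cdot> (?k \<cdot> x) = q1 \<cdot> Zero C (Dom C x) B" "q2 \<cdot> (?k \<cdot> x) = q2 \<cdot> Zero C (Dom C x) B"
        unfolding x(3) by simp_all
      then have "\<iota> \<cdot> (r1 \<cdot> x) = \<iota> \<cdot> Zero C (Dom C x) (Dom C \<iota>)" and 2: "r2 \<cdot> x = Zero C (Dom C x) Q"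
        using x(1,2) by simp_all
      from this(1) have "r1 \<cdot> x = Zero C (Dom C x) (Dom C \<iota>)"
        by (rule mono_cancel[OF P(8)]) (use x(1,2) in simp_all)
      with 2 show ?thesis by - (rule K.eq_into_biproduct, use x(1,2) in simp_all)
    qed
    then show "monomorphism C ?k" using k by (simp add: mono_iff_Zero del: Plus_Comp_Arr)
    fix g assume g: "g \<in> Arr C" "Cod C g = Dom C (\<pi> \<cdot> q1)" "(\<pi> \<cdot> q1) \<cdot> g = Zero C (Dom C g) (Cod C (\<pi> \<cdot> q1))"
    then obtain h where h: "h \<in> Arr C" "Dom C h = Dom C g" "Cod C h = Dom C \<iota>" "\<iota> \<cdot> h = q1 \<cdot> g"
      using is_kernelE[OF P(1), of "q1 \<cdot> g"] by auto
    \<comment> \<open>The first coordinate of \<open>g\<close> is killed by \<open>\<pi>\<close> and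
      factors through \<open>\<iota>\<close>; the second is copied.\<close>
    have "?k \<cdot> Plus C (e1 \<cdot> h) (e2 \<cdot> (q2 \<cdot> g)) = g"
      by (rule B.eq_into_biproduct) (use g(1,2) h in simp_all)
    then show "\<exists>h. h \<in> Arr C \<and> Dom C h = Dom C g \<and> Cod C h = Dom C ?k \<and> ?k \<cdot> h = g"
      using g(1,2) h(1-3) by (intro exI[of _ "Plus C (e1 \<cdot> h) (e2 \<cdot> (q2 \<cdot> g))"]) simp
  qed
  have "epimorphism C q1" by (rule split_epi[of _ j1]) simp_all
  then have "epimorphism C (\<pi> \<cdot> q1)" by (rule epi_Comp) (use P(9) in simp_all)
  then have cok: "is_cokernel C (\<pi> \<cdot> q1) ?k" using ker by (rule epi_cokernel)
  have "left_projective_approximation C ?k"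
    unfolding left_projective_approximation_def
  proof (intro conjI allI impI ballI)
    show "?k \<in> Arr C" by (rule k)
    show "projective C (Cod C ?k)" using B.projective_biproduct[OF P(10) Q] by simp
    fix R g assume R: "projective C R" and g: "g \<in> Hom C (Dom C ?k) R"
    then have g [simp]: "g \<in> Arr C" "Dom C g = K" "Cod C g = R" by auto
    obtain h where h [simp]: "h \<in> Arr C" "Dom C h = Cod C \<iota>" "Cod C h = R" and h4: "h \<cdot> \<iota> = g \<cdot> e1"
      using left_projective_approximationE[OF P(3), of "g \<cdot> e1"] R by auto
    \<comment> \<open>The part of \<open>g\<close> on \<open>Dom C \<iota>\<close> is extended by
      the approximation, the part on \<open>Q\<close> is kept.\<close>
    let ?h = "Plus C (h \<cdot> q1) ((g \<cdot> e2) \<cdot> q2)"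
    have "?h \<cdot> ?k = g"
      by (rule K.eq_from_biproduct) (use h4 in simp_all)
    then show "\<exists>h\<in>Hom C (Cod C ?k) R. h \<cdot> ?k = g" by (intro bexI[of _ ?h]) auto
  qed
  with ker cok show ?thesis by (simp add: approximation_sequence_def)
qed

text \<open>This is the direct sum of the given sequence with 0 -> Q -> Q, which leaves the first
  term unchanged.\<close>

lemma approximation_sequence_biproduct_right:
  assumes s: "approximation_sequence C \<iota> \<pi>" and Q: "projective C Q"
    and K: "biproduct C (Cod C \<pi>) Q K e1 e2 r1 r2" and B: "biproduct C (Cod C \<iota>) Q B j1 j2 q1 q2"
  shows "approximation_sequence C (j1 \<cdot> \<iota>) (Plus C (e1 \<cdot> (\<pi> \<cdot> q1)) (e2 \<cdot> q2))"
proof -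
  note P = approximation_sequenceD[OF s]
  note [simp] = P(4,5,6)
  interpret K: biproduct C "Cod C \<pi>" Q K e1 e2 r1 r2 by (rule K)
  interpret B: biproduct C "Cod C \<iota>" Q B j1 j2 q1 q2 by (rule B)
  let ?c = "Plus C (e1 \<cdot> (\<pi> \<cdot> q1)) (e2 \<cdot> q2)"
  have c: "?c \<in> Arr C" "Dom C ?c = B" "Cod C ?c = K" by simp_all
  have "x = Zero C K (Cod C x)" if x: "x \<in> Arr C" "Dom C x = K" "x \<cdot> ?c = Zero C B (Cod C x)" for x
  proof -
    have "(x \<cdot> ?c) \<cdot> j1 = Zero C B (Cod C x) \<cdot> j1" "(x \<cdot> ?c) \<cdot> j2 = Zero C B (Cod C x) \<cdot> j2"
      unfolding x(3) by simp_all
    then have "(x \<cdot> e1) \<cdot> \<pi> = Zero C (Cod C \<pi>) (Cod C x) \<cdot> \<pi>" and 2: "x \<cdot> e2 = Zero C Q (Cod C x)"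
      using x(1,2) by simp_all
    from this(1) have "x \<cdot> e1 = Zero C (Cod C \<pi>) (Cod C x)"
      by (rule epi_cancel[OF P(9)]) (use x(1,2) in simp_all)
    with 2 show ?thesis by - (rule K.eq_from_biproduct, use x(1,2) in simp_all)
  qed
  then have epi: "epimorphism C ?c" using c by (simp add: epi_iff_Zero del: Comp_Plus_Arr)
  have ker: "is_kernel C (j1 \<cdot> \<iota>) ?c"
  proof (rule is_kernelI)
    show "?c \<in> Arr C" "Cod C (j1 \<cdot> \<iota>) = Dom C ?c" by simp_all
    show "?c \<cdot> (j1 \<cdot> \<iota>) = Zero C (Dom C (j1 \<cdot> \<iota>)) (Cod C ?c)" by (simp add: P(7))
    have "monomorphism C j1" by (rule split_mono[of q1]) simp_all
    then show "monomorphism C (j1 \<cdot> \<iota>)" by (intro mono_Comp P(8)) simp_all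
    fix g assume g: "g \<in> Arr C" "Cod C g = Dom C ?c" "?c \<cdot> g = Zero C (Dom C g) (Cod C ?c)"
    then have gB: "Cod C g = B" by simp
    have "r1 \<cdot> (?c \<cdot> g) = r1 \<cdot> Zero C (Dom C g) K" "r2 \<cdot> (?c \<cdot> g) = r2 \<cdot> Zero C (Dom C g) K"
      unfolding g(3) using g(1) by simp_all
    then have 1: "\<pi> \<cdot> (q1 \<cdot> g) = Zero C (Dom C g) (Cod C \<pi>)" and 2: "q2 \<cdot> g = Zero C (Dom C g) Q"
      using g(1) gB by simp_all
    then obtain h where h: "h \<in> Arr C" "Dom C h = Dom C g" "Cod C h = Dom C \<iota>" "\<iota> \<cdot> h = q1 \<cdot> g"
      using is_kernelE[OF P(1), of "q1 \<cdot> g"] g(1) gB by auto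
    have "(j1 \<cdot> \<iota>) \<cdot> h = g"
      by (rule B.eq_into_biproduct) (use g(1) gB h 2 in simp_all)
    then show "\<exists>h. h \<in> Arr C \<and> Dom C h = Dom C g \<and> Cod C h = Dom C (j1 \<cdot> \<iota>) \<and> (j1 \<cdot> \<iota>) \<cdot> h = g"
      using h by auto
  qed
  have "left_projective_approximation C (j1 \<cdot> \<iota>)"
    unfolding left_projective_approximation_def
  proof (intro conjI allI impI ballI)
    show "j1 \<cdot> \<iota> \<in> Arr C" by simp
    show "projective C (Cod C (j1 \<cdot> \<iota>))" using B.projective_biproduct[OF P(10) Q] by simp
    fix R g assume R: "projective C R" and g: "g \<in> Hom C (Dom C (j1 \<cdot> \<iota>)) R"
    then obtain h where h: "h \<in> Arr C" "Dom C h = Cod C \<iota>" "Cod C h = R" "h \<cdot> \<iota> = g"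
      using left_projective_approximationE[OF P(3), of g] by auto
    then show "\<exists>h\<in>Hom C (Cod C (j1 \<cdot> \<iota>)) R. h \<cdot> (j1 \<cdot> \<iota>) = g" by (intro bexI[of _ "h \<cdot> q1"]) auto
  qed
  then show ?thesis using ker epi_cokernel[OF epi ker] by (simp add: approximation_sequence_def)
qed

text \<open>The kernel \<open>k\<close> is arbitrary because it will be a component of a kernel of
  complexes. It is compared with the explicit kernel
  \<open>Plus C (j1 \<cdot> (\<iota> \<cdot> r1)) (j2 \<cdot> r2)\<close>, and the biproduct is
  transported along the resulting isomorphism.\<close>

lemma kernel_of_projection_Comp:
  assumes s: "approximation_sequence C \<iota> \<pi>" and Q: "projective C Q"
    and B: "biproduct C (Cod C \<iota>) Q B j1 j2 q1 q2" and k: "is_kernel C k (\<pi> \<cdot> q1)"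
  shows "approximation_sequence C k (\<pi> \<cdot> q1)"
    and "\<exists>e1 e2 r1 r2. biproduct C (Dom C \<iota>) Q (Dom C k) e1 e2 r1 r2"
proof -
  note P = approximation_sequenceD[OF s]
  have "Q \<in> Obj C" using Q by (simp add: projective_def)
  then obtain K e1 e2 r1 r2 where K: "biproduct C (Dom C \<iota>) Q K e1 e2 r1 r2"
    using ex_biproduct[OF Dom_Obj[OF P(4)]] by blast
  interpret K: biproduct C "Dom C \<iota>" Q K e1 e2 r1 r2 by (rule K)
  interpret B: biproduct C "Cod C \<iota>" Q B j1 j2 q1 q2 by (rule B)
  let ?k = "Plus C (j1 \<cdot> (\<iota> \<cdot> r1)) (j2 \<cdot> r2)"
  have a: "approximation_sequence C ?k (\<pi> \<cdot> q1)"
    by (rule approximation_sequence_biproduct_left[OF s Q K B])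
  then show "approximation_sequence C k (\<pi> \<cdot> q1)" using k by (rule approximation_sequence_kernel)
  have "Dom C ?k = K" using P by simp
  then obtain u v where "u \<in> Hom C K (Dom C k)" "v \<in> Hom C (Dom C k) K"
    "v \<cdot> u = Idn C K" "u \<cdot> v = Idn C (Dom C k)"
    using kernel_unique[OF approximation_sequenceD(1)[OF a] k] by metis
  then show "\<exists>e1 e2 r1 r2. biproduct C (Dom C \<iota>) Q (Dom C k) e1 e2 r1 r2"
    using K.biproduct_iso by blast
qed

text \<open>The dual comparison. The biproduct \<open>B\<close> is a parameter, so that
  \<open>j1\<close> can later be a sheared injection.\<close>

lemma cokernel_of_injection_Comp:
  assumes s: "approximation_sequence C \<iota> \<pi>" and Q: "projective C Q"
    and B: "biproduct C (Cod C \<iota>) Q B j1 j2 q1 q2" and c: "is_cokernel C c (j1 \<cdot> \<iota>)"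
  shows "approximation_sequence C (j1 \<cdot> \<iota>) c"
    and "\<exists>e1 e2 r1 r2. biproduct C (Cod C \<pi>) Q (Cod C c) e1 e2 r1 r2"
proof -
  note P = approximation_sequenceD[OF s]
  have "Q \<in> Obj C" using Q by (simp add: projective_def)
  then obtain K e1 e2 r1 r2 where K: "biproduct C (Cod C \<pi>) Q K e1 e2 r1 r2"
    using ex_biproduct[OF Cod_Obj[OF P(5)]] by blast
  interpret K: biproduct C "Cod C \<pi>" Q K e1 e2 r1 r2 by (rule K)
  interpret B: biproduct C "Cod C \<iota>" Q B j1 j2 q1 q2 by (rule B)
  let ?c = "Plus C (e1 \<cdot> (\<pi> \<cdot> q1)) (e2 \<cdot> q2)"
  have a: "approximation_sequence C (j1 \<cdot> \<iota>) ?c"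
    by (rule approximation_sequence_biproduct_right[OF s Q K B])
  then show "approximation_sequence C (j1 \<cdot> \<iota>) c" using c by (rule approximation_sequence_cokernel)
  have "Cod C ?c = K" using P by simp
  then obtain u v where "u \<in> Hom C K (Cod C c)" "v \<in> Hom C (Cod C c) K"
    "v \<cdot> u = Idn C K" "u \<cdot> v = Idn C (Cod C c)"
    using cokernel_unique[OF approximation_sequenceD(2)[OF a] c] by metis
  then show "\<exists>e1 e2 r1 r2. biproduct C (Cod C \<pi>) Q (Cod C c) e1 e2 r1 r2"
    using K.biproduct_iso by blast
qed

end

section \<open>Syzygies of torsionfree and Gorenstein projective objects\<close>

context abelian_category
begin

lemma approximation_sequence_zero:
  assumes Z: "zero_object C Z"
  shows "approximation_sequence C (Idn C Z) (Zero C Z Z)"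
proof -
  have O: "Z \<in> Obj C" and e: "Idn C Z = Zero C Z Z" using Z by (auto simp: zero_object_iff)
  have m: "monomorphism C (Idn C Z)" by (rule split_mono[of "Idn C Z"]) (use O in simp_all)
  have z: "\<exists>h. h \<in> Arr C \<and> Dom C h = Cod C (Zero C Z Z) \<and> Cod C h = Cod C g \<and> h \<cdot> Zero C Z Z = g"
    if "g \<in> Arr C" "Dom C g = Z" for g
    using that O Comp_Idn_Arr[of g Z] unfolding e by (intro exI[of _ g]) simp
  have "is_cokernel C (Zero C Z Z) (Idn C Z)"
  proof (rule is_cokernelI)
    show "epimorphism C (Zero C Z Z)"
      unfolding e[symmetric] by (rule split_epi[of _ "Idn C Z"]) (use O in simp_all)
  qed (use O z in auto)
  then show ?thesis
    unfolding approximation_sequence_def left_projective_approximation_def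
    using mono_kernel[OF m] zero_projective[OF Z] O by auto
qed

lemma torsionfree_zero: "zero_object C Z \<Longrightarrow> torsionfree n C Z"
proof (induction n)
  case 0
  then show ?case using torsionfree_0 by (simp add: zero_object_def)
next
  case (Suc n)
  then have O: "Z \<in> Obj C" by (simp add: zero_object_def)
  then show ?case
    using Suc torsionfree_SucI[OF approximation_sequence_zero[OF Suc.prems]] by simp
qed

lemma GP_zero:
  assumes Z: "zero_object C Z"
  shows "Z \<in> GP C"
proof -
  have O: "Z \<in> Obj C" using Z by (simp add: zero_object_def)
  show ?thesis
    using GP_I[of "\<lambda>_. Idn C Z" "\<lambda>_. Zero C Z Z"] approximation_sequence_zero[OF Z] O by simp
qed

text \<open>Reindexing the doubly infinite chain through \<open>M\<close> by one gives another such
  chain, now passing through the cosyzygy at index 0.\<close>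

lemma GP_cosyzygy:
  assumes "M \<in> GP C"
  obtains i p where "approximation_sequence C i p" "Dom C i = M" "Cod C p \<in> GP C"
proof -
  obtain i p :: "int \<Rightarrow> 'b" where ip: "\<And>k. approximation_sequence C (i k) (p k)"
    "\<And>k. Cod C (p k) = Dom C (i (k + 1))" "Dom C (i 0) = M" using GP_E[OF assms] by metis
  have "Dom C (i (0 + 1)) \<in> GP C"
    using GP_I[of "\<lambda>k. i (k + 1)" "\<lambda>k. p (k + 1)"] ip(1,2) by simp
  then show ?thesis using that[of "i 0" "p 0"] ip by simp
qed

lemma GP_syzygy:
  assumes "M \<in> GP C"
  obtains i p where "approximation_sequence C i p" "Cod C p = M" "Dom C i \<in> GP C"
proof -
  obtain i p :: "int \<Rightarrow> 'b" where ip: "\<And>k. approximation_sequence C (i k) (p k)"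
    "\<And>k. Cod C (p k) = Dom C (i (k + 1))" "Dom C (i 0) = M" using GP_E[OF assms] by metis
  have "Dom C (i (0 - 1)) \<in> GP C"
    using GP_I[of "\<lambda>k. i (k - 1)" "\<lambda>k. p (k - 1)"] ip(1) ip(2)[of "_ - 1"] by simp
  then show ?thesis using that[of "i (-1)" "p (-1)"] ip(1) ip(2)[of "-1"] ip(3) by simp
qed

text \<open>Choose a cosyzygy and a syzygy for every object of \<open>S\<close>. Iterating both
  choices from \<open>M\<close> gives two half-infinite chains that meet at
  \<open>M\<close>.\<close>

lemma GP_coinduct:
  assumes M: "M \<in> S"
    and right: "\<And>M. M \<in> S \<Longrightarrow> \<exists>i p. approximation_sequence C i p \<and> Dom C i = M \<and> Cod C p \<in> S"
    and left: "\<And>M. M \<in> S \<Longrightarrow> \<exists>i p. approximation_sequence C i p \<and> Cod C p = M \<and> Dom C i \<in> S"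
  shows "M \<in> GP C"
proof -
  obtain ri rp where r: "\<And>M. M \<in> S \<Longrightarrow> approximation_sequence C (ri M) (rp M)"
    "\<And>M. M \<in> S \<Longrightarrow> Dom C (ri M) = M" "\<And>M. M \<in> S \<Longrightarrow> Cod C (rp M) \<in> S"
    using right by metis
  obtain li lp where l: "\<And>M. M \<in> S \<Longrightarrow> approximation_sequence C (li M) (lp M)"
    "\<And>M. M \<in> S \<Longrightarrow> Cod C (lp M) = M" "\<And>M. M \<in> S \<Longrightarrow> Dom C (li M) \<in> S"
    using left by metis
  define a where "a n = ((\<lambda>N. Cod C (rp N)) ^^ n) M" for n
  define b where "b n = ((\<lambda>N. Dom C (li N)) ^^ n) M" for n
  have a: "a 0 = M" "\<And>n. a (Suc n) = Cod C (rp (a n))" "a n \<in> S" for n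
    unfolding a_def by (simp, simp, induction n) (use M r(3) in auto)
  have b: "b 0 = M" "\<And>n. b (Suc n) = Dom C (li (b n))" "b n \<in> S" for n
    unfolding b_def by (simp, simp, induction n) (use M l(3) in auto)
  \<comment> \<open>Index -1 uses the syzygy sequence of \<open>b 0\<close>, which ends at
    \<open>M\<close>; index 0 uses the cosyzygy sequence of \<open>a 0\<close>, which starts at
    \<open>M\<close>.\<close>
  define i where "i k = (if k \<ge> 0 then ri (a (nat k)) else li (b (nat (- k - 1))))" for k :: int
  define p where "p k = (if k \<ge> 0 then rp (a (nat k)) else lp (b (nat (- k - 1))))" for k :: int
  have "approximation_sequence C (i k) (p k)" for k
    unfolding i_def p_def using r(1) l(1) a(3) b(3) by simp
  moreover have "Cod C (p k) = Dom C (i (k + 1))" for k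
  proof -
    consider "k \<ge> 0" | "k = -1" | "k < -1" by linarith
    then show ?thesis
    proof cases
      case 1
      then have "nat (k + 1) = Suc (nat k)" by simp
      then show ?thesis unfolding i_def p_def using 1 a(2)[of "nat k"] r(2)[OF a(3)[of "Suc (nat k)"]] by simp
    next
      case 2
      then show ?thesis unfolding i_def p_def using a(1) b(1) M r(2) l(2) by simp
    next
      case 3
      then have "nat (- k - 1) = Suc (nat (- (k + 1) - 1))" by simp
      then show ?thesis unfolding i_def p_def using 3 b(2)[of "nat (- (k + 1) - 1)"] l(2)[OF b(3)[of "Suc (nat (- (k + 1) - 1))"]]
        by simp
    qed
  qed
  ultimately have "Dom C (i 0) \<in> GP C" by (rule GP_I)
  then show ?thesis unfolding i_def using a(1) r(2) M by simp
qed

text \<open>The summand \<open>Q\<close> is absorbed by the first two terms, so \<open>K\<close> has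
  the same cosyzygy as the object it enlarges.\<close>

lemma cosyzygy_biproduct:
  assumes s: "approximation_sequence C \<iota> \<pi>" and Q: "projective C Q"
    and K: "biproduct C (Dom C \<iota>) Q K e1 e2 r1 r2"
  obtains i p where "approximation_sequence C i p" "Dom C i = K" "Cod C p = Cod C \<pi>"
proof -
  note P = approximation_sequenceD[OF s]
  have "Q \<in> Obj C" using Q by (simp add: projective_def)
  then obtain B j1 j2 q1 q2 where B: "biproduct C (Cod C \<iota>) Q B j1 j2 q1 q2"
    using ex_biproduct[OF Cod_Obj[OF P(4)]] by blast
  interpret K: biproduct C "Dom C \<iota>" Q K e1 e2 r1 r2 by (rule K)
  interpret B: biproduct C "Cod C \<iota>" Q B j1 j2 q1 q2 by (rule B)
  show ?thesis
    using that[OF approximation_sequence_biproduct_left[OF s Q K B]] P by simp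
qed

lemma syzygy_biproduct:
  assumes s: "approximation_sequence C \<iota> \<pi>" and Q: "projective C Q"
    and K: "biproduct C (Cod C \<pi>) Q K e1 e2 r1 r2"
  obtains i p where "approximation_sequence C i p" "Dom C i = Dom C \<iota>" "Cod C p = K"
proof -
  note P = approximation_sequenceD[OF s]
  have "Q \<in> Obj C" using Q by (simp add: projective_def)
  then obtain B j1 j2 q1 q2 where B: "biproduct C (Cod C \<iota>) Q B j1 j2 q1 q2"
    using ex_biproduct[OF Cod_Obj[OF P(4)]] by blast
  interpret K: biproduct C "Cod C \<pi>" Q K e1 e2 r1 r2 by (rule K)
  interpret B: biproduct C "Cod C \<iota>" Q B j1 j2 q1 q2 by (rule B)
  show ?thesis
    using that[OF approximation_sequence_biproduct_right[OF s Q K B]] P by simp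
qed

text \<open>\<open>K\<close> and \<open>M\<close> share a cosyzygy, so a case distinction on
  \<open>n\<close> replaces an induction.\<close>

lemma torsionfree_biproduct:
  assumes M: "torsionfree n C M" and Q: "projective C Q" and K: "biproduct C M Q K e1 e2 r1 r2"
  shows "torsionfree n C K"
proof (cases n)
  case 0
  then show ?thesis using torsionfree_0 biproduct.biproduct_Obj(3)[OF K] by simp
next
  case (Suc m)
  obtain i p where ip: "approximation_sequence C i p" "Dom C i = M" "torsionfree m C (Cod C p)"
    using M Suc torsionfree_Suc_iff by blast
  obtain i' p' where "approximation_sequence C i' p'" "Dom C i' = K" "Cod C p' = Cod C p"
    using cosyzygy_biproduct[OF ip(1) Q] K ip(2) by metis
  then show ?thesis using Suc ip(3) torsionfree_SucI by metis
qed

text \<open>\<open>K\<close> shares a cosyzygy and a syzygy with \<open>M\<close>, and both can be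
  chosen in \<open>GP C\<close>. Adding the single object \<open>K\<close> to that class therefore
  keeps it closed under the two steps of the coinduction.\<close>

lemma GP_biproduct:
  assumes M: "M \<in> GP C" and Q: "projective C Q" and K: "biproduct C M Q K e1 e2 r1 r2"
  shows "K \<in> GP C"
proof (rule GP_coinduct[where S = "insert K (GP C)"])
  show "K \<in> insert K (GP C)" by simp
  fix N assume N: "N \<in> insert K (GP C)"
  obtain i p where ip: "approximation_sequence C i p" "Dom C i = M" "Cod C p \<in> GP C"
    using GP_cosyzygy[OF M] by metis
  have "\<exists>i p. approximation_sequence C i p \<and> Dom C i = K \<and> Cod C p \<in> GP C"
    using cosyzygy_biproduct[OF ip(1) Q] K ip(2,3) by metis
  then show "\<exists>i p. approximation_sequence C i p \<and> Dom C i = N \<and> Cod C p \<in> insert K (GP C)"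
    using N GP_cosyzygy by (metis insert_iff)
  obtain i p where ip: "approximation_sequence C i p" "Cod C p = M" "Dom C i \<in> GP C"
    using GP_syzygy[OF M] by metis
  have "\<exists>i p. approximation_sequence C i p \<and> Cod C p = K \<and> Dom C i \<in> GP C"
    using syzygy_biproduct[OF ip(1) Q] K ip(2,3) by metis
  then show "\<exists>i p. approximation_sequence C i p \<and> Cod C p = N \<and> Dom C i \<in> insert K (GP C)"
    using N GP_syzygy by (metis insert_iff)
qed

end

section \<open>The abelian category of bounded complexes\<close>

lemma Cb_ChainMap [simp]:
  "Dom (Cb C) (ChainMap X Y \<phi>) = X" "Cod (Cb C) (ChainMap X Y \<phi>) = Y"
  by (simp_all add: Cb_def)

lemma Component_Cb [simp]:
  "Component (Comp (Cb C) g f) i = Comp C (Component g i) (Component f i)"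
  "Component (Idn (Cb C) X) i = Idn C (Term X i)"
  "Component (Plus (Cb C) f g) i = Plus C (Component f i) (Component g i)"
  "Component (Zero (Cb C) X Y) i = Zero C (Term X i) (Term Y i)"
  by (simp_all add: Cb_def)

lemma Dom_Cod_Cb:
  "Dom (Cb C) (Comp (Cb C) g f) = Dom (Cb C) f" "Cod (Cb C) (Comp (Cb C) g f) = Cod (Cb C) g"
  "Dom (Cb C) (Idn (Cb C) X) = X" "Cod (Cb C) (Idn (Cb C) X) = X"
  "Dom (Cb C) (Plus (Cb C) f g) = Dom (Cb C) f" "Cod (Cb C) (Plus (Cb C) f g) = Cod (Cb C) f"
  "Dom (Cb C) (Zero (Cb C) X Y) = X" "Cod (Cb C) (Zero (Cb C) X Y) = Y"
  by (simp_all add: Cb_def)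

lemma chain_map_eqI:
  assumes "\<And>i. Component f i = Component g i" "Dom (Cb C) f = Dom (Cb C) g" "Cod (Cb C) f = Cod (Cb C) g"
  shows "f = g"
  using assms by (cases f; cases g) (auto simp: Cb_def)

lemma Obj_Cb_iff: "X \<in> Obj (Cb C) \<longleftrightarrow> is_complex C X \<and> is_bounded C X"
  by (simp add: Cb_def bounded_complexes_def)

lemma Arr_Cb_iff:
  "f \<in> Arr (Cb C) \<longleftrightarrow> Dom (Cb C) f \<in> Obj (Cb C) \<and> Cod (Cb C) f \<in> Obj (Cb C) \<and>
    (\<forall>i. Component f i \<in> Arr C \<and> Dom C (Component f i) = Term (Dom (Cb C) f) i \<and>
      Cod C (Component f i) = Term (Cod (Cb C) f) i \<and>
      Comp C (Diff (Cod (Cb C) f) i) (Component f i) = Comp C (Component f (i + 1)) (Diff (Dom (Cb C) f) i))"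
  by (auto simp: Cb_def is_chain_map_def)

lemma Component_Arr [simp]:
  assumes "f \<in> Arr (Cb C)"
  shows "Component f i \<in> Arr C" "Dom C (Component f i) = Term (Dom (Cb C) f) i"
    "Cod C (Component f i) = Term (Cod (Cb C) f) i"
  using assms by (auto simp: Arr_Cb_iff)

lemma Diff_Component:
  "f \<in> Arr (Cb C) \<Longrightarrow>
    Comp C (Diff (Cod (Cb C) f) i) (Component f i) = Comp C (Component f (i + 1)) (Diff (Dom (Cb C) f) i)"
  unfolding Arr_Cb_iff by blast

lemma is_bounded_transfer:
  assumes "is_bounded C X"
    and "\<And>i. zero_object C (Term X (i - 1)) \<Longrightarrow> zero_object C (Term X i) \<Longrightarrow>
      zero_object C (Term X (i + 1)) \<Longrightarrow> zero_object C (Term Y i)"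
  shows "is_bounded C Y"
proof -
  obtain a b where "\<And>i. i < a \<or> b < i \<Longrightarrow> zero_object C (Term X i)"
    using assms(1) unfolding is_bounded_def by blast
  \<comment> \<open>The hypothesis looks one degree to each side, so the interval is widened by one
    at both ends.\<close>
  then have "zero_object C (Term Y i)" if "i < a - 1 \<or> b + 1 < i" for i
    using that by (intro assms(2)) auto
  then show ?thesis unfolding is_bounded_def by blast
qed

lemma Term_Obj [simp]: "X \<in> Obj (Cb C) \<Longrightarrow> Term X i \<in> Obj C"
  by (auto simp: Obj_Cb_iff is_complex_def)

lemma Diff_Arr [simp]:
  assumes "X \<in> Obj (Cb C)"
  shows "Diff X i \<in> Arr C" "Dom C (Diff X i) = Term X i" "Cod C (Diff X i) = Term X (i + 1)"
  using assms by (auto simp: Obj_Cb_iff is_complex_def)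

text \<open>The index stays in the form \<open>i + 1 + 1\<close>, in which it arises as the codomain
  of \<open>Diff X (i + 1)\<close>.\<close>

lemma Diff_Diff:
  "X \<in> Obj (Cb C) \<Longrightarrow> Comp C (Diff X (i + 1)) (Diff X i) = Zero C (Term X i) (Term X (i + 1 + 1))"
  unfolding Obj_Cb_iff is_complex_def add.assoc one_add_one by blast

lemma Obj_CbI:
  assumes "\<And>i. d i \<in> Arr C" "\<And>i. Dom C (d i) = T i" "\<And>i. Cod C (d i) = T (i + 1)"
    "\<And>i. T i \<in> Obj C" "\<And>i. Comp C (d (i + 1)) (d i) = Zero C (T i) (T (i + 1 + 1))"
    "is_bounded C (Cochain T d)"
  shows "Cochain T d \<in> Obj (Cb C)"
  using assms by (auto simp: Obj_Cb_iff is_complex_def add.assoc)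

lemma ChainMap_Arr:
  assumes "X \<in> Obj (Cb C)" "Y \<in> Obj (Cb C)" "\<And>i. \<phi> i \<in> Arr C" "\<And>i. Dom C (\<phi> i) = Term X i"
    "\<And>i. Cod C (\<phi> i) = Term Y i" "\<And>i. Comp C (Diff Y i) (\<phi> i) = Comp C (\<phi> (i + 1)) (Diff X i)"
  shows "ChainMap X Y \<phi> \<in> Arr (Cb C)"
  using assms by (auto simp: Arr_Cb_iff)

section \<open>Preadditive structure on bounded complexes\<close>

context preadditive_category
begin

lemmas Cb_eqI = chain_map_eqI[where C = C]

lemma Cb_Comp_Arr:
  assumes f: "f \<in> Arr (Cb C)" and g: "g \<in> Arr (Cb C)" and fg: "Cod (Cb C) f = Dom (Cb C) g"
  shows "g \<cdot>\<^bsub>Cb C\<^esub> f \<in> Arr (Cb C)"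
proof -
  have O: "Dom (Cb C) f \<in> Obj (Cb C)" "Cod (Cb C) f \<in> Obj (Cb C)" "Cod (Cb C) g \<in> Obj (Cb C)"
    using f g unfolding Arr_Cb_iff by blast+
  have "Diff (Cod (Cb C) g) i \<cdot> (Component g i \<cdot> Component f i) =
      (Component g (i + 1) \<cdot> Component f (i + 1)) \<cdot> Diff (Dom (Cb C) f) i" for i
  proof -
    have "Diff (Cod (Cb C) g) i \<cdot> (Component g i \<cdot> Component f i) =
       (Diff (Cod (Cb C) g) i \<cdot> Component g i) \<cdot> Component f i" using O f g fg by simp
    also have "\<dots> = Component g (i + 1) \<cdot> (Diff (Cod (Cb C) f) i \<cdot> Component f i)"
      unfolding Diff_Component[OF g] using O f g fg by simp
    also have "\<dots> = (Component g (i + 1) \<cdot> Component f (i + 1)) \<cdot> Diff (Dom (Cb C) f) i"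
      unfolding Diff_Component[OF f] using O f g fg by simp
    finally show ?thesis .
  qed
  then show ?thesis unfolding Arr_Cb_iff[of "g \<cdot>\<^bsub>Cb C\<^esub> f"] Dom_Cod_Cb using O f g fg by simp
qed

lemma Cb_Plus_Arr:
  assumes f: "f \<in> Arr (Cb C)" and g: "g \<in> Arr (Cb C)"
    and fg: "Dom (Cb C) f = Dom (Cb C) g" "Cod (Cb C) f = Cod (Cb C) g"
  shows "Plus (Cb C) f g \<in> Arr (Cb C)"
proof -
  have O: "Dom (Cb C) g \<in> Obj (Cb C)" "Cod (Cb C) g \<in> Obj (Cb C)"
    using g unfolding Arr_Cb_iff by blast+
  show ?thesis unfolding Arr_Cb_iff[of "Plus (Cb C) f g"] Dom_Cod_Cb
    using O f g fg Diff_Component[OF f] Diff_Component[OF g] by simp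
qed

lemma preadditive_category_Cb: "preadditive_category (Cb C)"
proof (intro preadditive_category.intro category.intro preadditive_category_axioms.intro)
  fix f assume "f \<in> Arr (Cb C)"
  then show "Dom (Cb C) f \<in> Obj (Cb C)" "Cod (Cb C) f \<in> Obj (Cb C)" unfolding Arr_Cb_iff by blast+
next
  fix X assume "X \<in> Obj (Cb C)"
  then show "Idn (Cb C) X \<in> Hom (Cb C) X X" by (simp add: Arr_Cb_iff Dom_Cod_Cb)
next
  fix f X Y g Z assume fg: "f \<in> Hom (Cb C) X Y" "g \<in> Hom (Cb C) Y Z"
  then show "g \<cdot>\<^bsub>Cb C\<^esub> f \<in> Hom (Cb C) X Z" using Cb_Comp_Arr[of f g] by (simp add: Dom_Cod_Cb)
next
  fix f W X g Y h Z assume "f \<in> Hom (Cb C) W X" "g \<in> Hom (Cb C) X Y" "h \<in> Hom (Cb C) Y Z"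
  then show "h \<cdot>\<^bsub>Cb C\<^esub> g \<cdot>\<^bsub>Cb C\<^esub> f = h \<cdot>\<^bsub>Cb C\<^esub> (g \<cdot>\<^bsub>Cb C\<^esub> f)"
    by (intro Cb_eqI) (simp_all add: Dom_Cod_Cb)
next
  fix f X Y assume "f \<in> Hom (Cb C) X Y"
  then show "f \<cdot>\<^bsub>Cb C\<^esub> Idn (Cb C) X = f" "Idn (Cb C) Y \<cdot>\<^bsub>Cb C\<^esub> f = f"
    by (auto intro!: Cb_eqI simp: Dom_Cod_Cb)
next
  fix f X Y f' g Z
  assume "f \<in> Hom (Cb C) X Y" "f' \<in> Hom (Cb C) X Y" "g \<in> Hom (Cb C) Y Z"
  then show "g \<cdot>\<^bsub>Cb C\<^esub> Plus (Cb C) f f' = Plus (Cb C) (g \<cdot>\<^bsub>Cb C\<^esub> f) (g \<cdot>\<^bsub>Cb C\<^esub> f')"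
    by (intro Cb_eqI) (simp_all add: Dom_Cod_Cb)
next
  fix f X Y g Z g'
  assume "f \<in> Hom (Cb C) X Y" "g \<in> Hom (Cb C) Y Z" "g' \<in> Hom (Cb C) Y Z"
  then show "Plus (Cb C) g g' \<cdot>\<^bsub>Cb C\<^esub> f = Plus (Cb C) (g \<cdot>\<^bsub>Cb C\<^esub> f) (g' \<cdot>\<^bsub>Cb C\<^esub> f)"
    by (intro Cb_eqI) (simp_all add: Dom_Cod_Cb)
next
  fix X Y assume X: "X \<in> Obj (Cb C)" and Y: "Y \<in> Obj (Cb C)"
  show "comm_group (HomGroup (Cb C) X Y)"
  proof (rule comm_groupI)
    fix f g assume fg: "f \<in> carrier (HomGroup (Cb C) X Y)" "g \<in> carrier (HomGroup (Cb C) X Y)"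
    then show "f \<otimes>\<^bsub>HomGroup (Cb C) X Y\<^esub> g \<in> carrier (HomGroup (Cb C) X Y)"
      using Cb_Plus_Arr by (simp add: HomGroup_def Dom_Cod_Cb)
    show "f \<otimes>\<^bsub>HomGroup (Cb C) X Y\<^esub> g = g \<otimes>\<^bsub>HomGroup (Cb C) X Y\<^esub> f"
      using fg X Y by (auto intro!: Cb_eqI Plus_commute simp: HomGroup_def Dom_Cod_Cb)
    fix h assume "h \<in> carrier (HomGroup (Cb C) X Y)"
    then show "f \<otimes>\<^bsub>HomGroup (Cb C) X Y\<^esub> g \<otimes>\<^bsub>HomGroup (Cb C) X Y\<^esub> h =
        f \<otimes>\<^bsub>HomGroup (Cb C) X Y\<^esub> (g \<otimes>\<^bsub>HomGroup (Cb C) X Y\<^esub> h)"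
      using fg X Y by (auto intro!: Cb_eqI Plus_assoc simp: HomGroup_def Dom_Cod_Cb)
  next
    show "\<one>\<^bsub>HomGroup (Cb C) X Y\<^esub> \<in> carrier (HomGroup (Cb C) X Y)"
      using X Y by (simp add: HomGroup_def Arr_Cb_iff Dom_Cod_Cb)
  next
    fix f assume f: "f \<in> carrier (HomGroup (Cb C) X Y)"
    then have A: "f \<in> Arr (Cb C)" "Dom (Cb C) f = X" "Cod (Cb C) f = Y" by (auto simp: HomGroup_def)
    show "\<one>\<^bsub>HomGroup (Cb C) X Y\<^esub> \<otimes>\<^bsub>HomGroup (Cb C) X Y\<^esub> f = f"
      using A X Y by (auto intro!: Cb_eqI simp: HomGroup_def Dom_Cod_Cb)
    have "\<exists>m. m \<in> Arr C \<and> Dom C m = Term X i \<and> Cod C m = Term Y i \<and>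
        Plus C m (Component f i) = Zero C (Term X i) (Term Y i)" for i
      using ex_minus[of "Component f i"] A by (metis Component_Arr)
    then obtain m where m: "\<And>i. m i \<in> Arr C" "\<And>i. Dom C (m i) = Term X i" "\<And>i. Cod C (m i) = Term Y i"
      "\<And>i. Plus C (m i) (Component f i) = Zero C (Term X i) (Term Y i)" by metis
    have m': "Plus C (Component f i) (m i) = Zero C (Term X i) (Term Y i)" for i
      using m(4)[of i] Plus_commute[of "m i" "Component f i"] m(1-3)[of i] A by simp
    \<comment> \<open>The negatives were chosen in each degree independently; they commute with the
      differentials because adding \<open>f\<close>, which does, gives zero on both sides.\<close>
    have "Diff Y i \<cdot> m i = m (i + 1) \<cdot> Diff X i" for i
    proof (rule Plus_left_cancel)
      have "Plus C (Diff Y i \<cdot> Component f i) (Diff Y i \<cdot> m i) = Diff Y i \<cdot> Plus C (Component f i) (m i)"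
        using A X Y m(1-3) by simp
      also have "\<dots> = Plus C (Component f (i + 1)) (m (i + 1)) \<cdot> Diff X i"
        unfolding m' using X Y by simp
      also have "\<dots> = Plus C (Diff Y i \<cdot> Component f i) (m (i + 1) \<cdot> Diff X i)"
        using A X Y m(1-3) Diff_Component[OF A(1)] by simp
      finally show "Plus C (Diff Y i \<cdot> Component f i) (Diff Y i \<cdot> m i) =
        Plus C (Diff Y i \<cdot> Component f i) (m (i + 1) \<cdot> Diff X i)" .
    qed (use A X Y m(1-3) in simp_all)
    then have "ChainMap X Y m \<in> Arr (Cb C)" using X Y m by (intro ChainMap_Arr) auto
    moreover have "Plus (Cb C) (ChainMap X Y m) f = Zero (Cb C) X Y"
      by (intro Cb_eqI) (use m A in \<open>simp_all add: Dom_Cod_Cb\<close>)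
    ultimately show "\<exists>g\<in>carrier (HomGroup (Cb C) X Y). g \<otimes>\<^bsub>HomGroup (Cb C) X Y\<^esub> f = \<one>\<^bsub>HomGroup (Cb C) X Y\<^esub>"
      by (intro bexI[of _ "ChainMap X Y m"]) (simp_all add: HomGroup_def)
  qed
qed

end

section \<open>Kernels and cokernels of chain maps, degree by degree\<close>

context abelian_category
begin

interpretation Cb: preadditive_category "Cb C" by (rule preadditive_category_Cb)

text \<open>Factorizations chosen in each degree commute with the differentials automatically: this
  can be tested after the monomorphism \<open>Component k (i + 1)\<close>.\<close>

lemma Cb_kernelI:
  assumes f: "f \<in> Arr (Cb C)" and k: "k \<in> Arr (Cb C)" and kf: "Cod (Cb C) k = Dom (Cb C) f"
    and ker: "\<And>i. is_kernel C (Component k i) (Component f i)"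
  shows "is_kernel (Cb C) k f"
proof (rule Cb.is_kernelI)
  note K = is_kernelD[OF ker]
  show "f \<in> Arr (Cb C)" "Cod (Cb C) k = Dom (Cb C) f" by fact+
  show "f \<cdot>\<^bsub>Cb C\<^esub> k = Zero (Cb C) (Dom (Cb C) k) (Cod (Cb C) f)"
    by (intro Cb_eqI) (use K(4) f k kf in simp_all)
  show "monomorphism (Cb C) k" unfolding monomorphism_def
  proof (intro conjI ballI impI)
    fix W g h assume gh: "g \<in> Hom (Cb C) W (Dom (Cb C) k)" "h \<in> Hom (Cb C) W (Dom (Cb C) k)"
      "k \<cdot>\<^bsub>Cb C\<^esub> g = k \<cdot>\<^bsub>Cb C\<^esub> h"
    show "g = h"
    proof (rule Cb_eqI)
      fix i
      have "Component (k \<cdot>\<^bsub>Cb C\<^esub> g) i = Component (k \<cdot>\<^bsub>Cb C\<^esub> h) i" using gh(3) by simp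
      then have "Component k i \<cdot> Component g i = Component k i \<cdot> Component h i" by simp
      then show "Component g i = Component h i"
        by (rule mono_cancel[OF K(5)]) (use gh(1,2) k in auto)
    qed (use gh(1,2) in auto)
  qed (rule k)
  fix g assume g: "g \<in> Arr (Cb C)" "Cod (Cb C) g = Dom (Cb C) f"
    "f \<cdot>\<^bsub>Cb C\<^esub> g = Zero (Cb C) (Dom (Cb C) g) (Cod (Cb C) f)"
  let ?X = "Dom (Cb C) g" let ?K = "Dom (Cb C) k"
  have O: "?X \<in> Obj (Cb C)" "?K \<in> Obj (Cb C)" "Dom (Cb C) f \<in> Obj (Cb C)" using g k f by simp_all
  have "\<exists>h. h \<in> Arr C \<and> Dom C h = Term ?X i \<and> Cod C h = Term ?K i \<and> Component k i \<cdot> h = Component g i" for i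
  proof -
    have "Component (f \<cdot>\<^bsub>Cb C\<^esub> g) i = Component (Zero (Cb C) ?X (Cod (Cb C) f)) i" using g(3) by simp
    then have "Component f i \<cdot> Component g i = Zero C (Term ?X i) (Term (Cod (Cb C) f) i)" by simp
    then show ?thesis using is_kernelE[OF ker, of "Component g i" i] f g(1,2) k by (metis Component_Arr)
  qed
  then obtain h where h: "\<And>i. h i \<in> Arr C" "\<And>i. Dom C (h i) = Term ?X i" "\<And>i. Cod C (h i) = Term ?K i"
    "\<And>i. Component k i \<cdot> h i = Component g i" by metis
  have "Diff ?K i \<cdot> h i = h (i + 1) \<cdot> Diff ?X i" for i
  proof (rule mono_cancel[OF K(5)[of "i + 1"]])
    have "Component k (i + 1) \<cdot> (Diff ?K i \<cdot> h i) = (Component k (i + 1) \<cdot> Diff ?K i) \<cdot> h i"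
      using k h(1-3) O by simp
    also have "\<dots> = Diff (Dom (Cb C) f) i \<cdot> (Component k i \<cdot> h i)"
      unfolding Diff_Component[OF k, symmetric] using k kf h(1-3) O by simp
    also have "\<dots> = (Component k (i + 1) \<cdot> h (i + 1)) \<cdot> Diff ?X i"
      unfolding h(4) using Diff_Component[OF g(1)] g(2) by simp
    also have "\<dots> = Component k (i + 1) \<cdot> (h (i + 1) \<cdot> Diff ?X i)" using k h(1-3) O by simp
    finally show "Component k (i + 1) \<cdot> (Diff ?K i \<cdot> h i) = Component k (i + 1) \<cdot> (h (i + 1) \<cdot> Diff ?X i)" .
  qed (use h(1-3) k O in simp_all)
  then have "ChainMap ?X ?K h \<in> Arr (Cb C)" using h O by (intro ChainMap_Arr) auto
  moreover have "k \<cdot>\<^bsub>Cb C\<^esub> ChainMap ?X ?K h = g"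
    by (rule Cb_eqI) (use calculation k g kf h(4) in simp_all)
  ultimately show "\<exists>h. h \<in> Arr (Cb C) \<and> Dom (Cb C) h = Dom (Cb C) g \<and> Cod (Cb C) h = Dom (Cb C) k \<and>
      k \<cdot>\<^bsub>Cb C\<^esub> h = g" by (intro exI[of _ "ChainMap ?X ?K h"]) simp
qed

text \<open>Dually, the chosen factorizations form a chain map because compatibility can be tested
  before the epimorphism \<open>Component c i\<close>.\<close>

lemma Cb_cokernelI:
  assumes f: "f \<in> Arr (Cb C)" and c: "c \<in> Arr (Cb C)" and cf: "Dom (Cb C) c = Cod (Cb C) f"
    and cok: "\<And>i. is_cokernel C (Component c i) (Component f i)"
  shows "is_cokernel (Cb C) c f"
proof (rule Cb.is_cokernelI)
  note K = is_cokernelD[OF cok]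
  show "f \<in> Arr (Cb C)" "Dom (Cb C) c = Cod (Cb C) f" by fact+
  show "c \<cdot>\<^bsub>Cb C\<^esub> f = Zero (Cb C) (Dom (Cb C) f) (Cod (Cb C) c)"
    by (intro Cb_eqI) (use K(4) f c cf in simp_all)
  show "epimorphism (Cb C) c" unfolding epimorphism_def
  proof (intro conjI ballI impI)
    fix W g h assume gh: "g \<in> Hom (Cb C) (Cod (Cb C) c) W" "h \<in> Hom (Cb C) (Cod (Cb C) c) W"
      "g \<cdot>\<^bsub>Cb C\<^esub> c = h \<cdot>\<^bsub>Cb C\<^esub> c"
    show "g = h"
    proof (rule Cb_eqI)
      fix i
      have "Component (g \<cdot>\<^bsub>Cb C\<^esub> c) i = Component (h \<cdot>\<^bsub>Cb C\<^esub> c) i" using gh(3) by simp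
      then have "Component g i \<cdot> Component c i = Component h i \<cdot> Component c i" by simp
      then show "Component g i = Component h i"
        by (rule epi_cancel[OF K(5)]) (use gh(1,2) c in auto)
    qed (use gh(1,2) in auto)
  qed (rule c)
  fix g assume g: "g \<in> Arr (Cb C)" "Dom (Cb C) g = Cod (Cb C) f"
    "g \<cdot>\<^bsub>Cb C\<^esub> f = Zero (Cb C) (Dom (Cb C) f) (Cod (Cb C) g)"
  let ?X = "Cod (Cb C) g" let ?K = "Cod (Cb C) c"
  have O: "?X \<in> Obj (Cb C)" "?K \<in> Obj (Cb C)" "Cod (Cb C) f \<in> Obj (Cb C)" using g c f by simp_all
  have "\<exists>h. h \<in> Arr C \<and> Dom C h = Term ?K i \<and> Cod C h = Term ?X i \<and> h \<cdot> Component c i = Component g i" for i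
  proof -
    have "Component (g \<cdot>\<^bsub>Cb C\<^esub> f) i = Component (Zero (Cb C) (Dom (Cb C) f) ?X) i" using g(3) by simp
    then have "Component g i \<cdot> Component f i = Zero C (Term (Dom (Cb C) f) i) (Term ?X i)" by simp
    then show ?thesis using is_cokernelE[OF cok, of "Component g i" i] f g(1,2) c by (metis Component_Arr)
  qed
  then obtain h where h: "\<And>i. h i \<in> Arr C" "\<And>i. Dom C (h i) = Term ?K i" "\<And>i. Cod C (h i) = Term ?X i"
    "\<And>i. h i \<cdot> Component c i = Component g i" by metis
  have "Diff ?X i \<cdot> h i = h (i + 1) \<cdot> Diff ?K i" for i
  proof (rule epi_cancel[OF K(5)[of i]])
    have "(h (i + 1) \<cdot> Diff ?K i) \<cdot> Component c i = h (i + 1) \<cdot> (Diff ?K i \<cdot> Component c i)"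
      using c h(1-3) O by simp
    also have "\<dots> = (h (i + 1) \<cdot> Component c (i + 1)) \<cdot> Diff (Cod (Cb C) f) i"
      unfolding Diff_Component[OF c] using c cf h(1-3) O by simp
    also have "\<dots> = Diff ?X i \<cdot> (h i \<cdot> Component c i)"
      unfolding h(4) using Diff_Component[OF g(1)] g(2) by simp
    also have "\<dots> = (Diff ?X i \<cdot> h i) \<cdot> Component c i" using c h(1-3) O by simp
    finally show "(Diff ?X i \<cdot> h i) \<cdot> Component c i = (h (i + 1) \<cdot> Diff ?K i) \<cdot> Component c i" by simp
  qed (use h(1-3) c O in simp_all)
  then have "ChainMap ?K ?X h \<in> Arr (Cb C)" using h O by (intro ChainMap_Arr) auto
  moreover have "ChainMap ?K ?X h \<cdot>\<^bsub>Cb C\<^esub> c = g"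
    by (rule Cb_eqI) (use calculation c g cf h(4) in simp_all)
  ultimately show "\<exists>h. h \<in> Arr (Cb C) \<and> Dom (Cb C) h = Cod (Cb C) c \<and> Cod (Cb C) h = Cod (Cb C) g \<and>
      h \<cdot>\<^bsub>Cb C\<^esub> c = g" by (intro exI[of _ "ChainMap ?K ?X h"]) simp
qed

text \<open>The differential restricts to the kernels because \<open>f\<close> is a chain map. Its
  square vanishes after a monomorphism, and a subobject of a zero object is zero, which gives the
  bounds.\<close>

lemma ex_degreewise_kernel:
  assumes f: "f \<in> Arr (Cb C)"
  obtains k where "is_kernel (Cb C) k f" "\<And>i. is_kernel C (Component k i) (Component f i)"
proof -
  let ?X = "Dom (Cb C) f" let ?Y = "Cod (Cb C) f"
  have O: "?X \<in> Obj (Cb C)" "?Y \<in> Obj (Cb C)" using f by simp_all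
  have "\<exists>k. is_kernel C k (Component f i)" for i using ex_kernel f by simp
  then obtain k where k: "\<And>i. is_kernel C (k i) (Component f i)" by metis
  note K = is_kernelD[OF k]
  have kA [simp]: "k i \<in> Arr C" "Cod C (k i) = Term ?X i" for i using K(1,3) f by simp_all
  have "\<exists>d. d \<in> Arr C \<and> Dom C d = Dom C (k i) \<and> Cod C d = Dom C (k (i + 1)) \<and>
      k (i + 1) \<cdot> d = Diff ?X i \<cdot> k i" for i
  proof -
    have "Component f (i + 1) \<cdot> (Diff ?X i \<cdot> k i) = (Component f (i + 1) \<cdot> Diff ?X i) \<cdot> k i"
      using f O by simp
    also have "\<dots> = Diff ?Y i \<cdot> (Component f i \<cdot> k i)"
      unfolding Diff_Component[OF f, symmetric] using f O by simp
    also have "\<dots> = Zero C (Dom C (k i)) (Term ?Y (i + 1))" unfolding K(4) using f O by simp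
    finally show ?thesis using is_kernelE[OF k, of "Diff ?X i \<cdot> k i" "i + 1"] O f by auto
  qed
  then obtain d where d: "\<And>i. d i \<in> Arr C" "\<And>i. Dom C (d i) = Dom C (k i)"
    "\<And>i. Cod C (d i) = Dom C (k (i + 1))" "\<And>i. k (i + 1) \<cdot> d i = Diff ?X i \<cdot> k i" by metis
  define K' where "K' = Cochain (\<lambda>i. Dom C (k i)) d"
  have "K' \<in> Obj (Cb C)" unfolding K'_def
  proof (rule Obj_CbI)
    fix i
    show "d (i + 1) \<cdot> d i = Zero C (Dom C (k i)) (Dom C (k (i + 1 + 1)))"
    proof (rule mono_cancel[OF K(5)[of "i + 1 + 1"]])
      have "k (i + 1 + 1) \<cdot> (d (i + 1) \<cdot> d i) = (k (i + 1 + 1) \<cdot> d (i + 1)) \<cdot> d i"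
        using d(1-3) by simp
      also have "\<dots> = (Diff ?X (i + 1) \<cdot> k (i + 1)) \<cdot> d i" unfolding d(4) ..
      also have "\<dots> = Diff ?X (i + 1) \<cdot> (k (i + 1) \<cdot> d i)" using d(1-3) O by simp
      also have "\<dots> = (Diff ?X (i + 1) \<cdot> Diff ?X i) \<cdot> k i" unfolding d(4) using O by simp
      also have "\<dots> = k (i + 1 + 1) \<cdot> Zero C (Dom C (k i)) (Dom C (k (i + 1 + 1)))"
        unfolding Diff_Diff[OF O(1)] using O by simp
      finally show "k (i + 1 + 1) \<cdot> (d (i + 1) \<cdot> d i) =
        k (i + 1 + 1) \<cdot> Zero C (Dom C (k i)) (Dom C (k (i + 1 + 1)))" .
    qed (use d(1-3) in simp_all)
  next
    have "zero_object C (Dom C (k i))" if "zero_object C (Term ?X i)" for i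
      using mono_into_zero[OF K(5)] that by simp
    then show "is_bounded C (Cochain (\<lambda>i. Dom C (k i)) d)"
      by - (rule is_bounded_transfer[of C ?X], use O in \<open>simp_all add: Obj_Cb_iff\<close>)
  qed (use d(1-3) in simp_all)
  then have "ChainMap K' ?X k \<in> Arr (Cb C)"
    by (rule ChainMap_Arr[OF _ O(1)]) (simp_all add: K'_def d(4))
  then have "is_kernel (Cb C) (ChainMap K' ?X k) f" using f k by (intro Cb_kernelI) simp_all
  then show ?thesis using that k by simp
qed

lemma ex_degreewise_cokernel:
  assumes f: "f \<in> Arr (Cb C)"
  obtains c where "is_cokernel (Cb C) c f" "\<And>i. is_cokernel C (Component c i) (Component f i)"
proof -
  let ?X = "Cod (Cb C) f" let ?Y = "Dom (Cb C) f"
  have O: "?X \<in> Obj (Cb C)" "?Y \<in> Obj (Cb C)" using f by simp_all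
  have "\<exists>c. is_cokernel C c (Component f i)" for i using ex_cokernel f by simp
  then obtain k where k: "\<And>i. is_cokernel C (k i) (Component f i)" by metis
  note K = is_cokernelD[OF k]
  have kA [simp]: "k i \<in> Arr C" "Dom C (k i) = Term ?X i" for i using K(1,3) f by simp_all
  have "\<exists>d. d \<in> Arr C \<and> Dom C d = Cod C (k i) \<and> Cod C d = Cod C (k (i + 1)) \<and>
      d \<cdot> k i = k (i + 1) \<cdot> Diff ?X i" for i
  proof -
    have "(k (i + 1) \<cdot> Diff ?X i) \<cdot> Component f i = k (i + 1) \<cdot> (Diff ?X i \<cdot> Component f i)"
      using f O by simp
    also have "\<dots> = (k (i + 1) \<cdot> Component f (i + 1)) \<cdot> Diff ?Y i"
      unfolding Diff_Component[OF f] using f O by simp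
    also have "\<dots> = Zero C (Term ?Y i) (Cod C (k (i + 1)))" unfolding K(4) using f O by simp
    finally show ?thesis using is_cokernelE[OF k, of "k (i + 1) \<cdot> Diff ?X i" i] O f by auto
  qed
  then obtain d where d: "\<And>i. d i \<in> Arr C" "\<And>i. Dom C (d i) = Cod C (k i)"
    "\<And>i. Cod C (d i) = Cod C (k (i + 1))" "\<And>i. d i \<cdot> k i = k (i + 1) \<cdot> Diff ?X i" by metis
  define K' where "K' = Cochain (\<lambda>i. Cod C (k i)) d"
  have "K' \<in> Obj (Cb C)" unfolding K'_def
  proof (rule Obj_CbI)
    fix i
    show "d (i + 1) \<cdot> d i = Zero C (Cod C (k i)) (Cod C (k (i + 1 + 1)))"
    proof (rule epi_cancel[OF K(5)[of i]])
      have "(d (i + 1) \<cdot> d i) \<cdot> k i = d (i + 1) \<cdot> (d i \<cdot> k i)"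
        using d(1-3) by simp
      also have "\<dots> = d (i + 1) \<cdot> (k (i + 1) \<cdot> Diff ?X i)" unfolding d(4) ..
      also have "\<dots> = (d (i + 1) \<cdot> k (i + 1)) \<cdot> Diff ?X i" using d(1-3) O by simp
      also have "\<dots> = k (i + 1 + 1) \<cdot> (Diff ?X (i + 1) \<cdot> Diff ?X i)" unfolding d(4) using O by simp
      also have "\<dots> = Zero C (Cod C (k i)) (Cod C (k (i + 1 + 1))) \<cdot> k i"
        unfolding Diff_Diff[OF O(1)] using O by simp
      finally show "(d (i + 1) \<cdot> d i) \<cdot> k i = Zero C (Cod C (k i)) (Cod C (k (i + 1 + 1))) \<cdot> k i" .
    qed (use d(1-3) in simp_all)
  next
    have "zero_object C (Cod C (k i))" if "zero_object C (Term ?X i)" for i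
      using epi_from_zero[OF K(5)] that by simp
    then show "is_bounded C (Cochain (\<lambda>i. Cod C (k i)) d)"
      by - (rule is_bounded_transfer[of C ?X], use O in \<open>simp_all add: Obj_Cb_iff\<close>)
  qed (use d(1-3) in simp_all)
  then have "ChainMap ?X K' k \<in> Arr (Cb C)"
    by (rule ChainMap_Arr[OF O(1)]) (simp_all add: K'_def d(4))
  then have "is_cokernel (Cb C) (ChainMap ?X K' k) f" using f k by (intro Cb_cokernelI) simp_all
  then show ?thesis using that k by simp
qed

text \<open>Any kernel is isomorphic to the one built in each degree, and the components of an
  isomorphism of complexes are isomorphisms.\<close>

lemma Cb_kernelD:
  assumes k: "is_kernel (Cb C) k f"
  shows "is_kernel C (Component k i) (Component f i)"
proof -
  note K = Cb.is_kernelD[OF k]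
  obtain k' where k': "is_kernel (Cb C) k' f" "\<And>i. is_kernel C (Component k' i) (Component f i)"
    using ex_degreewise_kernel[OF K(2)] by blast
  note K' = Cb.is_kernelD[OF k'(1)]
  obtain u v where uv: "u \<in> Hom (Cb C) (Dom (Cb C) k) (Dom (Cb C) k')"
    "v \<in> Hom (Cb C) (Dom (Cb C) k') (Dom (Cb C) k)"
    and vu: "v \<cdot>\<^bsub>Cb C\<^esub> u = Idn (Cb C) (Dom (Cb C) k)" "u \<cdot>\<^bsub>Cb C\<^esub> v = Idn (Cb C) (Dom (Cb C) k')"
    and ku: "k' \<cdot>\<^bsub>Cb C\<^esub> u = k"
    using Cb.kernel_unique[OF k k'(1)] by blast
  have "Component (v \<cdot>\<^bsub>Cb C\<^esub> u) i = Idn C (Term (Dom (Cb C) k) i)"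
    "Component (u \<cdot>\<^bsub>Cb C\<^esub> v) i = Idn C (Term (Dom (Cb C) k') i)"
    unfolding vu by simp_all
  then have "is_kernel C (Component k' i \<cdot> Component u i) (Component f i)"
    by (intro kernel_Comp_iso[OF k'(2), where v = "Component v i" and X = "Term (Dom (Cb C) k) i"])
      (use uv K'(1) in auto)
  also have "Component k' i \<cdot> Component u i = Component k i" using ku by auto
  finally show ?thesis .
qed

lemma Cb_cokernelD:
  assumes k: "is_cokernel (Cb C) k f"
  shows "is_cokernel C (Component k i) (Component f i)"
proof -
  note K = Cb.is_cokernelD[OF k]
  obtain k' where k': "is_cokernel (Cb C) k' f" "\<And>i. is_cokernel C (Component k' i) (Component f i)"
    using ex_degreewise_cokernel[OF K(2)] by blast
  note K' = Cb.is_cokernelD[OF k'(1)]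
  obtain u v where uv: "u \<in> Hom (Cb C) (Cod (Cb C) k') (Cod (Cb C) k)"
    "v \<in> Hom (Cb C) (Cod (Cb C) k) (Cod (Cb C) k')"
    and vu: "v \<cdot>\<^bsub>Cb C\<^esub> u = Idn (Cb C) (Cod (Cb C) k')" "u \<cdot>\<^bsub>Cb C\<^esub> v = Idn (Cb C) (Cod (Cb C) k)"
    and ku: "u \<cdot>\<^bsub>Cb C\<^esub> k' = k"
    using Cb.cokernel_unique[OF k'(1) k] by blast
  have "Component (v \<cdot>\<^bsub>Cb C\<^esub> u) i = Idn C (Term (Cod (Cb C) k') i)"
    "Component (u \<cdot>\<^bsub>Cb C\<^esub> v) i = Idn C (Term (Cod (Cb C) k) i)"
    unfolding vu by simp_all
  then have "is_cokernel C (Component u i \<cdot> Component k' i) (Component f i)"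
    by (intro cokernel_iso_Comp[OF k'(2), where v = "Component v i" and X = "Term (Cod (Cb C) k) i"])
      (use uv K'(1) in auto)
  also have "Component u i \<cdot> Component k' i = Component k i" using ku by auto
  finally show ?thesis .
qed

text \<open>The kernel of a monomorphism is zero and is computed in each degree, so every component
  has zero kernel.\<close>

lemma Cb_monoD:
  assumes f: "monomorphism (Cb C) f"
  shows "monomorphism C (Component f i)"
proof -
  have A: "f \<in> Arr (Cb C)" using f by (simp add: monomorphism_def)
  obtain k where k: "is_kernel (Cb C) k f" using ex_degreewise_kernel[OF A] by blast
  note K = Cb.is_kernelD[OF k]
  have "k = Zero (Cb C) (Dom (Cb C) k) (Dom (Cb C) f)"
    using f K unfolding Cb.mono_iff_Zero by blast
  then have k0: "Component k i = Zero C (Term (Dom (Cb C) k) i) (Term (Dom (Cb C) f) i)"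
    by (metis Component_Cb(4))
  have "g = Zero C (Dom C g) (Term (Dom (Cb C) f) i)"
    if g: "g \<in> Arr C" "Cod C g = Term (Dom (Cb C) f) i"
      "Component f i \<cdot> g = Zero C (Dom C g) (Term (Cod (Cb C) f) i)" for g
  proof -
    obtain h where h: "h \<in> Arr C" "Dom C h = Dom C g" "Cod C h = Term (Dom (Cb C) k) i" "Component k i \<cdot> h = g"
      using is_kernelE[OF Cb_kernelD[OF k], of g i] g A K(1) by (metis Component_Arr)
    then show ?thesis unfolding k0 using Dom_Obj[OF g(1)] A by simp
  qed
  then show ?thesis using A by (simp add: mono_iff_Zero)
qed

lemma Cb_epiD:
  assumes f: "epimorphism (Cb C) f"
  shows "epimorphism C (Component f i)"
proof -
  have A: "f \<in> Arr (Cb C)" using f by (simp add: epimorphism_def)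
  obtain k where k: "is_cokernel (Cb C) k f" using ex_degreewise_cokernel[OF A] by blast
  note K = Cb.is_cokernelD[OF k]
  have "k = Zero (Cb C) (Cod (Cb C) f) (Cod (Cb C) k)"
    using f K unfolding Cb.epi_iff_Zero by blast
  then have k0: "Component k i = Zero C (Term (Cod (Cb C) f) i) (Term (Cod (Cb C) k) i)"
    by (metis Component_Cb(4))
  have "g = Zero C (Term (Cod (Cb C) f) i) (Cod C g)"
    if g: "g \<in> Arr C" "Dom C g = Term (Cod (Cb C) f) i"
      "g \<cdot> Component f i = Zero C (Term (Dom (Cb C) f) i) (Cod C g)" for g
  proof -
    obtain h where h: "h \<in> Arr C" "Cod C h = Cod C g" "Dom C h = Term (Cod (Cb C) k) i" "h \<cdot> Component k i = g"
      using is_cokernelE[OF Cb_cokernelD[OF k], of g i] g A K(1) by (metis Component_Arr)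
    then show ?thesis unfolding k0 using Cod_Obj[OF g(1)] A by simp
  qed
  then show ?thesis using A by (simp add: epi_iff_Zero)
qed

lemma Cb_epiI:
  assumes f: "f \<in> Arr (Cb C)" and e: "\<And>i. epimorphism C (Component f i)"
  shows "epimorphism (Cb C) f"
  unfolding epimorphism_def
proof (intro conjI ballI impI)
  fix W g h assume gh: "g \<in> Hom (Cb C) (Cod (Cb C) f) W" "h \<in> Hom (Cb C) (Cod (Cb C) f) W"
    "g \<cdot>\<^bsub>Cb C\<^esub> f = h \<cdot>\<^bsub>Cb C\<^esub> f"
  show "g = h"
  proof (rule Cb_eqI)
    fix i
    have "Component (g \<cdot>\<^bsub>Cb C\<^esub> f) i = Component (h \<cdot>\<^bsub>Cb C\<^esub> f) i" using gh(3) by simp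
    then have "Component g i \<cdot> Component f i = Component h i \<cdot> Component f i" by simp
    then show "Component g i = Component h i"
      by (rule epi_cancel[OF e]) (use gh(1,2) f in auto)
  qed (use gh(1,2) in auto)
qed (rule f)

end

section \<open>Chosen biproducts, the abelian structure on complexes, contractible complexes\<close>

context abelian_category
begin

text \<open>Each choice is made relative to the earlier ones, so that together they fix one
  biproduct for every pair of objects; the differentials of sums can then be given by
  formulas.\<close>

definition sum_obj where "sum_obj X Y = (SOME B. \<exists>i j p q. biproduct C X Y B i j p q)"
definition in1 where "in1 X Y = (SOME i. \<exists>j p q. biproduct C X Y (sum_obj X Y) i j p q)"
definition in2 where "in2 X Y = (SOME j. \<exists>p q. biproduct C X Y (sum_obj X Y) (in1 X Y) j p q)"
definition pr1 where "pr1 X Y = (SOME p. \<exists>q. biproduct C X Y (sum_obj X Y) (in1 X Y) (in2 X Y) p q)"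
definition pr2 where "pr2 X Y = (SOME q. biproduct C X Y (sum_obj X Y) (in1 X Y) (in2 X Y) (pr1 X Y) q)"

lemma biproduct_sum_obj:
  assumes "X \<in> Obj C" "Y \<in> Obj C"
  shows "biproduct C X Y (sum_obj X Y) (in1 X Y) (in2 X Y) (pr1 X Y) (pr2 X Y)"
proof -
  have "\<exists>B i j p q. biproduct C X Y B i j p q" using ex_biproduct[OF assms] by metis
  then have "\<exists>i j p q. biproduct C X Y (sum_obj X Y) i j p q" unfolding sum_obj_def by (rule someI_ex)
  then have "\<exists>j p q. biproduct C X Y (sum_obj X Y) (in1 X Y) j p q" unfolding in1_def by (rule someI_ex)
  then have "\<exists>p q. biproduct C X Y (sum_obj X Y) (in1 X Y) (in2 X Y) p q"
    unfolding in2_def by (rule someI_ex)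
  then have "\<exists>q. biproduct C X Y (sum_obj X Y) (in1 X Y) (in2 X Y) (pr1 X Y) q"
    unfolding pr1_def by (rule someI_ex)
  then show ?thesis unfolding pr2_def by (rule someI_ex)
qed

lemmas sum_obj_simps [simp] =
  biproduct.biproduct_Arr[OF biproduct_sum_obj] biproduct.biproduct_Obj(3)[OF biproduct_sum_obj]
  biproduct.biproduct_Comp[OF biproduct_sum_obj] biproduct.biproduct_Comp_Comp[OF biproduct_sum_obj]

lemmas eq_into_sum = biproduct.eq_into_biproduct[OF biproduct_sum_obj]
lemmas eq_from_sum = biproduct.eq_from_biproduct[OF biproduct_sum_obj]

lemma zero_object_sum_obj:
  assumes X: "zero_object C X" and Y: "zero_object C Y"
  shows "zero_object C (sum_obj X Y)"
proof -
  have O: "X \<in> Obj C" "Y \<in> Obj C" using X Y by (auto simp: zero_object_def)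
  have "Idn C (sum_obj X Y) = Zero C (sum_obj X Y) (sum_obj X Y)"
  proof (rule eq_into_sum[OF O])
    show "pr1 X Y \<cdot> Idn C (sum_obj X Y) = pr1 X Y \<cdot> Zero C (sum_obj X Y) (sum_obj X Y)"
      using Zero_if_zero_Cod[of "pr1 X Y"] O X by simp
    show "pr2 X Y \<cdot> Idn C (sum_obj X Y) = pr2 X Y \<cdot> Zero C (sum_obj X Y) (sum_obj X Y)"
      using Zero_if_zero_Cod[of "pr2 X Y"] O Y by simp
  qed (use O in simp_all)
  then show ?thesis using O by (simp add: zero_object_iff)
qed

interpretation Cb: preadditive_category "Cb C" by (rule preadditive_category_Cb)

lemma ex_product_Cb:
  assumes X: "X \<in> Obj (Cb C)" and Y: "Y \<in> Obj (Cb C)"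
  shows "\<exists>P p q. is_product (Cb C) X Y P p q"
proof -
  let ?d = "\<lambda>i. Plus C (in1 (Term X (i + 1)) (Term Y (i + 1)) \<cdot> (Diff X i \<cdot> pr1 (Term X i) (Term Y i)))
    (in2 (Term X (i + 1)) (Term Y (i + 1)) \<cdot> (Diff Y i \<cdot> pr2 (Term X i) (Term Y i)))"
  define P where "P = Cochain (\<lambda>i. sum_obj (Term X i) (Term Y i)) ?d"
  have dd: "Diff X (i + 1) \<cdot> (Diff X i \<cdot> f) = Zero C (Dom C f) (Term X (i + 1 + 1))"
    if "f \<in> Arr C" "Cod C f = Term X i" for f i
  proof -
    have "Diff X (i + 1) \<cdot> (Diff X i \<cdot> f) = (Diff X (i + 1) \<cdot> Diff X i) \<cdot> f" using X that by simp
    then show ?thesis unfolding Diff_Diff[OF X] using X that by simp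
  qed
  have dd': "Diff Y (i + 1) \<cdot> (Diff Y i \<cdot> f) = Zero C (Dom C f) (Term Y (i + 1 + 1))"
    if "f \<in> Arr C" "Cod C f = Term Y i" for f i
  proof -
    have "Diff Y (i + 1) \<cdot> (Diff Y i \<cdot> f) = (Diff Y (i + 1) \<cdot> Diff Y i) \<cdot> f" using Y that by simp
    then show ?thesis unfolding Diff_Diff[OF Y] using Y that by simp
  qed
  have bd: "is_bounded C (Cochain (\<lambda>i. sum_obj (Term X i) (Term Y i)) ?d)"
  proof -
    obtain a b a' b' where "\<And>i. i < a \<or> b < i \<Longrightarrow> zero_object C (Term X i)"
      "\<And>i. i < a' \<or> b' < i \<Longrightarrow> zero_object C (Term Y i)"
      using X Y unfolding Obj_Cb_iff is_bounded_def by metis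
    then have "zero_object C (sum_obj (Term X i) (Term Y i))" if "i < min a a' \<or> max b b' < i" for i
      using that by (intro zero_object_sum_obj) auto
    then show ?thesis unfolding is_bounded_def cochain.sel by blast
  qed
  have P: "P \<in> Obj (Cb C)" unfolding P_def
    by (rule Obj_CbI[OF _ _ _ _ _ bd]) (use X Y dd dd' in simp_all)
  let ?p = "ChainMap P X (\<lambda>i. pr1 (Term X i) (Term Y i))"
  let ?q = "ChainMap P Y (\<lambda>i. pr2 (Term X i) (Term Y i))"
  have p: "?p \<in> Arr (Cb C)" by (rule ChainMap_Arr[OF P X]) (use X Y in \<open>simp_all add: P_def\<close>)
  have q: "?q \<in> Arr (Cb C)" by (rule ChainMap_Arr[OF P Y]) (use X Y in \<open>simp_all add: P_def\<close>)
  have "\<exists>!h. h \<in> Hom (Cb C) W P \<and> ?p \<cdot>\<^bsub>Cb C\<^esub> h = f \<and> ?q \<cdot>\<^bsub>Cb C\<^esub> h = g"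
    if f: "f \<in> Hom (Cb C) W X" and g: "g \<in> Hom (Cb C) W Y" for W f g
  proof (rule ex_ex1I)
    have W: "W \<in> Obj (Cb C)" using f by auto
    have A: "f \<in> Arr (Cb C)" "Dom (Cb C) f = W" "Cod (Cb C) f = X"
      "g \<in> Arr (Cb C)" "Dom (Cb C) g = W" "Cod (Cb C) g = Y" using f g by auto
    let ?h = "\<lambda>i. Plus C (in1 (Term X i) (Term Y i) \<cdot> Component f i) (in2 (Term X i) (Term Y i) \<cdot> Component g i)"
    have "ChainMap W P ?h \<in> Arr (Cb C)"
      by (rule ChainMap_Arr[OF W P])
        (use A X Y W Diff_Component[OF A(1)] Diff_Component[OF A(4)] in \<open>simp_all add: P_def\<close>)
    moreover have "?p \<cdot>\<^bsub>Cb C\<^esub> ChainMap W P ?h = f"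
      by (rule Cb_eqI) (use calculation p A X Y W in simp_all)
    moreover have "?q \<cdot>\<^bsub>Cb C\<^esub> ChainMap W P ?h = g"
      by (rule Cb_eqI) (use calculation(1) q A X Y W in simp_all)
    ultimately show "\<exists>h. h \<in> Hom (Cb C) W P \<and> ?p \<cdot>\<^bsub>Cb C\<^esub> h = f \<and> ?q \<cdot>\<^bsub>Cb C\<^esub> h = g"
      by (intro exI[of _ "ChainMap W P ?h"]) simp
    fix h h' assume h: "h \<in> Hom (Cb C) W P \<and> ?p \<cdot>\<^bsub>Cb C\<^esub> h = f \<and> ?q \<cdot>\<^bsub>Cb C\<^esub> h = g"
      and h': "h' \<in> Hom (Cb C) W P \<and> ?p \<cdot>\<^bsub>Cb C\<^esub> h' = f \<and> ?q \<cdot>\<^bsub>Cb C\<^esub> h' = g"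
    have "?p \<cdot>\<^bsub>Cb C\<^esub> h = ?p \<cdot>\<^bsub>Cb C\<^esub> h'" "?q \<cdot>\<^bsub>Cb C\<^esub> h = ?q \<cdot>\<^bsub>Cb C\<^esub> h'" using h h' by metis+
    then have e: "Component (?p \<cdot>\<^bsub>Cb C\<^esub> h) i = Component (?p \<cdot>\<^bsub>Cb C\<^esub> h') i"
      "Component (?q \<cdot>\<^bsub>Cb C\<^esub> h) i = Component (?q \<cdot>\<^bsub>Cb C\<^esub> h') i" for i by metis+
    have B: "h \<in> Arr (Cb C)" "Dom (Cb C) h = W" "Cod (Cb C) h = P"
      "h' \<in> Arr (Cb C)" "Dom (Cb C) h' = W" "Cod (Cb C) h' = P" using h h' by auto
    show "h = h'"
    proof (rule Cb_eqI)
      fix i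
      show "Component h i = Component h' i"
        by (rule eq_into_sum[of "Term X i" "Term Y i"])
          (use e[of i] B X Y in \<open>simp_all add: P_def\<close>)
    qed (use B in simp_all)
  qed
  moreover have "?p \<in> Hom (Cb C) P X" "?q \<in> Hom (Cb C) P Y" using p q by simp_all
  ultimately have "is_product (Cb C) X Y P ?p ?q" unfolding is_product_def by blast
  then show ?thesis by blast
qed

lemma abelian_category_Cb: "abelian_category (Cb C)"
proof (intro abelian_category.intro preadditive_category_Cb abelian_category_axioms.intro)
  obtain Z where Z: "zero_object C Z" using ex_zero_object by blast
  then have O: "Z \<in> Obj C" by (simp add: zero_object_def)
  have "Cochain (\<lambda>_. Z) (\<lambda>_. Zero C Z Z) \<in> Obj (Cb C)"
    by (rule Obj_CbI) (use O Z in \<open>simp_all add: is_bounded_def\<close>)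
  then have "zero_object (Cb C) (Cochain (\<lambda>_. Z) (\<lambda>_. Zero C Z Z))"
    unfolding Cb.zero_object_iff using Z by (auto intro!: Cb_eqI simp: zero_object_iff)
  then show "\<exists>Z. zero_object (Cb C) Z" by blast
next
  fix X Y assume "X \<in> Obj (Cb C)" "Y \<in> Obj (Cb C)"
  then show "\<exists>P p q. is_product (Cb C) X Y P p q" by (rule ex_product_Cb)
next
  fix f assume f: "f \<in> Arr (Cb C)"
  show "\<exists>k. is_kernel (Cb C) k f" using ex_degreewise_kernel[OF f] by metis
  show "\<exists>c. is_cokernel (Cb C) c f" using ex_degreewise_cokernel[OF f] by metis
next
  fix f c assume f: "monomorphism (Cb C) f" and c: "is_cokernel (Cb C) c f"
  show "is_kernel (Cb C) f c"
    using Cb.is_cokernelD[OF c] mono_kernel[OF Cb_monoD[OF f] Cb_cokernelD[OF c]]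
    by (intro Cb_kernelI) simp_all
next
  fix f k assume f: "epimorphism (Cb C) f" and k: "is_kernel (Cb C) k f"
  show "is_cokernel (Cb C) f k"
    using Cb.is_kernelD[OF k] epi_cokernel[OF Cb_epiD[OF f] Cb_kernelD[OF k]]
    by (intro Cb_cokernelI) simp_all
qed

section \<open>Projective bounded complexes\<close>

definition bounded_family :: "(int \<Rightarrow> 'a) \<Rightarrow> bool" where
  "bounded_family Q \<longleftrightarrow> (\<forall>i. Q i \<in> Obj C) \<and> (\<exists>a b. \<forall>i. i < a \<or> b < i \<longrightarrow> zero_object C (Q i))"

text \<open>The direct sum of the contractible complexes that have \<open>Q i\<close> in degrees \<open>i - 1\<close> and \<open>i\<close>.\<close>

definition disc :: "(int \<Rightarrow> 'a) \<Rightarrow> ('a, 'b) cochain" where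
  "disc Q = Cochain (\<lambda>i. sum_obj (Q i) (Q (i + 1)))
     (\<lambda>i. in1 (Q (i + 1)) (Q (i + 1 + 1)) \<cdot> pr2 (Q i) (Q (i + 1)))"

text \<open>The first coordinates \<open>\<phi> i\<close> are free. Compatibility with the
  differential forces the second coordinate in degree \<open>i\<close> to be
  \<open>\<phi> (i + 1) \<cdot> Diff X i\<close>.\<close>

definition into_disc :: "('a, 'b) cochain \<Rightarrow> (int \<Rightarrow> 'a) \<Rightarrow> (int \<Rightarrow> 'b) \<Rightarrow> ('a, 'b) chain_map" where
  "into_disc X Q \<phi> = ChainMap X (disc Q) (\<lambda>i. Plus C (in1 (Q i) (Q (i + 1)) \<cdot> \<phi> i)
     (in2 (Q i) (Q (i + 1)) \<cdot> (\<phi> (i + 1) \<cdot> Diff X i)))"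

text \<open>The values \<open>\<psi> i\<close> on the second summand \<open>Q (i + 1)\<close> of
  degree \<open>i\<close> are free. The first summand \<open>Q i\<close> is hit isomorphically from
  degree \<open>i - 1\<close>, so its value is forced.\<close>

definition from_disc :: "('a, 'b) cochain \<Rightarrow> (int \<Rightarrow> 'a) \<Rightarrow> (int \<Rightarrow> 'b) \<Rightarrow> ('a, 'b) chain_map" where
  "from_disc X Q \<psi> = ChainMap (disc Q) X (\<lambda>i. Plus C (\<psi> i \<cdot> pr2 (Q i) (Q (i + 1)))
     (Diff X (i - 1) \<cdot> (\<psi> (i - 1) \<cdot> pr1 (Q i) (Q (i + 1)))))"

lemma disc_simps [simp]:
  "Term (disc Q) i = sum_obj (Q i) (Q (i + 1))"
  "Diff (disc Q) i = in1 (Q (i + 1)) (Q (i + 1 + 1)) \<cdot> pr2 (Q i) (Q (i + 1))"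
  "Dom (Cb C) (into_disc X Q \<phi>) = X" "Cod (Cb C) (into_disc X Q \<phi>) = disc Q"
  "Dom (Cb C) (from_disc X Q \<phi>) = disc Q" "Cod (Cb C) (from_disc X Q \<phi>) = X"
  by (simp_all add: disc_def into_disc_def from_disc_def)

lemma bounded_family_Obj: "bounded_family Q \<Longrightarrow> Q i \<in> Obj C"
  by (simp add: bounded_family_def)

lemma disc_Obj:
  assumes Q: "bounded_family Q"
  shows "disc Q \<in> Obj (Cb C)"
  unfolding disc_def
proof (rule Obj_CbI)
  note [simp] = bounded_family_Obj[OF Q]
  obtain a b where "\<And>i. i < a \<or> b < i \<Longrightarrow> zero_object C (Q i)"
    using Q unfolding bounded_family_def by blast
  \<comment> \<open>Degree \<open>i\<close> also contains \<open>Q (i + 1)\<close>, hence the lower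
    bound moves down by one.\<close>
  then have "zero_object C (sum_obj (Q i) (Q (i + 1)))" if "i < a - 1 \<or> b < i" for i
    using that by (intro zero_object_sum_obj) auto
  then show "is_bounded C (Cochain (\<lambda>i. sum_obj (Q i) (Q (i + 1)))
     (\<lambda>i. in1 (Q (i + 1)) (Q (i + 1 + 1)) \<cdot> pr2 (Q i) (Q (i + 1))))"
    unfolding is_bounded_def by auto
qed (use bounded_family_Obj[OF Q] in simp_all)

lemma into_disc_Arr:
  assumes X: "X \<in> Obj (Cb C)" and Q: "bounded_family Q" and \<phi>: "\<And>i. \<phi> i \<in> Hom C (Term X i) (Q i)"
  shows "into_disc X Q \<phi> \<in> Arr (Cb C)"
proof -
  note [simp] = bounded_family_Obj[OF Q]
  have [simp]: "\<phi> i \<in> Arr C" "Dom C (\<phi> i) = Term X i" "Cod C (\<phi> i) = Q i" for i using \<phi> by auto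
  \<comment> \<open>This is the second coordinate of the map after the differential of
    \<open>X\<close>; it has to vanish since the differential of \<open>disc Q\<close> lands in the
    first summand.\<close>
  have z: "\<phi> (i + 1 + 1) \<cdot> (Diff X (i + 1) \<cdot> Diff X i) = Zero C (Term X i) (Q (i + 1 + 1))" for i
    unfolding Diff_Diff[OF X] using X by simp
  show ?thesis unfolding into_disc_def
    by (rule ChainMap_Arr[OF X disc_Obj[OF Q]]) (use X z in simp_all)
qed

lemma from_disc_Arr:
  assumes X: "X \<in> Obj (Cb C)" and Q: "bounded_family Q" and \<psi>: "\<And>i. \<psi> i \<in> Hom C (Q (i + 1)) (Term X i)"
  shows "from_disc X Q \<psi> \<in> Arr (Cb C)"
proof -
  note [simp] = bounded_family_Obj[OF Q]
  have [simp]: "\<psi> i \<in> Arr C" "Dom C (\<psi> i) = Q (i + 1)" "Cod C (\<psi> i) = Term X i" for i using \<psi> by auto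
  have z: "Diff X i \<cdot> (Diff X (i - 1) \<cdot> f) = Zero C (Dom C f) (Term X (i + 1))"
    if "f \<in> Arr C" "Cod C f = Term X (i - 1)" for f i
  proof -
    have "Diff X i \<cdot> (Diff X (i - 1) \<cdot> f) = (Diff X (i - 1 + 1) \<cdot> Diff X (i - 1)) \<cdot> f"
      using X that by simp
    then show ?thesis unfolding Diff_Diff[OF X] using X that by simp
  qed
  show ?thesis unfolding from_disc_def
    by (rule ChainMap_Arr[OF disc_Obj[OF Q] X]) (use X z in simp_all)
qed

text \<open>The second coordinate in degree \<open>i\<close> is recovered from the first coordinate
  in degree \<open>i + 1\<close> by composing with \<open>Diff X i\<close>.\<close>

lemma eq_into_disc:
  assumes Q: "bounded_family Q" and f: "f \<in> Hom (Cb C) X (disc Q)" and g: "g \<in> Hom (Cb C) X (disc Q)"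
    and eq: "\<And>i. pr1 (Q i) (Q (i + 1)) \<cdot> Component f i = pr1 (Q i) (Q (i + 1)) \<cdot> Component g i"
  shows "f = g"
proof (rule Cb_eqI)
  note [simp] = bounded_family_Obj[OF Q]
  have X: "X \<in> Obj (Cb C)" using f by auto
  have A [simp]: "f \<in> Arr (Cb C)" "Dom (Cb C) f = X" "Cod (Cb C) f = disc Q"
    "g \<in> Arr (Cb C)" "Dom (Cb C) g = X" "Cod (Cb C) g = disc Q" using f g by auto
  have 2: "pr2 (Q i) (Q (i + 1)) \<cdot> Component h i =
      pr1 (Q (i + 1)) (Q (i + 1 + 1)) \<cdot> Component h (i + 1) \<cdot> Diff X i"
    if h: "h \<in> Hom (Cb C) X (disc Q)" for h i
  proof -
    have B [simp]: "h \<in> Arr (Cb C)" "Dom (Cb C) h = X" "Cod (Cb C) h = disc Q" using h by auto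
    have "pr2 (Q i) (Q (i + 1)) \<cdot> Component h i =
        pr1 (Q (i + 1)) (Q (i + 1 + 1)) \<cdot> (Diff (disc Q) i \<cdot> Component h i)" by simp
    also have "\<dots> = pr1 (Q (i + 1)) (Q (i + 1 + 1)) \<cdot> (Component h (i + 1) \<cdot> Diff X i)"
      using Diff_Component[OF B(1), of i] by simp
    also have "\<dots> = pr1 (Q (i + 1)) (Q (i + 1 + 1)) \<cdot> Component h (i + 1) \<cdot> Diff X i" using X by simp
    finally show ?thesis .
  qed
  fix i
  show "Component f i = Component g i"
    by (rule eq_into_sum[of "Q i" "Q (i + 1)"])
      (use eq[of "i + 1"] in \<open>simp_all add: eq 2[OF f] 2[OF g] del: Comp_assoc_Arr\<close>)
qed (use f g in auto)

text \<open>The first summand of degree \<open>i + 1\<close> is the image of the second summand of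
  degree \<open>i\<close> under the differential, so agreement on second summands spreads to the
  first ones.\<close>

lemma eq_from_disc:
  assumes Q: "bounded_family Q" and f: "f \<in> Hom (Cb C) (disc Q) X" and g: "g \<in> Hom (Cb C) (disc Q) X"
    and eq: "\<And>i. Component f i \<cdot> in2 (Q i) (Q (i + 1)) = Component g i \<cdot> in2 (Q i) (Q (i + 1))"
  shows "f = g"
proof (rule Cb_eqI)
  note [simp] = bounded_family_Obj[OF Q]
  have X: "X \<in> Obj (Cb C)" using f by auto
  have A [simp]: "f \<in> Arr (Cb C)" "Cod (Cb C) f = X" "Dom (Cb C) f = disc Q"
    "g \<in> Arr (Cb C)" "Cod (Cb C) g = X" "Dom (Cb C) g = disc Q" using f g by auto
  have 1: "Component h (i + 1) \<cdot> in1 (Q (i + 1)) (Q (i + 1 + 1)) =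
      Diff X i \<cdot> (Component h i \<cdot> in2 (Q i) (Q (i + 1)))"
    if h: "h \<in> Hom (Cb C) (disc Q) X" for h i
  proof -
    have B [simp]: "h \<in> Arr (Cb C)" "Cod (Cb C) h = X" "Dom (Cb C) h = disc Q" using h by auto
    have "Component h (i + 1) \<cdot> in1 (Q (i + 1)) (Q (i + 1 + 1)) =
        (Component h (i + 1) \<cdot> Diff (disc Q) i) \<cdot> in2 (Q i) (Q (i + 1))" by simp
    also have "\<dots> = (Diff X i \<cdot> Component h i) \<cdot> in2 (Q i) (Q (i + 1))"
      using Diff_Component[OF B(1), of i] by simp
    also have "\<dots> = Diff X i \<cdot> (Component h i \<cdot> in2 (Q i) (Q (i + 1)))" using X by simp
    finally show ?thesis .
  qed
  fix i
  show "Component f i = Component g i"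
    by (rule eq_from_sum[of "Q i" "Q (i + 1)"])
      (use 1[OF f, of "i - 1"] 1[OF g, of "i - 1"] eq[of "i - 1"] in \<open>simp_all add: eq\<close>)
qed (use f g in auto)

text \<open>Chain maps out of \<open>disc Q\<close> are families of arrows from the projectives
  \<open>Q (i + 1)\<close>, and the components of an epimorphism of complexes are epi. So lifts can
  be chosen in each degree separately.\<close>

lemma disc_projective:
  assumes Q: "bounded_family Q" and P: "\<And>i. projective C (Q i)"
  shows "projective (Cb C) (disc Q)"
  unfolding projective_def
proof (intro conjI allI impI)
  note [simp] = bounded_family_Obj[OF Q]
  show "disc Q \<in> Obj (Cb C)" by (rule disc_Obj[OF Q])
  fix e f assume ef: "epimorphism (Cb C) e \<and> f \<in> Hom (Cb C) (disc Q) (Cod (Cb C) e)"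
  then have A [simp]: "e \<in> Arr (Cb C)" "f \<in> Arr (Cb C)" "Dom (Cb C) f = disc Q" "Cod (Cb C) f = Cod (Cb C) e"
    by (auto simp: epimorphism_def)
  let ?X = "Dom (Cb C) e"
  have "\<exists>g\<in>Hom C (Q (i + 1)) (Dom C (Component e i)).
      Component e i \<cdot> g = Component f i \<cdot> in2 (Q i) (Q (i + 1))" for i
  proof -
    have "Component f i \<cdot> in2 (Q i) (Q (i + 1)) \<in> Hom C (Q (i + 1)) (Cod C (Component e i))" by simp
    then show ?thesis using P[of "i + 1"] Cb_epiD[of e i] ef unfolding projective_def by blast
  qed
  then obtain \<psi> where \<psi>: "\<And>i. \<psi> i \<in> Hom C (Q (i + 1)) (Dom C (Component e i))"
    "\<And>i. Component e i \<cdot> \<psi> i = Component f i \<cdot> in2 (Q i) (Q (i + 1))" by metis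
  have \<psi>' [simp]: "\<psi> i \<in> Arr C" "Dom C (\<psi> i) = Q (i + 1)" "Cod C (\<psi> i) = Term ?X i" for i
    using \<psi>(1)[of i] by simp_all
  have X: "?X \<in> Obj (Cb C)" by simp
  have g: "from_disc ?X Q \<psi> \<in> Arr (Cb C)" by (rule from_disc_Arr[OF X Q]) simp
  have "e \<cdot>\<^bsub>Cb C\<^esub> from_disc ?X Q \<psi> = f"
  proof (rule eq_from_disc[OF Q])
    fix i
    have "Component (from_disc ?X Q \<psi>) i \<cdot> in2 (Q i) (Q (i + 1)) = \<psi> i"
      using X by (simp add: from_disc_def)
    then show "Component (e \<cdot>\<^bsub>Cb C\<^esub> from_disc ?X Q \<psi>) i \<cdot> in2 (Q i) (Q (i + 1)) =
      Component f i \<cdot> in2 (Q i) (Q (i + 1))"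
      using g \<psi>(2)[of i] by simp
  qed (use g in simp_all)
  then show "\<exists>g\<in>Hom (Cb C) (disc Q) (Dom (Cb C) e). e \<cdot>\<^bsub>Cb C\<^esub> g = f"
    using g by (intro bexI[of _ "from_disc ?X Q \<psi>"]) simp_all
qed

end

lemma (in category) epi_if_Comp_epi:
  assumes fg: "epimorphism C (g \<cdot> f)" and f: "f \<in> Arr C" and g: "g \<in> Arr C" "Cod C f = Dom C g"
  shows "epimorphism C g"
  unfolding epimorphism_def
proof (intro conjI ballI impI)
  fix W x y assume xy: "x \<in> Hom C (Cod C g) W" "y \<in> Hom C (Cod C g) W" "x \<cdot> g = y \<cdot> g"
  have "x \<cdot> (g \<cdot> f) = (x \<cdot> g) \<cdot> f" using xy(1) f g by simp
  also have "\<dots> = (y \<cdot> g) \<cdot> f" unfolding xy(3) ..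
  also have "\<dots> = y \<cdot> (g \<cdot> f)" using xy(2) f g by simp
  finally show "x = y" by (rule epi_cancel[OF fg]) (use xy f g in simp_all)
qed (rule g)

section \<open>Projectives, approximations, syzygies and cosyzygies of complexes\<close>

context abelian_category
begin

interpretation Cb: abelian_category "Cb C" by (rule abelian_category_Cb)

text \<open>An epimorphism from a projective onto each term is extended by \<open>from_disc\<close>;
  the components stay epi because each restricts to the given one on the second summand.\<close>

lemma ex_disc_epi:
  assumes en: "enough_projectives C" and X: "X \<in> Obj (Cb C)"
  obtains Q r where "bounded_family Q" "\<And>i. projective C (Q i)" "epimorphism (Cb C) r"
    "r \<in> Hom (Cb C) (disc Q) X"
proof -
  \<comment> \<open>A zero term is covered by its identity, so that the family of projectives stays
    bounded.\<close>
  have "\<exists>e. epimorphism C e \<and> projective C (Dom C e) \<and> Cod C e = Term X i \<and>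
      (zero_object C (Term X i) \<longrightarrow> zero_object C (Dom C e))" for i
  proof (cases "zero_object C (Term X i)")
    case True
    then show ?thesis using zero_projective[OF True] X split_epi[of "Idn C (Term X i)" "Idn C (Term X i)"]
      by (intro exI[of _ "Idn C (Term X i)"]) simp
  next
    case False
    then show ?thesis using en X unfolding enough_projectives_def by (meson Term_Obj)
  qed
  then obtain e where e: "\<And>i. epimorphism C (e i)" "\<And>i. projective C (Dom C (e i))"
    "\<And>i. Cod C (e i) = Term X i" "\<And>i. zero_object C (Term X i) \<Longrightarrow> zero_object C (Dom C (e i))"
    by metis
  have eA [simp]: "e i \<in> Arr C" "Cod C (e i) = Term X i" for i
    using e(1,3) by (auto simp: epimorphism_def)
  \<comment> \<open>The shift by one matches \<open>from_disc\<close>, whose arrow into degree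
    \<open>i\<close> starts at \<open>Q (i + 1)\<close>.\<close>
  define Q where "Q i = Dom C (e (i - 1))" for i
  have [simp]: "Q (i + 1) = Dom C (e i)" for i by (simp add: Q_def)
  have QO [simp]: "Q i \<in> Obj C" for i by (simp add: Q_def)
  obtain a b where "\<And>i. i < a \<or> b < i \<Longrightarrow> zero_object C (Term X i)"
    using X unfolding Obj_Cb_iff is_bounded_def by blast
  then have "zero_object C (Q i)" if "i < a \<or> b + 1 < i" for i
    unfolding Q_def using that by (intro e(4)) auto
  then have Q: "bounded_family Q" unfolding bounded_family_def using QO by blast
  have r: "from_disc X Q e \<in> Arr (Cb C)" by (rule from_disc_Arr[OF X Q]) simp
  have "epimorphism C (Component (from_disc X Q e) i)" for i
  proof (rule epi_if_Comp_epi)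
    have "Component (from_disc X Q e) i \<cdot> in2 (Q i) (Q (i + 1)) = e i"
      using X by (simp add: from_disc_def Q_def)
    then show "epimorphism C (Component (from_disc X Q e) i \<cdot> in2 (Q i) (Q (i + 1)))" using e(1) by simp
  qed (use r in simp_all)
  then have "epimorphism (Cb C) (from_disc X Q e)" by (rule Cb_epiI[OF r])
  moreover have "projective C (Q i)" for i unfolding Q_def by (rule e(2))
  ultimately show ?thesis using that Q r by simp
qed

text \<open>An epimorphism onto a projective splits; it is applied to the cover by a contractible
  complex.\<close>

lemma projective_Cb_retract:
  assumes en: "enough_projectives C" and R: "projective (Cb C) R"
  obtains Q r s where "bounded_family Q" "\<And>i. projective C (Q i)" "r \<in> Hom (Cb C) (disc Q) R"
    "s \<in> Hom (Cb C) R (disc Q)" "r \<cdot>\<^bsub>Cb C\<^esub> s = Idn (Cb C) R"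
proof -
  have RO: "R \<in> Obj (Cb C)" using R by (simp add: projective_def)
  obtain Q r where Q: "bounded_family Q" "\<And>i. projective C (Q i)" and r: "epimorphism (Cb C) r"
    "r \<in> Hom (Cb C) (disc Q) R" using ex_disc_epi[OF en RO] by metis
  have "Idn (Cb C) R \<in> Hom (Cb C) R (Cod (Cb C) r)" using r(2) RO by simp
  then obtain s where "s \<in> Hom (Cb C) R (Dom (Cb C) r)" "r \<cdot>\<^bsub>Cb C\<^esub> s = Idn (Cb C) R"
    using R r(1) unfolding projective_def by blast
  then show ?thesis using that Q r(2) by simp
qed

lemma projective_Term:
  assumes en: "enough_projectives C" and R: "projective (Cb C) R"
  shows "projective C (Term R i)"
proof -
  obtain Q r s where Q: "bounded_family Q" "\<And>i. projective C (Q i)"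
    and r: "r \<in> Hom (Cb C) (disc Q) R" and s: "s \<in> Hom (Cb C) R (disc Q)"
    and rs: "r \<cdot>\<^bsub>Cb C\<^esub> s = Idn (Cb C) R"
    using projective_Cb_retract[OF en R] by metis
  note [simp] = bounded_family_Obj[OF Q(1)]
  have "Component r i \<cdot> Component s i = Component (r \<cdot>\<^bsub>Cb C\<^esub> s) i" by simp
  then have "Component r i \<cdot> Component s i = Idn C (Term R i)" unfolding rs by simp
  moreover have "projective C (sum_obj (Q i) (Q (i + 1)))"
    by (rule biproduct.projective_biproduct[OF biproduct_sum_obj]) (use Q in simp_all)
  moreover have "Component r i \<in> Hom C (sum_obj (Q i) (Q (i + 1))) (Term R i)"
    "Component s i \<in> Hom C (Term R i) (sum_obj (Q i) (Q (i + 1)))" using r s by auto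
  ultimately show ?thesis using retract_projective by blast
qed

text \<open>An arrow from one term to a projective \<open>R\<close> is the same as a chain map to
  the disc complex of \<open>R\<close> concentrated at that index. It extends along
  \<open>f\<close>, and \<open>pr1\<close> reads off the required extension.\<close>

lemma left_projective_approximation_Component:
  assumes en: "enough_projectives C" and f: "left_projective_approximation (Cb C) f"
  shows "left_projective_approximation C (Component f i)"
  unfolding left_projective_approximation_def
proof (intro conjI allI impI ballI)
  have A [simp]: "f \<in> Arr (Cb C)" and P: "projective (Cb C) (Cod (Cb C) f)"
    using f by (auto simp: left_projective_approximation_def)
  let ?X = "Dom (Cb C) f"
  show "Component f i \<in> Arr C" "projective C (Cod C (Component f i))"
    using projective_Term[OF en P] by simp_all
  fix R g assume R: "projective C R" and "g \<in> Hom C (Dom C (Component f i)) R"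
  then have g [simp]: "g \<in> Arr C" "Dom C g = Term ?X i" "Cod C g = R" by auto
  have X: "?X \<in> Obj (Cb C)" by simp
  obtain Z where Z: "zero_object C Z" using ex_zero_object by blast
  then have ZO [simp]: "Z \<in> Obj C" by (simp add: zero_object_def)
  \<comment> \<open>The value \<open>R\<close> sits at index \<open>i\<close>, since arrows into
    \<open>Q i\<close> are tested against the term of degree \<open>i\<close>.\<close>
  define Q where "Q k = (if k = i then R else Z)" for k
  define \<phi> where "\<phi> k = (if k = i then g else Zero C (Term ?X k) Z)" for k
  have RO [simp]: "R \<in> Obj C" using R by (simp add: projective_def)
  have [simp]: "Q k \<in> Obj C" for k by (simp add: Q_def)
  have "zero_object C (Q k)" if "k < i \<or> i < k" for k using that Z by (auto simp: Q_def)
  then have Q: "bounded_family Q" unfolding bounded_family_def by auto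
  have "projective C (Q k)" for k using R zero_projective[OF Z] by (simp add: Q_def)
  then have D: "projective (Cb C) (disc Q)" by (rule disc_projective[OF Q])
  have \<phi>: "\<phi> k \<in> Hom C (Term ?X k) (Q k)" for k using X by (simp add: \<phi>_def Q_def)
  have \<phi>' [simp]: "\<phi> k \<in> Arr C" "Dom C (\<phi> k) = Term ?X k" "Cod C (\<phi> k) = Q k" for k using \<phi> by auto
  have "into_disc ?X Q \<phi> \<in> Arr (Cb C)" by (rule into_disc_Arr[OF X Q \<phi>])
  then obtain h where h: "h \<in> Arr (Cb C)" "Dom (Cb C) h = Cod (Cb C) f" "Cod (Cb C) h = disc Q"
    and hf: "h \<cdot>\<^bsub>Cb C\<^esub> f = into_disc ?X Q \<phi>"
    using Cb.left_projective_approximationE[OF f, of "into_disc ?X Q \<phi>"] D by auto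
  have "Component (h \<cdot>\<^bsub>Cb C\<^esub> f) i = Component (into_disc ?X Q \<phi>) i" using hf by simp
  then have "pr1 (Q i) (Q (i + 1)) \<cdot> (Component h i \<cdot> Component f i) =
      pr1 (Q i) (Q (i + 1)) \<cdot> Component (into_disc ?X Q \<phi>) i" by simp
  also have "\<dots> = \<phi> i" using X by (simp add: into_disc_def)
  finally have "(pr1 (Q i) (Q (i + 1)) \<cdot> Component h i) \<cdot> Component f i = g"
    using h by (simp add: \<phi>_def)
  moreover have "Q i = R" by (simp add: Q_def)
  ultimately show "\<exists>h\<in>Hom C (Cod C (Component f i)) R. h \<cdot> Component f i = g"
    using h by (intro bexI[of _ "pr1 (Q i) (Q (i + 1)) \<cdot> Component h i"]) simp_all
qed

text \<open>Write the target as a retract of some \<open>disc Q\<close> by \<open>r\<close> and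
  \<open>s\<close>. The map \<open>s\<close> after \<open>g\<close> is a family of arrows into
  projectives and extends in each degree; composing the extension with \<open>r\<close> returns to
  the target.\<close>

lemma left_projective_approximation_CbI:
  assumes en: "enough_projectives C" and f: "f \<in> Arr (Cb C)" and P: "projective (Cb C) (Cod (Cb C) f)"
    and l: "\<And>i. left_projective_approximation C (Component f i)"
  shows "left_projective_approximation (Cb C) f"
  unfolding left_projective_approximation_def
proof (intro conjI allI impI ballI)
  note [simp] = f
  let ?X = "Dom (Cb C) f" let ?Y = "Cod (Cb C) f"
  have X: "?X \<in> Obj (Cb C)" "?Y \<in> Obj (Cb C)" by simp_all
  show "f \<in> Arr (Cb C)" "projective (Cb C) (Cod (Cb C) f)" by fact+
  fix R g assume R: "projective (Cb C) R" and "g \<in> Hom (Cb C) (Dom (Cb C) f) R"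
  then have g [simp]: "g \<in> Arr (Cb C)" "Dom (Cb C) g = ?X" "Cod (Cb C) g = R" by auto
  obtain Q r s where Q: "bounded_family Q" "\<And>i. projective C (Q i)"
    and r: "r \<in> Hom (Cb C) (disc Q) R" and s: "s \<in> Hom (Cb C) R (disc Q)"
    and rs: "r \<cdot>\<^bsub>Cb C\<^esub> s = Idn (Cb C) R"
    using projective_Cb_retract[OF en R] by metis
  note [simp] = bounded_family_Obj[OF Q(1)]
  have r' [simp]: "r \<in> Arr (Cb C)" "Dom (Cb C) r = disc Q" "Cod (Cb C) r = R" using r by auto
  have s' [simp]: "s \<in> Arr (Cb C)" "Dom (Cb C) s = R" "Cod (Cb C) s = disc Q" using s by auto
  have "\<exists>h. h \<in> Hom C (Term ?Y i) (Q i) \<and>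
      h \<cdot> Component f i = pr1 (Q i) (Q (i + 1)) \<cdot> (Component s i \<cdot> Component g i)" for i
    by (rule left_projective_approximationE[OF l,
        of "pr1 (Q i) (Q (i + 1)) \<cdot> (Component s i \<cdot> Component g i)" i]) (use Q(2) in auto)
  then obtain h where h: "\<And>i. h i \<in> Hom C (Term ?Y i) (Q i)"
    "\<And>i. h i \<cdot> Component f i = pr1 (Q i) (Q (i + 1)) \<cdot> (Component s i \<cdot> Component g i)" by metis
  have h' [simp]: "h i \<in> Arr C" "Dom C (h i) = Term ?Y i" "Cod C (h i) = Q i" for i using h(1) by auto
  have H [simp]: "into_disc ?Y Q h \<in> Arr (Cb C)" by (rule into_disc_Arr[OF X(2) Q(1) h(1)])
  have "into_disc ?Y Q h \<cdot>\<^bsub>Cb C\<^esub> f = s \<cdot>\<^bsub>Cb C\<^esub> g"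
  proof (rule eq_into_disc[OF Q(1)])
    fix i
    have "pr1 (Q i) (Q (i + 1)) \<cdot> Component (into_disc ?Y Q h) i = h i"
      using X by (simp add: into_disc_def)
    then have "(pr1 (Q i) (Q (i + 1)) \<cdot> Component (into_disc ?Y Q h) i) \<cdot> Component f i =
      pr1 (Q i) (Q (i + 1)) \<cdot> (Component s i \<cdot> Component g i)" using h(2) by simp
    then show "pr1 (Q i) (Q (i + 1)) \<cdot> Component (into_disc ?Y Q h \<cdot>\<^bsub>Cb C\<^esub> f) i =
      pr1 (Q i) (Q (i + 1)) \<cdot> Component (s \<cdot>\<^bsub>Cb C\<^esub> g) i" by simp
  qed simp_all
  then have "(r \<cdot>\<^bsub>Cb C\<^esub> into_disc ?Y Q h) \<cdot>\<^bsub>Cb C\<^esub> f = r \<cdot>\<^bsub>Cb C\<^esub> (s \<cdot>\<^bsub>Cb C\<^esub> g)" by simp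
  also have "\<dots> = (r \<cdot>\<^bsub>Cb C\<^esub> s) \<cdot>\<^bsub>Cb C\<^esub> g" by simp
  also have "\<dots> = g" unfolding rs by simp
  finally show "\<exists>h\<in>Hom (Cb C) (Cod (Cb C) f) R. h \<cdot>\<^bsub>Cb C\<^esub> f = g"
    by (intro bexI[of _ "r \<cdot>\<^bsub>Cb C\<^esub> into_disc ?Y Q h"]) simp_all
qed

lemma approximation_sequence_Component:
  assumes "enough_projectives C" "approximation_sequence (Cb C) i p"
  shows "approximation_sequence C (Component i k) (Component p k)"
  using assms Cb_kernelD Cb_cokernelD left_projective_approximation_Component
  unfolding approximation_sequence_def by blast

lemma approximation_sequence_CbI:
  assumes "enough_projectives C" "i \<in> Arr (Cb C)" "p \<in> Arr (Cb C)" "Cod (Cb C) i = Dom (Cb C) p"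
    "projective (Cb C) (Cod (Cb C) i)" "\<And>k. approximation_sequence C (Component i k) (Component p k)"
  shows "approximation_sequence (Cb C) i p"
  using assms Cb_kernelI[of p i] Cb_cokernelI[of i p] left_projective_approximation_CbI[of i]
  unfolding approximation_sequence_def by simp

text \<open>The sequences need not be compatible with the differentials of \<open>X\<close>, so the
  new terms are controlled up to projective summands. The condition on zero terms makes the family
  of middle terms bounded.\<close>

lemma ex_cosyzygy_Cb:
  assumes en: "enough_projectives C" and X: "X \<in> Obj (Cb C)"
    and s: "\<And>k. approximation_sequence C (\<iota> k) (\<pi> k)" and dom: "\<And>k. Dom C (\<iota> k) = Term X k"
    and z: "\<And>k. zero_object C (Term X k) \<Longrightarrow> zero_object C (Cod C (\<iota> k))"
  obtains i p where "approximation_sequence (Cb C) i p" "Dom (Cb C) i = X"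
    "\<And>k. \<exists>Q e1 e2 r1 r2. projective C Q \<and> biproduct C (Cod C (\<pi> k)) Q (Term (Cod (Cb C) p) k) e1 e2 r1 r2"
proof -
  note S = approximation_sequenceD[OF s]
  define Q where "Q k = Cod C (\<iota> k)" for k
  have [simp]: "\<iota> k \<in> Arr C" "Dom C (\<iota> k) = Term X k" "Cod C (\<iota> k) = Q k" for k
    using S(4) dom by (auto simp: Q_def)
  have [simp]: "Q k \<in> Obj C" for k unfolding Q_def by (rule Cod_Obj[OF S(4)])
  obtain a b where "\<And>i. i < a \<or> b < i \<Longrightarrow> zero_object C (Term X i)"
    using X unfolding Obj_Cb_iff is_bounded_def by blast
  then have "zero_object C (Q i)" if "i < a \<or> b < i" for i using that z[of i] by simp
  then have Q: "bounded_family Q" unfolding bounded_family_def by auto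
  have QP: "projective C (Q k)" for k using S(10)[of k] by simp
  let ?i = "into_disc X Q \<iota>"
  have i [simp]: "?i \<in> Arr (Cb C)" by (rule into_disc_Arr[OF X Q]) simp
  obtain p where p: "is_cokernel (Cb C) p ?i" using Cb.ex_cokernel[OF i] by blast
  note P = Cb.is_cokernelD[OF p]
  have *: "approximation_sequence C (Component ?i k) (Component p k) \<and>
    (\<exists>Q e1 e2 r1 r2. projective C Q \<and> biproduct C (Cod C (\<pi> k)) Q (Term (Cod (Cb C) p) k) e1 e2 r1 r2)" for k
  proof -
    \<comment> \<open>The second coordinate of the component in degree \<open>k\<close> ends in the
      projective \<open>Q (k + 1)\<close>, so it extends along the approximation
      \<open>\<iota> k\<close>.\<close>
    obtain h where h: "h \<in> Arr C" "Dom C h = Q k" "Cod C h = Q (k + 1)" "h \<cdot> \<iota> k = \<iota> (k + 1) \<cdot> Diff X k"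
      using left_projective_approximationE[OF S(3), of "\<iota> (k + 1) \<cdot> Diff X k" k] QP X by auto
    obtain m where m: "m \<in> Arr C" "Dom C m = Dom C h" "Cod C m = Cod C h"
      "Plus C h m = Zero C (Dom C h) (Cod C h)" using ex_minus[OF h(1)] by metis
    have B: "biproduct C (Cod C (\<iota> k)) (Q (k + 1)) (sum_obj (Q k) (Q (k + 1)))
      (Plus C (in1 (Q k) (Q (k + 1))) (in2 (Q k) (Q (k + 1)) \<cdot> h)) (in2 (Q k) (Q (k + 1)))
      (pr1 (Q k) (Q (k + 1))) (Plus C (pr2 (Q k) (Q (k + 1))) (m \<cdot> pr1 (Q k) (Q (k + 1))))"
      using biproduct.biproduct_shear[OF biproduct_sum_obj[of "Q k" "Q (k + 1)"], of h m] h(1-3) m by simp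
    \<comment> \<open>By the choice of \<open>h\<close> the component is the sheared first injection
      after \<open>\<iota> k\<close>, so its cokernel is that of \<open>\<iota> k\<close> plus
      \<open>Q (k + 1)\<close>.\<close>
    have e: "Component ?i k = Plus C (in1 (Q k) (Q (k + 1))) (in2 (Q k) (Q (k + 1)) \<cdot> h) \<cdot> \<iota> k"
      using h X by (simp add: into_disc_def)
    have c: "is_cokernel C (Component p k) (Plus C (in1 (Q k) (Q (k + 1))) (in2 (Q k) (Q (k + 1)) \<cdot> h) \<cdot> \<iota> k)"
      using Cb_cokernelD[OF p, of k] unfolding e .
    have "Cod C (Component p k) = Term (Cod (Cb C) p) k" using P(1) by simp
    then show ?thesis
      using cokernel_of_injection_Comp[OF s QP B c] QP[of "k + 1"] unfolding e by metis
  qed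
  have "approximation_sequence (Cb C) ?i p"
    by (rule approximation_sequence_CbI[OF en]) (use P(1,3) * disc_projective[OF Q QP] in simp_all)
  then show ?thesis using that * by simp
qed

text \<open>Dual to the cosyzygy, with the two summands of each degree exchanged:
  \<open>\<pi> k\<close> is defined on the second summand \<open>Q (k + 1)\<close>, and
  \<open>Q k\<close> is the summand left over in the kernel.\<close>

lemma ex_syzygy_Cb:
  assumes en: "enough_projectives C" and X: "X \<in> Obj (Cb C)"
    and s: "\<And>k. approximation_sequence C (\<iota> k) (\<pi> k)" and cod: "\<And>k. Cod C (\<pi> k) = Term X k"
    and z: "\<And>k. zero_object C (Term X k) \<Longrightarrow> zero_object C (Cod C (\<iota> k))"
  obtains i p where "approximation_sequence (Cb C) i p" "Cod (Cb C) p = X"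
    "\<And>k. \<exists>Q e1 e2 r1 r2. projective C Q \<and> biproduct C (Dom C (\<iota> k)) Q (Term (Dom (Cb C) i) k) e1 e2 r1 r2"
proof -
  note S = approximation_sequenceD[OF s]
  \<comment> \<open>The middle term over degree \<open>k\<close> must be \<open>Q (k + 1)\<close>,
    as \<open>from_disc\<close> requires.\<close>
  define Q where "Q k = Cod C (\<iota> (k - 1))" for k
  have Q1: "Q (k + 1) = Cod C (\<iota> k)" for k by (simp add: Q_def)
  have [simp]: "\<pi> k \<in> Arr C" "Dom C (\<pi> k) = Q (k + 1)" "Cod C (\<pi> k) = Term X k" for k
    using S(5,6)[of k] cod by (auto simp: Q_def)
  have [simp]: "Q k \<in> Obj C" for k unfolding Q_def by (rule Cod_Obj[OF S(4)])
  obtain a b where "\<And>i. i < a \<or> b < i \<Longrightarrow> zero_object C (Term X i)"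
    using X unfolding Obj_Cb_iff is_bounded_def by blast
  then have "zero_object C (Q i)" if "i < a \<or> b + 1 < i" for i
    unfolding Q_def using that by (intro z) auto
  then have Q: "bounded_family Q" unfolding bounded_family_def using \<open>\<And>k. Q k \<in> Obj C\<close> by blast
  have QP: "projective C (Q k)" for k unfolding Q_def by (rule S(10))
  let ?p = "from_disc X Q \<pi>"
  have p [simp]: "?p \<in> Arr (Cb C)" by (rule from_disc_Arr[OF X Q]) simp
  obtain i where i: "is_kernel (Cb C) i ?p" using Cb.ex_kernel[OF p] by blast
  note P = Cb.is_kernelD[OF i]
  have *: "approximation_sequence C (Component i k) (Component ?p k) \<and>
    (\<exists>Q e1 e2 r1 r2. projective C Q \<and> biproduct C (Dom C (\<iota> k)) Q (Term (Dom (Cb C) i) k) e1 e2 r1 r2)" for k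
  proof -
    have k1 [simp]: "\<pi> (k - 1) \<in> Arr C" "Dom C (\<pi> (k - 1)) = Q k" "Cod C (\<pi> (k - 1)) = Term X (k - 1)"
      "Cod C (Diff X (k - 1)) = Term X k"
      using \<open>\<And>k. Dom C (\<pi> k) = Q (k + 1)\<close>[of "k - 1"] X by simp_all
    \<comment> \<open>The value on the first summand starts at the projective \<open>Q k\<close>, so
      it lifts through the epimorphism \<open>\<pi> k\<close>.\<close>
    have "Diff X (k - 1) \<cdot> \<pi> (k - 1) \<in> Hom C (Q k) (Cod C (\<pi> k))" using X by simp
    then obtain h where "h \<in> Hom C (Q k) (Dom C (\<pi> k))" "\<pi> k \<cdot> h = Diff X (k - 1) \<cdot> \<pi> (k - 1)"
      using QP[of k] S(9)[of k] unfolding projective_def by blast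
    then have h: "h \<in> Arr C" "Dom C h = Q k" "Cod C h = Q (k + 1)"
      "\<pi> k \<cdot> h = Diff X (k - 1) \<cdot> \<pi> (k - 1)" by simp_all
    obtain m where m: "m \<in> Arr C" "Dom C m = Dom C h" "Cod C m = Cod C h"
      "Plus C m h = Zero C (Dom C h) (Cod C h)" using ex_minus[OF h(1)] by metis
    \<comment> \<open>Shearing by \<open>m\<close>, the negative of \<open>h\<close>, puts
      \<open>h\<close> itself into the projection; the swap then makes the summand that carries
      \<open>\<pi> k\<close> the first one.\<close>
    have "biproduct C (Q (k + 1)) (Q k) (sum_obj (Q k) (Q (k + 1)))
      (in2 (Q k) (Q (k + 1))) (Plus C (in1 (Q k) (Q (k + 1))) (in2 (Q k) (Q (k + 1)) \<cdot> m))
      (Plus C (pr2 (Q k) (Q (k + 1))) (h \<cdot> pr1 (Q k) (Q (k + 1)))) (pr1 (Q k) (Q (k + 1)))"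
      by (rule biproduct.biproduct_commute, rule biproduct.biproduct_shear[OF biproduct_sum_obj])
        (use h(1-3) m in simp_all)
    note B = this[unfolded Q1[of k]]
    have e: "Component ?p k = \<pi> k \<cdot> Plus C (pr2 (Q k) (Q (k + 1))) (h \<cdot> pr1 (Q k) (Q (k + 1)))"
    proof -
      have "\<pi> k \<cdot> (h \<cdot> pr1 (Q k) (Q (k + 1))) = (\<pi> k \<cdot> h) \<cdot> pr1 (Q k) (Q (k + 1))" using h(1-3) by simp
      also have "\<dots> = Diff X (k - 1) \<cdot> (\<pi> (k - 1) \<cdot> pr1 (Q k) (Q (k + 1)))"
        unfolding h(4) using X by simp
      finally show ?thesis using h(1-3) X by (simp add: from_disc_def)
    qed
    have c: "is_kernel C (Component i k) (\<pi> k \<cdot> Plus C (pr2 (Q k) (Q (k + 1))) (h \<cdot> pr1 (Q k) (Q (k + 1))))"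
      using Cb_kernelD[OF i, of k] unfolding e .
    have "Dom C (Component i k) = Term (Dom (Cb C) i) k" using P(1) by simp
    then show ?thesis
      using kernel_of_projection_Comp[OF s QP B c[unfolded Q1[of k]]] QP[of k] unfolding e Q1[of k] by metis
  qed
  have "approximation_sequence (Cb C) i ?p"
    by (rule approximation_sequence_CbI[OF en]) (use P(1,3) * disc_projective[OF Q QP] in simp_all)
  then show ?thesis using that * by simp
qed

text \<open>Zero terms are resolved by zero objects, so that the complexes built from the chosen sequences
  are bounded.\<close>

lemma ex_cosyzygy_zero:
  assumes "\<exists>i p. approximation_sequence C i p \<and> Dom C i = M \<and> S (Cod C p)"
    and "\<And>Z. zero_object C Z \<Longrightarrow> S Z"
  shows "\<exists>i p. approximation_sequence C i p \<and> Dom C i = M \<and> S (Cod C p) \<and>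
    (zero_object C M \<longrightarrow> zero_object C (Cod C i))"
proof (cases "zero_object C M")
  case True
  then have "M \<in> Obj C" by (simp add: zero_object_def)
  then show ?thesis using approximation_sequence_zero[OF True] assms(2)[OF True] True
    by (intro exI[of _ "Idn C M"] exI[of _ "Zero C M M"]) simp
qed (use assms(1) in blast)

lemma ex_syzygy_zero:
  assumes "\<exists>i p. approximation_sequence C i p \<and> Cod C p = M \<and> S (Dom C i)"
    and "\<And>Z. zero_object C Z \<Longrightarrow> S Z"
  shows "\<exists>i p. approximation_sequence C i p \<and> Cod C p = M \<and> S (Dom C i) \<and>
    (zero_object C M \<longrightarrow> zero_object C (Cod C i))"
proof (cases "zero_object C M")
  case True
  then have "M \<in> Obj C" by (simp add: zero_object_def)
  then show ?thesis using approximation_sequence_zero[OF True] assms(2)[OF True] True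
    by (intro exI[of _ "Idn C M"] exI[of _ "Zero C M M"]) simp
qed (use assms(1) in blast)

text \<open>The complex varies in the induction because the hypothesis is applied to a cosyzygy
  complex. One direction restricts an approximation sequence to each degree, the other assembles one
  from the terms.\<close>

theorem torsionfree_Cb_iff:
  assumes en: "enough_projectives C" and X: "X \<in> Obj (Cb C)"
  shows "torsionfree n (Cb C) X \<longleftrightarrow> (\<forall>k. torsionfree n C (Term X k))"
  using X
proof (induction n arbitrary: X)
  case 0
  then show ?case using torsionfree_0 Cb.torsionfree_0 by simp
next
  case (Suc n)
  show ?case
  proof
    assume "torsionfree (Suc n) (Cb C) X"
    then obtain i p where ip: "approximation_sequence (Cb C) i p" "Dom (Cb C) i = X"
      "torsionfree n (Cb C) (Cod (Cb C) p)" using Cb.torsionfree_Suc_iff by blast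
    note P = Cb.approximation_sequenceD[OF ip(1)]
    have "torsionfree n C (Term (Cod (Cb C) p) k)" for k
      using Suc.IH[of "Cod (Cb C) p"] ip(3) P(5) by simp
    then have "torsionfree (Suc n) C (Dom C (Component i k))" for k
      using torsionfree_SucI[OF approximation_sequence_Component[OF en ip(1)]] P(5) by simp
    then show "\<forall>k. torsionfree (Suc n) C (Term X k)" using P(4) ip(2) by simp
  next
    assume "\<forall>k. torsionfree (Suc n) C (Term X k)"
    then have "\<exists>i p. approximation_sequence C i p \<and> Dom C i = Term X k \<and> torsionfree n C (Cod C p) \<and>
        (zero_object C (Term X k) \<longrightarrow> zero_object C (Cod C i))" for k
      by (intro ex_cosyzygy_zero torsionfree_zero) (simp_all add: torsionfree_Suc_iff)
    then obtain \<iota> \<pi> where s: "\<And>k. approximation_sequence C (\<iota> k) (\<pi> k)" "\<And>k. Dom C (\<iota> k) = Term X k"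
      "\<And>k. torsionfree n C (Cod C (\<pi> k))" "\<And>k. zero_object C (Term X k) \<Longrightarrow> zero_object C (Cod C (\<iota> k))"
      by metis
    obtain i p where ip: "approximation_sequence (Cb C) i p" "Dom (Cb C) i = X"
      and b: "\<And>k. \<exists>Q e1 e2 r1 r2. projective C Q \<and> biproduct C (Cod C (\<pi> k)) Q (Term (Cod (Cb C) p) k) e1 e2 r1 r2"
      using ex_cosyzygy_Cb[OF en Suc.prems s(1,2,4)] by blast
    \<comment> \<open>Each term of the new complex is a chosen cosyzygy plus a projective, which
      closure under projective summands absorbs.\<close>
    have "torsionfree n C (Term (Cod (Cb C) p) k)" for k
      using b[of k] torsionfree_biproduct[OF s(3)] by blast
    then have "torsionfree n (Cb C) (Cod (Cb C) p)"
      using Suc.IH[of "Cod (Cb C) p"] Cb.approximation_sequenceD(5)[OF ip(1)] by simp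
    then show "torsionfree (Suc n) (Cb C) X" using ip Cb.torsionfree_Suc_iff by blast
  qed
qed

text \<open>Restriction to one degree carries a chain for \<open>X\<close> to a chain for its term.
  A converse by prescribing chains for all terms at once fails, since each step alters the terms by
  projective summands; coinduction asks for one step at a time.\<close>

theorem GP_Cb_iff:
  assumes en: "enough_projectives C" and X: "X \<in> Obj (Cb C)"
  shows "X \<in> GP (Cb C) \<longleftrightarrow> (\<forall>k. Term X k \<in> GP C)"
proof
  assume "X \<in> GP (Cb C)"
  then obtain i p :: "int \<Rightarrow> ('a, 'b) chain_map" where ip: "\<And>j. approximation_sequence (Cb C) (i j) (p j)"
    "\<And>j. Cod (Cb C) (p j) = Dom (Cb C) (i (j + 1))" "Dom (Cb C) (i 0) = X" using Cb.GP_E by metis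
  note P = Cb.approximation_sequenceD[OF ip(1)]
  have "Dom C (Component (i 0) k) \<in> GP C" for k
    using GP_I[of "\<lambda>j. Component (i j) k" "\<lambda>j. Component (p j) k"]
      approximation_sequence_Component[OF en ip(1)] ip(2) P(4,5) by simp
  then show "\<forall>k. Term X k \<in> GP C" using ip(3) P(4) by simp
next
  assume GP: "\<forall>k. Term X k \<in> GP C"
  show "X \<in> GP (Cb C)"
  \<comment> \<open>The class consists of all complexes with Gorenstein projective terms; it is
    closed under both steps because \<open>GP C\<close> absorbs projective summands.\<close>
  proof (rule Cb.GP_coinduct[where S = "{X \<in> Obj (Cb C). \<forall>k. Term X k \<in> GP C}"])
    show "X \<in> {X \<in> Obj (Cb C). \<forall>k. Term X k \<in> GP C}" using X GP by blast
    fix M assume M: "M \<in> {X \<in> Obj (Cb C). \<forall>k. Term X k \<in> GP C}"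
    then have MO: "M \<in> Obj (Cb C)" by blast
    have "\<exists>i p. approximation_sequence C i p \<and> Dom C i = Term M k \<and> Cod C p \<in> GP C \<and>
        (zero_object C (Term M k) \<longrightarrow> zero_object C (Cod C i))" for k
      using M GP_cosyzygy by (intro ex_cosyzygy_zero GP_zero) blast+
    then obtain \<iota> \<pi> where s: "\<And>k. approximation_sequence C (\<iota> k) (\<pi> k)" "\<And>k. Dom C (\<iota> k) = Term M k"
      "\<And>k. Cod C (\<pi> k) \<in> GP C" "\<And>k. zero_object C (Term M k) \<Longrightarrow> zero_object C (Cod C (\<iota> k))"
      by metis
    obtain i p where ip: "approximation_sequence (Cb C) i p" "Dom (Cb C) i = M"
      and b: "\<And>k. \<exists>Q e1 e2 r1 r2. projective C Q \<and> biproduct C (Cod C (\<pi> k)) Q (Term (Cod (Cb C) p) k) e1 e2 r1 r2"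
      using ex_cosyzygy_Cb[OF en MO s(1,2,4)] by blast
    have "Term (Cod (Cb C) p) k \<in> GP C" for k using b[of k] GP_biproduct[OF s(3)] by blast
    then show "\<exists>i p. approximation_sequence (Cb C) i p \<and> Dom (Cb C) i = M \<and>
        Cod (Cb C) p \<in> {X \<in> Obj (Cb C). \<forall>k. Term X k \<in> GP C}"
      using ip Cb.Cod_Obj[OF Cb.approximation_sequenceD(5)[OF ip(1)]] by blast
    have "\<exists>i p. approximation_sequence C i p \<and> Cod C p = Term M k \<and> Dom C i \<in> GP C \<and>
        (zero_object C (Term M k) \<longrightarrow> zero_object C (Cod C i))" for k
      using M GP_syzygy by (intro ex_syzygy_zero GP_zero) blast+
    then obtain \<iota> \<pi> where s: "\<And>k. approximation_sequence C (\<iota> k) (\<pi> k)" "\<And>k. Cod C (\<pi> k) = Term M k"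
      "\<And>k. Dom C (\<iota> k) \<in> GP C" "\<And>k. zero_object C (Term M k) \<Longrightarrow> zero_object C (Cod C (\<iota> k))"
      by metis
    obtain i p where ip: "approximation_sequence (Cb C) i p" "Cod (Cb C) p = M"
      and b: "\<And>k. \<exists>Q e1 e2 r1 r2. projective C Q \<and> biproduct C (Dom C (\<iota> k)) Q (Term (Dom (Cb C) i) k) e1 e2 r1 r2"
      using ex_syzygy_Cb[OF en MO s(1,2,4)] by blast
    have "Term (Dom (Cb C) i) k \<in> GP C" for k using b[of k] GP_biproduct[OF s(3)] by blast
    then show "\<exists>i p. approximation_sequence (Cb C) i p \<and> Cod (Cb C) p = M \<and>
        Dom (Cb C) i \<in> {X \<in> Obj (Cb C). \<forall>k. Term X k \<in> GP C}"
      using ip Cb.Dom_Obj[OF Cb.approximation_sequenceD(4)[OF ip(1)]] by blast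
  qed
qed

end

theorem proposition3p8:
  fixes A :: "('o, 'm) cat" and n :: nat and X :: "('o, 'm) cochain"
  assumes "abelian_category A"
    and "enough_projectives A"
    and "n \<ge> 1"
    and "X \<in> Obj (Cb A)"
  shows "(X \<in> Tf n (Cb A) \<longleftrightarrow> (\<forall>i. Term X i \<in> Tf n A)) \<and>
    (X \<in> Tf_infinity (Cb A) \<longleftrightarrow> (\<forall>i. Term X i \<in> Tf_infinity A)) \<and>
    (X \<in> GP (Cb A) \<longleftrightarrow> (\<forall>i. Term X i \<in> GP A))"
proof -
  \<comment> \<open>The equivalence is recorded for every \<open>m\<close>, so that it can also be
    intersected over all positive integers.\<close>
  have Tf: "X \<in> Tf m (Cb A) \<longleftrightarrow> (\<forall>i. Term X i \<in> Tf m A)" for m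
    using abelian_category.torsionfree_Cb_iff[OF assms(1,2,4)] Term_Obj[OF assms(4)] assms(4)
    by (simp add: Tf_def)
  then have "X \<in> Tf_infinity (Cb A) \<longleftrightarrow> (\<forall>i. Term X i \<in> Tf_infinity A)"
    by (auto simp: Tf_infinity_def)
  then show ?thesis using Tf abelian_category.GP_Cb_iff[OF assms(1,2,4)] by blast
qed

end
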